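(* If $\mathfrak g=\mathfrak{sp}_{2n}$, then for every nilradical $\mathfrak n$ in $\mathfrak g$ the coadjoint representation $(\mathfrak n:\mathfrak n^* )$ has a generic stabiliser.
   Context: Everything is over $\mathbb C$. A nilradical in $\mathfrak g$ means the nilradical $\mathfrak n$ of a standard parabolic subalgebra of $\mathfrak g$ (i.e. one containing a fixed Borel subalgebra); $N=\exp(\mathfrak n)$. The coadjoint representation of $\mathfrak n$ has a generic stabiliser if there is a dense open subset $\Omega\subset\mathfrak n^*$ such that the stabilisers $\mathfrak n^\xi=\{x\in\mathfrak n\mid \mathrm{ad}^*(x)\xi=0\}$, $\xi\in\Omega$, are all conjugate under $N$. *)

theory Defs
  imports "HOL-Analysis.Analysis"
begin

section \<open>Lie subalgebras of $\mathfrak{gl}_m(\mathbb C)$\<close>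

text \<open>HOL-Analysis provides only the real vector space structure on \<open>complex^'m^'m\<close>;
  subspaces, spans and linear functionals below are all complex.\<close>

definition cscale :: "complex \<Rightarrow> complex^'m^'m \<Rightarrow> complex^'m^'m" where
  "cscale c A = (\<chi> i j. c * A $ i $ j)"

interpretation gl: vector_space "cscale :: complex \<Rightarrow> complex^'m^'m \<Rightarrow> complex^'m^'m"
  by standard (simp_all add: cscale_def vec_eq_iff algebra_simps)

definition lie_bracket :: "complex^'m^'m \<Rightarrow> complex^'m^'m \<Rightarrow> complex^'m^'m" where
  "lie_bracket A B = A ** B - B ** A"

definition lie_subalgebra :: "(complex^'m^'m) set \<Rightarrow> bool" where
  "lie_subalgebra \<gg> \<longleftrightarrow>
     gl.subspace \<gg> \<and> (\<forall>x\<in>\<gg>. \<forall>y\<in>\<gg>. lie_bracket x y \<in> \<gg>)"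

definition lie_ideal :: "(complex^'m^'m) set \<Rightarrow> (complex^'m^'m) set \<Rightarrow> bool" where
  "lie_ideal \<ii> \<gg> \<longleftrightarrow>
     gl.subspace \<ii> \<and> \<ii> \<subseteq> \<gg> \<and> (\<forall>x\<in>\<gg>. \<forall>y\<in>\<ii>. lie_bracket x y \<in> \<ii>)"

definition bracket_span ::
    "(complex^'m^'m) set \<Rightarrow> (complex^'m^'m) set \<Rightarrow> (complex^'m^'m) set" where
  "bracket_span \<aa> \<bb> = gl.span {lie_bracket x y | x y. x \<in> \<aa> \<and> y \<in> \<bb>}"

primrec derived_series :: "(complex^'m^'m) set \<Rightarrow> nat \<Rightarrow> (complex^'m^'m) set" where
  "derived_series \<gg> 0 = \<gg>"
| "derived_series \<gg> (Suc k) = bracket_span (derived_series \<gg> k) (derived_series \<gg> k)"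

primrec lower_central_series :: "(complex^'m^'m) set \<Rightarrow> nat \<Rightarrow> (complex^'m^'m) set" where
  "lower_central_series \<gg> 0 = \<gg>"
| "lower_central_series \<gg> (Suc k) = bracket_span \<gg> (lower_central_series \<gg> k)"

definition lie_solvable :: "(complex^'m^'m) set \<Rightarrow> bool" where
  "lie_solvable \<gg> \<longleftrightarrow> (\<exists>k. derived_series \<gg> k = {0})"

definition lie_nilpotent :: "(complex^'m^'m) set \<Rightarrow> bool" where
  "lie_nilpotent \<gg> \<longleftrightarrow> (\<exists>k. lower_central_series \<gg> k = {0})"

definition borel_subalgebra :: "(complex^'m^'m) set \<Rightarrow> (complex^'m^'m) set \<Rightarrow> bool" where
  "borel_subalgebra \<bb> \<gg> \<longleftrightarrow>
     lie_subalgebra \<bb> \<and> \<bb> \<subseteq> \<gg> \<and> lie_solvable \<bb> \<and>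
     (\<forall>\<ss>. lie_subalgebra \<ss> \<and> \<ss> \<subseteq> \<gg> \<and> lie_solvable \<ss> \<and> \<bb> \<subseteq> \<ss>
        \<longrightarrow> \<ss> = \<bb>)"

text \<open>The parabolic subalgebras of \<open>\<gg>\<close> that are standard with respect to the
  Borel subalgebra \<open>\<bb>\<close>.\<close>

definition standard_parabolic ::
    "(complex^'m^'m) set \<Rightarrow> (complex^'m^'m) set \<Rightarrow> (complex^'m^'m) set \<Rightarrow> bool" where
  "standard_parabolic \<pp> \<bb> \<gg> \<longleftrightarrow>
     lie_subalgebra \<pp> \<and> \<bb> \<subseteq> \<pp> \<and> \<pp> \<subseteq> \<gg>"

text \<open>The sum of all nilpotent ideals, that is, the largest nilpotent ideal. For a parabolic
  subalgebra of a semisimple Lie algebra it consists of ad-nilpotent elements and is the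
  complement to a Levi subalgebra, since the centre of a Levi subalgebra acts faithfully and
  semisimply on it.\<close>

definition nilradical :: "(complex^'m^'m) set \<Rightarrow> (complex^'m^'m) set" where
  "nilradical \<gg> = gl.span (\<Union>{\<ii>. lie_ideal \<ii> \<gg> \<and> lie_nilpotent \<ii>})"


section \<open>The symplectic Lie algebra\<close>

definition symplectic_form :: "complex^('n::finite + 'n)^('n + 'n)" where
  "symplectic_form = (\<chi> i j. case (i, j) of
       (Inl a, Inr b) \<Rightarrow> if a = b then 1 else 0
     | (Inr a, Inl b) \<Rightarrow> if a = b then -1 else 0
     | _ \<Rightarrow> 0)"

text \<open>$\mathfrak{sp}_{2n}$ with $n = {}$\<open>CARD('n)\<close>.\<close>

definition sp :: "(complex^('n::finite + 'n)^('n + 'n)) set" where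
  "sp = {A. transpose A ** symplectic_form + symplectic_form ** A = 0}"


section \<open>The coadjoint representation and generic stabilisers\<close>

text \<open>A linear functional on the subspace \<open>\<nn>\<close> is represented by its extension
  by \<open>0\<close> to all matrices outside \<open>\<nn>\<close>.\<close>

definition dual_space :: "(complex^'m^'m) set \<Rightarrow> (complex^'m^'m \<Rightarrow> complex) set" where
  "dual_space \<nn> = {\<xi>.
     (\<forall>x\<in>\<nn>. \<forall>y\<in>\<nn>. \<xi> (x + y) = \<xi> x + \<xi> y) \<and>
     (\<forall>c. \<forall>x\<in>\<nn>. \<xi> (cscale c x) = c * \<xi> x) \<and>
     (\<forall>x. x \<notin> \<nn> \<longrightarrow> \<xi> x = 0)}"

definition coadjoint ::
    "(complex^'m^'m) set \<Rightarrow> complex^'m^'m \<Rightarrow> (complex^'m^'m \<Rightarrow> complex)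
      \<Rightarrow> (complex^'m^'m \<Rightarrow> complex)" where
  "coadjoint \<nn> x \<xi> = (\<lambda>y. if y \<in> \<nn> then - \<xi> (lie_bracket x y) else 0)"

definition coadjoint_stabiliser ::
    "(complex^'m^'m) set \<Rightarrow> (complex^'m^'m \<Rightarrow> complex) \<Rightarrow> (complex^'m^'m) set" where
  "coadjoint_stabiliser \<nn> \<xi> = {x \<in> \<nn>. coadjoint \<nn> x \<xi> = (\<lambda>_. 0)}"

text \<open>The polynomial functions on $\mathfrak n^*$: the algebra generated by the evaluations at
  elements of $\mathfrak n$. Only their values on \<open>dual_space \<nn>\<close> matter.\<close>

inductive_set dual_polynomials ::
    "(complex^'m^'m) set \<Rightarrow> ((complex^'m^'m \<Rightarrow> complex) \<Rightarrow> complex) set"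
  for \<nn> :: "(complex^'m^'m) set" where
  const: "(\<lambda>_. c) \<in> dual_polynomials \<nn>"
| eval: "x \<in> \<nn> \<Longrightarrow> (\<lambda>\<xi>. \<xi> x) \<in> dual_polynomials \<nn>"
| add: "\<lbrakk>p \<in> dual_polynomials \<nn>; q \<in> dual_polynomials \<nn>\<rbrakk>
          \<Longrightarrow> (\<lambda>\<xi>. p \<xi> + q \<xi>) \<in> dual_polynomials \<nn>"
| mult: "\<lbrakk>p \<in> dual_polynomials \<nn>; q \<in> dual_polynomials \<nn>\<rbrakk>
          \<Longrightarrow> (\<lambda>\<xi>. p \<xi> * q \<xi>) \<in> dual_polynomials \<nn>"

definition zariski_closed ::
    "(complex^'m^'m) set \<Rightarrow> (complex^'m^'m \<Rightarrow> complex) set \<Rightarrow> bool" where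
  "zariski_closed \<nn> Z \<longleftrightarrow>
     (\<exists>F \<subseteq> dual_polynomials \<nn>. Z = {\<xi> \<in> dual_space \<nn>. \<forall>f\<in>F. f \<xi> = 0})"

definition zariski_open ::
    "(complex^'m^'m) set \<Rightarrow> (complex^'m^'m \<Rightarrow> complex) set \<Rightarrow> bool" where
  "zariski_open \<nn> U \<longleftrightarrow> U \<subseteq> dual_space \<nn> \<and> zariski_closed \<nn> (dual_space \<nn> - U)"

definition zariski_dense ::
    "(complex^'m^'m) set \<Rightarrow> (complex^'m^'m \<Rightarrow> complex) set \<Rightarrow> bool" where
  "zariski_dense \<nn> U \<longleftrightarrow>
     U \<subseteq> dual_space \<nn> \<and> (\<forall>Z. zariski_closed \<nn> Z \<and> U \<subseteq> Z \<longrightarrow> Z = dual_space \<nn>)"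

definition matrix_exp :: "complex^'m^'m \<Rightarrow> complex^'m^'m" where
  "matrix_exp A = (\<Sum>k. (1 / fact k) *\<^sub>R (((**) A) ^^ k) (mat 1))"

definition conjugate_under ::
    "(complex^'m^'m) set \<Rightarrow> (complex^'m^'m) set \<Rightarrow> (complex^'m^'m) set \<Rightarrow> bool" where
  "conjugate_under G \<ss> \<tt> \<longleftrightarrow>
     (\<exists>g\<in>G. \<tt> = (\<lambda>x. g ** x ** matrix_inv g) ` \<ss>)"

text \<open>In the following definition \<open>matrix_exp ` \<nn>\<close> is the group $N = \exp(\mathfrak n)$, and
  ``dense open'' refers to the Zariski topology of $\mathfrak n^*$; a Zariski-dense Zariski-open
  set is also dense and open in the Euclidean topology.\<close>

definition has_generic_coadjoint_stabiliser :: "(complex^'m^'m) set \<Rightarrow> bool" where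
  "has_generic_coadjoint_stabiliser \<nn> \<longleftrightarrow>
     (\<exists>\<Omega>. zariski_open \<nn> \<Omega> \<and> zariski_dense \<nn> \<Omega> \<and>
        (\<forall>\<xi>\<in>\<Omega>. \<forall>\<eta>\<in>\<Omega>.
           conjugate_under (matrix_exp ` \<nn>)
             (coadjoint_stabiliser \<nn> \<xi>) (coadjoint_stabiliser \<nn> \<eta>)))"

end

theory Submission
  imports Defs "HOL-Computational_Algebra.Fundamental_Theorem_Algebra"
begin

text \<open>By Lie's theorem a Borel subalgebra stabilises a full isotropic flag, so up to conjugation it
  consists of the matrices that are upper triangular for a suitable order of the symplectic basis. A parabolic
  subalgebra \<open>\<pp>\<close> above it is then described by a total preorder on the indices, and its nilradical \<open>\<nn>\<close>
  is its strictly triangular part, that is, the set of all \<open>block A S 0 (- transpose A)\<close> with \<open>A\<close> strictly block upper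
  triangular and \<open>S\<close> symmetric with at least one index in \<open>I\<close>, the index set of the largest isotropic space \<open>W\<close> of the flag.

  A functional \<open>\<xi>\<close> on \<open>\<nn>\<close> restricts to a symmetric form \<open>\<gamma>\<close> on \<open>W\<close>. Let \<open>\<gamma>\<close> be nondegenerate on every member of the
  flag. Testing against the symmetric part of \<open>\<nn>\<close> forces \<open>A = 0\<close> for every element of the stabiliser;
  the remaining condition is that \<open>S\<close> is supported on \<open>I\<close> and \<open>S ** \<gamma>\<close> preserves the flag.
  By a block LDL decomposition of \<open>\<gamma>\<close> with a block unipotent \<open>g\<close> this space is \<open>g ** S0 ** transpose g\<close> for \<open>S0\<close> ranging
  over the block diagonal symmetric matrices. Hence all these stabilisers are conjugate under block unipotent matrices,
  which are exponentials of elements of \<open>\<nn>\<close>.\<close>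

section \<open>Block matrices and the symplectic Lie algebra\<close>

text \<open>Why stabilisers of generic functionals are conjugate although the functionals need not
  be: put D = transpose g ** G ** g for the Gram matrix \<open>G\<close> of \<gamma> and the block
  unipotent \<open>g\<close>. For S = g ** S0 ** transpose g, the matrix S ** G is block triangular
  exactly if S0 ** D is, and the invertible block triangular \<open>D\<close> can be cancelled. So
  \<open>D\<close>, which varies with \<xi>, leaves no trace in the condition on \<open>S0\<close>.
  A Borel subalgebra is given only by maximality among solvable subalgebras, with no basis attached.
  Extending an isotropic flag with span L calls for a common eigenvector in the perpendicular space
  of L modulo L, which is why Lie's theorem is proved relative to a subspace. Maximality then
  identifies the Borel subalgebra with the triangular one. A parabolic subalgebra is recovered from
  the root vectors that it contains: it is stable under the diagonal Cartan subalgebra, whose root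
  spaces are one-dimensional. Nonzero matrix entries therefore detect root vectors, and brackets
  make the resulting relation transitive.\<close>

primrec flip :: "'n + 'n \<Rightarrow> 'n + 'n" where
  "flip (Inl a) = Inr a"
| "flip (Inr a) = Inl a"

primrec eps :: "'n + 'n \<Rightarrow> complex" where
  "eps (Inl a) = 1"
| "eps (Inr a) = -1"

lemma flip_flip [simp]: "flip (flip i) = i"
  by (cases i) auto

lemma flip_neq [simp]: "flip i \<noteq> i" "i \<noteq> flip i"
  by (cases i; auto)+

lemma flip_eq_flip_iff [simp]: "flip i = flip j \<longleftrightarrow> i = j"
  by (metis flip_flip)

lemma eq_flip_commute: "i = flip j \<longleftrightarrow> j = flip i"
  by (metis flip_flip)

lemma eps_flip [simp]: "eps (flip i) = - eps i"
  by (cases i) auto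

lemma eps_square [simp]: "eps i * eps i = 1"
  by (cases i) auto

lemma eps_nonzero [simp]: "eps i \<noteq> 0"
  by (cases i) auto

lemma symplectic_form_nth: "symplectic_form $ i $ j = (if j = flip i then eps i else 0)"
  by (cases i; cases j) (auto simp: symplectic_form_def)

text \<open>\<open>symplectic_form\<close> is a signed permutation, so each entry of the defining
  equation has just two terms; reindexing by \<open>flip\<close> turns it into a sign rule for
  reflection in the antidiagonal of an ordered symplectic basis.\<close>

lemma sp_iff:
  fixes A :: "complex^('n::finite + 'n)^('n + 'n)"
  shows "A \<in> sp \<longleftrightarrow> (\<forall>i j. A $ flip j $ flip i = - eps i * eps j * A $ i $ j)"
proof -
  have *: "(transpose A ** symplectic_form + symplectic_form ** A) $ i $ j
      = eps i * A $ flip i $ j - eps j * A $ flip j $ i" for i j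
  proof -
    have "(\<Sum>k\<in>UNIV. A $ k $ i * symplectic_form $ k $ j)
        = (\<Sum>k\<in>UNIV. if k = flip j then A $ k $ i * eps k else 0)"
      by (rule sum.cong) (auto simp: symplectic_form_nth)
    moreover have "(\<Sum>k\<in>UNIV. symplectic_form $ i $ k * A $ k $ j)
        = (\<Sum>k\<in>UNIV. if k = flip i then eps i * A $ k $ j else 0)"
      by (rule sum.cong) (auto simp: symplectic_form_nth)
    ultimately show ?thesis
      by (simp add: matrix_matrix_mult_def transpose_def)
  qed
  have "A \<in> sp \<longleftrightarrow> (\<forall>i j. eps i * A $ flip i $ j = eps j * A $ flip j $ i)"
    unfolding sp_def mem_Collect_eq by (subst vec_eq_iff, subst vec_eq_iff) (simp add: * del: matrix_mult_dot vector_add_component)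
  also have "\<dots> \<longleftrightarrow> (\<forall>i j. A $ flip j $ flip i = - eps i * eps j * A $ i $ j)"
  proof (intro iffI allI)
    fix i j assume "\<forall>i j. eps i * A $ flip i $ j = eps j * A $ flip j $ i"
    then have "eps (flip i) * A $ i $ j = eps j * A $ flip j $ flip i"
      by (metis flip_flip)
    then show "A $ flip j $ flip i = - eps i * eps j * A $ i $ j"
      by (cases i; cases j) auto
  next
    fix i j assume "\<forall>i j. A $ flip j $ flip i = - eps i * eps j * A $ i $ j"
    then have "A $ flip j $ flip (flip i) = - eps (flip i) * eps j * A $ flip i $ j" by blast
    then show "eps i * A $ flip i $ j = eps j * A $ flip j $ i"
      by (cases i; cases j) auto
  qed
  finally show ?thesis .
qed

lemma sum_UNIV_Plus:
  "(\<Sum>i\<in>(UNIV :: ('a::finite + 'b::finite) set). f i) = (\<Sum>a\<in>UNIV. f (Inl a)) + (\<Sum>b\<in>UNIV. f (Inr b))"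
proof -
  have "(\<Sum>i\<in>(UNIV :: ('a + 'b) set). f i) = (\<Sum>i\<in>UNIV <+> UNIV. f i)" by simp
  then show ?thesis by (simp add: sum.Plus del: UNIV_Plus_UNIV)
qed

section \<open>Two-by-two block matrices\<close>

definition block :: "complex^'n^'n \<Rightarrow> complex^'n^'n \<Rightarrow> complex^'n^'n \<Rightarrow> complex^'n^'n
    \<Rightarrow> complex^('n::finite + 'n)^('n + 'n)" where
  "block A B C D = (\<chi> i j. case i of
      Inl a \<Rightarrow> (case j of Inl b \<Rightarrow> A $ a $ b | Inr b \<Rightarrow> B $ a $ b)
    | Inr a \<Rightarrow> (case j of Inl b \<Rightarrow> C $ a $ b | Inr b \<Rightarrow> D $ a $ b))"

lemma block_nth [simp]:
  "block A B C D $ Inl a $ Inl b = A $ a $ b"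
  "block A B C D $ Inl a $ Inr b = B $ a $ b"
  "block A B C D $ Inr a $ Inl b = C $ a $ b"
  "block A B C D $ Inr a $ Inr b = D $ a $ b"
  by (simp_all add: block_def)

lemma all_Plus_iff: "(\<forall>i. P i) \<longleftrightarrow> (\<forall>a. P (Inl a)) \<and> (\<forall>b. P (Inr b))"
  by (metis sum.exhaust)

lemma matrix_eq_iff: "A = B \<longleftrightarrow> (\<forall>i j. A $ i $ j = B $ i $ j)"
  by (simp add: vec_eq_iff)

lemma matrix_mult_nth: "(A ** B) $ i $ j = (\<Sum>k\<in>UNIV. A $ i $ k * B $ k $ j)"
  by (simp add: matrix_matrix_mult_def)

lemma block_eq_iff [simp]:
  "block A B C D = block A' B' C' D' \<longleftrightarrow> A = A' \<and> B = B' \<and> C = C' \<and> D = D'"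
  by (auto simp: matrix_eq_iff all_Plus_iff)

lemma block_mult:
  "block A B C D ** block A' B' C' D'
    = block (A ** A' + B ** C') (A ** B' + B ** D') (C ** A' + D ** C') (C ** B' + D ** D')"
  by (simp add: matrix_eq_iff all_Plus_iff matrix_mult_nth sum_UNIV_Plus)

lemma block_add: "block A B C D + block A' B' C' D' = block (A + A') (B + B') (C + C') (D + D')"
  by (simp add: matrix_eq_iff all_Plus_iff)

lemma block_diff: "block A B C D - block A' B' C' D' = block (A - A') (B - B') (C - C') (D - D')"
  by (simp add: matrix_eq_iff all_Plus_iff)

lemma block_cscale: "cscale c (block A B C D) = block (cscale c A) (cscale c B) (cscale c C) (cscale c D)"
  by (simp add: matrix_eq_iff all_Plus_iff cscale_def)

lemma block_one: "mat 1 = block (mat 1) 0 0 (mat 1)"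
  by (simp add: matrix_eq_iff all_Plus_iff mat_def)

lemma block_zero: "0 = block 0 0 0 0"
  by (simp add: matrix_eq_iff all_Plus_iff)

lemma block_cases: obtains A B C D where "x = block A B C D"
proof
  show "x = block (\<chi> a b. x $ Inl a $ Inl b) (\<chi> a b. x $ Inl a $ Inr b)
                  (\<chi> a b. x $ Inr a $ Inl b) (\<chi> a b. x $ Inr a $ Inr b)"
    by (simp add: matrix_eq_iff all_Plus_iff)
qed

lemma block_mem_sp_iff:
  "block A B C D \<in> sp \<longleftrightarrow> transpose B = B \<and> transpose C = C \<and> D = - transpose A"
  by (auto simp: sp_iff matrix_eq_iff all_Plus_iff transpose_def)

section \<open>Exponentials of nilpotent matrices\<close>

text \<open>The powers inside \<open>matrix_exp\<close> get a name because only nilpotent matrices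
  are exponentiated: the series is then a finite sum.\<close>

definition mpow :: "complex^'m^'m \<Rightarrow> nat \<Rightarrow> complex^'m::finite^'m" where
  "mpow A k = (((**) A) ^^ k) (mat 1)"

lemma mpow_0 [simp]: "mpow A 0 = mat 1"
  and mpow_Suc: "mpow A (Suc k) = A ** mpow A k"
  by (simp_all add: mpow_def)

lemma mpow_add: "mpow A (i + j) = mpow A i ** mpow A j"
  by (induction i) (simp_all add: mpow_Suc matrix_mul_assoc)

lemma mpow_eq_0_mono: "mpow A K = 0 \<Longrightarrow> K \<le> k \<Longrightarrow> mpow A k = 0"
  by (metis add.commute le_Suc_ex mpow_add times0_right)

lemma matrix_mult_scaleR_left: "(c *\<^sub>R A) ** B = c *\<^sub>R (A ** (B :: complex^'p^'m::finite))"
  by (simp add: matrix_eq_iff matrix_mult_nth scaleR_sum_right)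

lemma matrix_mult_scaleR_right: "A ** (c *\<^sub>R B) = c *\<^sub>R (A ** (B :: complex^'p^'m::finite))"
  by (simp add: matrix_eq_iff matrix_mult_nth scaleR_sum_right)

lemma matrix_add_rdistrib: "(A + B) ** C = A ** C + B ** (C :: complex^'p^'m::finite)"
  by (simp add: matrix_eq_iff matrix_mult_nth sum.distrib ring_distribs)

lemma matrix_diff_ldistrib: "C ** (A - B) = C ** A - C ** (B :: complex^'p^'m::finite)"
  by (simp add: matrix_eq_iff matrix_mult_nth sum_subtractf ring_distribs)

lemma matrix_mult_sum_left: "(\<Sum>i\<in>S. f i) ** B = (\<Sum>i\<in>S. f i ** (B :: complex^'p^'m::finite))"
  by (induction S rule: infinite_finite_induct) (simp_all add: matrix_add_rdistrib)

lemma matrix_mult_sum_right: "B ** (\<Sum>i\<in>S. f i) = (\<Sum>i\<in>S. B ** (f i :: complex^'p^'m::finite))"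
  by (induction S rule: infinite_finite_induct) (simp_all add: matrix_add_ldistrib)

lemma matrix_mult_minus_left: "(- A) ** B = - (A ** (B :: complex^'p^'m::finite))"
  by (simp add: matrix_eq_iff matrix_mult_nth sum_negf)

lemma matrix_mult_minus_right: "A ** (- B) = - (A ** (B :: complex^'p^'m::finite))"
  by (simp add: matrix_eq_iff matrix_mult_nth sum_negf)

lemma mpow_minus: "mpow (- A) k = ((-1) ^ k) *\<^sub>R mpow A k"
  by (induction k) (simp_all add: mpow_Suc matrix_mult_scaleR_right matrix_mult_minus_left)

lemma mpow_commute: "mpow A k ** A = A ** mpow A k"
  by (induction k) (simp_all add: mpow_Suc matrix_mul_assoc [symmetric])

lemma mpow_transpose: "mpow (transpose A) k = transpose (mpow A k)"
  by (induction k) (simp_all add: mpow_Suc matrix_transpose_mul mpow_commute [symmetric])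

lemma mpow_block: "mpow (block A 0 0 D) k = block (mpow A k) 0 0 (mpow D k)"
  by (induction k) (simp_all add: mpow_Suc block_mult block_one)

lemma matrix_exp_finite:
  assumes "mpow A K = 0"
  shows "matrix_exp A = (\<Sum>k<K. (1 / fact k) *\<^sub>R mpow A k)"
  unfolding matrix_exp_def mpow_def [symmetric]
  by (rule suminf_finite) (auto simp: mpow_eq_0_mono [OF assms])

lemma transpose_nth: "transpose A $ i $ j = A $ j $ i"
  by (simp add: transpose_def)

lemma matrix_exp_transpose:
  assumes "mpow A K = 0"
  shows "matrix_exp (transpose A) = transpose (matrix_exp A)"
proof -
  have "mpow (transpose A) K = 0"
    by (simp add: mpow_transpose assms transpose_nth vec_eq_iff)
  then show ?thesis
    by (simp add: matrix_exp_finite [where K = K] assms mpow_transpose matrix_eq_iff transpose_nth)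
qed

lemma matrix_exp_block:
  assumes "mpow A K = 0" "mpow D K = 0"
  shows "matrix_exp (block A 0 0 D) = block (matrix_exp A) 0 0 (matrix_exp D)"
proof -
  have "mpow (block A 0 0 D) K = 0"
    by (simp add: mpow_block assms block_zero [symmetric])
  then show ?thesis
    by (simp add: matrix_exp_finite [where K = K] assms mpow_block matrix_eq_iff all_Plus_iff)
qed

text \<open>Coefficient k of exp(t) exp(-t): times \<open>fact k\<close> it is the binomial
  expansion of (1 - 1)^k.\<close>

lemma sum_exp_coefficients:
  "(\<Sum>i\<le>k. (1 / fact i) * ((-1) ^ (k - i) / fact (k - i))) = (if k = 0 then 1 else (0::real))"
proof -
  have "(\<Sum>i\<le>k. (1 / fact i) * ((-1) ^ (k - i) / fact (k - i)) :: real)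
      = (\<Sum>i\<le>k. of_nat (k choose i) * 1 ^ i * (-1) ^ (k - i)) / fact k"
    unfolding sum_divide_distrib by (rule sum.cong) (auto simp: binomial_fact)
  also have "\<dots> = (1 + (-1)) ^ k / fact k"
    by (subst binomial_ring) simp
  finally show ?thesis by (cases k) auto
qed

lemma matrix_exp_mult_minus:
  assumes "mpow A K = 0"
  shows "matrix_exp A ** matrix_exp (- A) = mat 1"
proof (cases "K = 0")
  \<comment> \<open>Here \<open>mat 1\<close> is 0, so all matrices coincide.\<close>
  case True
  have "B = 0" for B :: "complex^'a^'a"
  proof -
    have "B = mat 1 ** B" by simp
    also have "\<dots> = 0" using assms True by simp
    finally show ?thesis .
  qed
  then show ?thesis by metis
next
  case False
  let ?c = "\<lambda>i j. (1 / fact i) * ((-1) ^ j / fact j) :: real"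
  have nz: "mpow A k \<noteq> 0 \<Longrightarrow> k < K" for k
    using mpow_eq_0_mono [OF assms] not_less by blast
  have "mpow (- A) K = 0" by (simp add: mpow_minus assms)
  then have "matrix_exp A ** matrix_exp (- A)
      = (\<Sum>i<K. \<Sum>j<K. ((1 / fact i) *\<^sub>R mpow A i) ** ((1 / fact j) *\<^sub>R ((-1) ^ j *\<^sub>R mpow A j)))"
    by (simp only: matrix_exp_finite [where K = K] assms matrix_mult_sum_left matrix_mult_sum_right mpow_minus)
       (subst sum.swap, simp)
  also have "\<dots> = (\<Sum>i<K. \<Sum>j<K. ?c i j *\<^sub>R mpow A (i + j))"
    by (simp add: matrix_mult_scaleR_left matrix_mult_scaleR_right mpow_add mult_ac)
  also have "\<dots> = (\<Sum>(i,j)\<in>{..<K} \<times> {..<K}. ?c i j *\<^sub>R mpow A (i + j))"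
    by (simp add: sum.cartesian_product)
  \<comment> \<open>Nilpotency cuts the square of index pairs down to the triangle, on which the
    Cauchy product is summed along antidiagonals.\<close>
  also have "\<dots> = (\<Sum>(i,j)\<in>{(i,j). i + j < K}. ?c i j *\<^sub>R mpow A (i + j))"
    by (rule sum.mono_neutral_right) (auto intro: nz)
  also have "\<dots> = (\<Sum>k<K. \<Sum>i\<le>k. ?c i (k - i) *\<^sub>R mpow A (i + (k - i)))"
    by (rule sum.triangle_reindex)
  also have "\<dots> = (\<Sum>k<K. (\<Sum>i\<le>k. ?c i (k - i)) *\<^sub>R mpow A k)"
    by (simp add: scaleR_sum_left)
  also have "\<dots> = (\<Sum>k<K. if k = 0 then mat 1 else 0)"
    unfolding sum_exp_coefficients by (rule sum.cong) auto
  also have "\<dots> = mat 1" using False by simp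
  finally show ?thesis .
qed

section \<open>Level-raising matrices and the unipotent group attached to them\<close>

definition raising :: "('m \<Rightarrow> nat) \<Rightarrow> 'm set \<Rightarrow> nat \<Rightarrow> (complex^'m::finite^'m) set" where
  "raising l I k = {A. \<forall>i j. A $ i $ j \<noteq> 0 \<longrightarrow> i \<in> I \<and> j \<in> I \<and> l i + k \<le> l j}"

lemma raisingI:
  "(\<And>i j. A $ i $ j \<noteq> 0 \<Longrightarrow> i \<in> I \<and> j \<in> I \<and> l i + k \<le> l j) \<Longrightarrow> A \<in> raising l I k"
  and raisingD:
  "A \<in> raising l I k \<Longrightarrow> A $ i $ j \<noteq> 0 \<Longrightarrow> i \<in> I \<and> j \<in> I \<and> l i + k \<le> l j"
  by (auto simp: raising_def)

lemma raising_0 [simp]: "0 \<in> raising l I k"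
  by (simp add: raising_def)

lemma raising_mono: "A \<in> raising l I k \<Longrightarrow> k' \<le> k \<Longrightarrow> A \<in> raising l I k'"
  by (rule raisingI) (drule (1) raisingD, simp)

lemma raising_add:
  assumes "A \<in> raising l I k" "B \<in> raising l I k"
  shows "A + B \<in> raising l I k"
proof (rule raisingI)
  fix i j assume "(A + B) $ i $ j \<noteq> 0"
  then have "A $ i $ j \<noteq> 0 \<or> B $ i $ j \<noteq> 0" by auto
  then show "i \<in> I \<and> j \<in> I \<and> l i + k \<le> l j" using assms raisingD by metis
qed

lemma raising_scaleR: "A \<in> raising l I k \<Longrightarrow> c *\<^sub>R A \<in> raising l I k"
  by (rule raisingI) (drule raisingD, auto)

lemma raising_diff: "A \<in> raising l I k \<Longrightarrow> B \<in> raising l I k \<Longrightarrow> A - B \<in> raising l I k"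
  using raising_add [of A l I k "(-1) *\<^sub>R B"] raising_scaleR [of B l I k "-1"] by simp

lemma raising_sum: "(\<And>x. x \<in> S \<Longrightarrow> f x \<in> raising l I k) \<Longrightarrow> (\<Sum>x\<in>S. f x) \<in> raising l I k"
  by (induction S rule: infinite_finite_induct) (auto intro: raising_add)

lemma raising_mult:
  assumes "A \<in> raising l I p" "B \<in> raising l I q"
  shows "A ** B \<in> raising l I (p + q)"
proof (rule raisingI)
  fix i j assume "(A ** B) $ i $ j \<noteq> 0"
  then obtain k where "A $ i $ k * B $ k $ j \<noteq> 0"
    unfolding matrix_mult_nth by (rule sum.not_neutral_contains_not_neutral)
  then have "A $ i $ k \<noteq> 0" "B $ k $ j \<noteq> 0" by auto
  then have "i \<in> I \<and> k \<in> I \<and> l i + p \<le> l k" "k \<in> I \<and> j \<in> I \<and> l k + q \<le> l j"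
    using assms raisingD by blast+
  then show "i \<in> I \<and> j \<in> I \<and> l i + (p + q) \<le> l j" by linarith
qed

lemma raising_eq_0: "A \<in> raising l I k \<Longrightarrow> (\<And>j. l j < k) \<Longrightarrow> A = 0"
  unfolding matrix_eq_iff by (intro allI, rule ccontr, drule raisingD) (auto simp: not_less [symmetric], meson trans_less_add2)

lemma mpow_raising:
  assumes "A \<in> raising l I 1" "k \<ge> 1"
  shows "mpow A k \<in> raising l I k"
  using assms(2)
proof (induction k rule: dec_induct)
  case base
  then show ?case using assms by (simp add: mpow_Suc)
next
  case (step k)
  then show ?case using raising_mult [OF assms(1) step.IH] by (simp add: mpow_Suc)
qed

lemma mpow_raising_eq_0:
  assumes "A \<in> raising l I 1" "k \<ge> 1" "\<And>j. l j < k"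
  shows "mpow A k = 0"
  using assms mpow_raising raising_eq_0 by metis

text \<open>A product with one factor \<open>d\<close> gains k levels from it and at least one from
  each further factor; the recursion splits the difference of powers into two terms of this
  kind.\<close>

lemma mpow_diff_raising:
  assumes A: "A \<in> raising l I 1" and d: "d \<in> raising l I k" "k \<ge> 1"
  shows "mpow (A + d) (Suc j) - mpow A (Suc j) \<in> raising l I (k + j)"
proof (induction j)
  case 0
  then show ?case using d by (simp add: mpow_Suc)
next
  case (Suc j)
  have *: "mpow (A + d) (Suc (Suc j)) - mpow A (Suc (Suc j))
      = (A + d) ** (mpow (A + d) (Suc j) - mpow A (Suc j)) + d ** mpow A (Suc j)"
    by (simp add: mpow_Suc [of _ "Suc j"] matrix_add_rdistrib matrix_diff_ldistrib)
  have "A + d \<in> raising l I 1" using A d raising_add raising_mono by blast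
  from raising_mult [OF this Suc] have 1: "(A + d) ** (mpow (A + d) (Suc j) - mpow A (Suc j)) \<in> raising l I (k + Suc j)" by simp
  have "d ** mpow A (Suc j) \<in> raising l I (k + Suc j)"
    by (rule raising_mult [OF d(1) mpow_raising]) (use A in auto)
  with 1 show ?case unfolding * by (rule raising_add)
qed

text \<open>To first order in the filtration exp(A + d) is exp A + d: the powers of exponent at
  least 2 differ only by terms that contain \<open>d\<close> and a further raising factor.\<close>

lemma matrix_exp_diff_raising:
  assumes A: "A \<in> raising l I 1" and d: "d \<in> raising l I k" "k \<ge> 1"
  shows "matrix_exp (A + d) - matrix_exp A - d \<in> raising l I (Suc k)"
proof -
  obtain N where N: "\<And>j. l j < N"
  proof
    show "l j < Suc (Max (range l))" for j by (simp add: le_imp_less_Suc)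
  qed
  let ?K = "Suc (Suc N)"
  have lK: "l j < ?K" for j using N [of j] by simp
  have Ad: "A + d \<in> raising l I 1" using A d raising_add raising_mono by blast
  have "mpow (A + d) ?K = 0" "mpow A ?K = 0"
    by (rule mpow_raising_eq_0 [where l = l and I = I]; (use A Ad lK in simp)?)+
  then have "matrix_exp (A + d) - matrix_exp A
      = (\<Sum>k<?K. (1 / fact k) *\<^sub>R (mpow (A + d) k - mpow A k))"
    by (simp add: matrix_exp_finite [where K = ?K] sum_subtractf [symmetric] scaleR_diff_right del: sum.lessThan_Suc)
  \<comment> \<open>The constant terms cancel and the linear terms leave exactly
    \<open>d\<close>.\<close>
  also have "\<dots> = d + (\<Sum>k<N. (1 / fact (Suc (Suc k))) *\<^sub>R (mpow (A + d) (Suc (Suc k)) - mpow A (Suc (Suc k))))"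
    by (simp only: sum.lessThan_Suc_shift) (simp add: mpow_Suc)
  finally have "matrix_exp (A + d) - matrix_exp A - d
     = (\<Sum>k<N. (1 / fact (Suc (Suc k))) *\<^sub>R (mpow (A + d) (Suc (Suc k)) - mpow A (Suc (Suc k))))" by simp
  also have "\<dots> \<in> raising l I (Suc k)"
    by (intro raising_sum raising_scaleR raising_mono [OF mpow_diff_raising [OF A d]]) simp
  finally show ?thesis .
qed

text \<open>A logarithm by successive approximation: adding the defect M - exp A to \<open>A\<close>
  pushes the new defect one level up, and a defect beyond the top level vanishes.\<close>

lemma matrix_exp_surj_raising:
  assumes M: "M - mat 1 \<in> raising l I 1"
  obtains A where "A \<in> raising l I 1" "matrix_exp A = M"
proof -
  obtain N where N: "\<And>j. l j < Suc N"
  proof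
    show "l j < Suc (Max (range l))" for j by (simp add: le_imp_less_Suc)
  qed
  have "\<exists>A \<in> raising l I 1. M - matrix_exp A \<in> raising l I (Suc k)" for k
  proof (induction k)
    case 0
    have "matrix_exp (0 :: complex^'a^'a) = mat 1"
      using matrix_exp_finite [of "0 :: complex^'a^'a" 1] by (simp add: mpow_Suc)
    then show ?case using M by (intro bexI [of _ 0]) auto
  next
    case (Suc k)
    then obtain A where A: "A \<in> raising l I 1" and d: "M - matrix_exp A \<in> raising l I (Suc k)" (is "?d \<in> _") by blast
    have "M - matrix_exp (A + ?d) = 0 - (matrix_exp (A + ?d) - matrix_exp A - ?d)" by simp
    moreover have "\<dots> \<in> raising l I (Suc (Suc k))"
      by (intro raising_diff matrix_exp_diff_raising A d) auto
    moreover have "A + ?d \<in> raising l I 1"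
      using A d by (intro raising_add) (auto intro: raising_mono)
    ultimately show ?case by (intro bexI [of _ "A + ?d"]) (simp_all only:)
  qed
  then obtain A where "A \<in> raising l I 1" "M - matrix_exp A \<in> raising l I (Suc N)" by blast
  then show ?thesis using that raising_eq_0 [OF _ N] by force
qed

section \<open>Block LDL decompositions of symmetric forms\<close>

lemma matrix_diff_rdistrib: "(A - B) ** C = A ** C - B ** (C :: complex^'p^'m::finite)"
  by (simp add: matrix_eq_iff matrix_mult_nth sum_subtractf ring_distribs)

lemma matrix_vector_nth: "(A *v v) $ i = (\<Sum>j\<in>UNIV. A $ i $ j * v $ j)"
  by (simp add: matrix_vector_mult_def)

lemma invertible_if_kernel_trivial:
  fixes A :: "complex^'n::finite^'n"
  assumes "\<And>v. A *v v = 0 \<Longrightarrow> v = 0"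
  shows "invertible A"
proof -
  have "inj ((*v) A)"
    using assms by (auto intro!: injI) (metis eq_iff_diff_eq_0 matrix_vector_mult_diff_distrib)
  then show ?thesis
    by (simp add: invertible_left_inverse matrix_left_invertible_injective)
qed

lemma invertible_solve:
  fixes A :: "complex^'n::finite^'n"
  assumes "invertible A"
  obtains v where "A *v v = b"
  using assms by (metis invertible_def matrix_vector_mul_assoc matrix_vector_mul_lid)

lemma invertible_kernel_trivial:
  fixes A :: "complex^'n::finite^'n"
  assumes "invertible A" "A *v v = 0"
  shows "v = 0"
  using assms by (metis invertible_def matrix_vector_mul_assoc matrix_vector_mul_lid matrix_vector_mult_0_right)

section \<open>Matrices with prescribed support\<close>

definition pattern :: "('m \<Rightarrow> 'm \<Rightarrow> bool) \<Rightarrow> (complex^'m::finite^'m) set" where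
  "pattern Q = {A. \<forall>i j. A $ i $ j \<noteq> 0 \<longrightarrow> Q i j}"

lemma patternI: "(\<And>i j. A $ i $ j \<noteq> 0 \<Longrightarrow> Q i j) \<Longrightarrow> A \<in> pattern Q"
  and patternD: "A \<in> pattern Q \<Longrightarrow> A $ i $ j \<noteq> 0 \<Longrightarrow> Q i j"
  by (auto simp: pattern_def)

lemma pattern_mult:
  assumes "transp Q" "A \<in> pattern Q" "B \<in> pattern Q"
  shows "A ** B \<in> pattern Q"
proof (rule patternI)
  fix i j assume "(A ** B) $ i $ j \<noteq> 0"
  then obtain k where "A $ i $ k * B $ k $ j \<noteq> 0"
    unfolding matrix_mult_nth by (rule sum.not_neutral_contains_not_neutral)
  then have "Q i k" "Q k j" using assms(2,3) patternD by fastforce+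
  then show "Q i j" using assms(1) by (meson transpD)
qed

text \<open>Fix a column j of the inverse. The vectors supported on the down-set {a. Q a j} form a
  subspace that \<open>M\<close> maps injectively into itself, hence onto itself. By reflexivity it
  contains the basis vector at j, so the preimage of that vector, which is column j of
  \<open>N\<close>, lies in it as well.\<close>

lemma pattern_inverse:
  assumes Q: "reflp Q" "transp Q" and M: "M \<in> pattern Q" and MN: "M ** N = mat 1"
  shows "N \<in> pattern Q"
proof (rule patternI, rule ccontr)
  fix i j assume nz: "N $ i $ j \<noteq> 0" and nQ: "\<not> Q i j"
  have NM: "N ** M = mat 1" using MN matrix_left_right_inverse by blast
  have inj: "v = 0" if "M *v v = 0" for v
    using that NM by (metis matrix_vector_mul_assoc matrix_vector_mul_lid matrix_vector_mult_0_right)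
  \<comment> \<open>The block of \<open>M\<close> on the down-set of j, completed by the identity so
    that it remains a square matrix over the same index type.\<close>
  define M' where "M' = (\<chi> a b. if Q a j \<and> Q b j then M $ a $ b else if a = b then 1 else 0)"
  have off: "(M' *v v) $ a = v $ a" if "\<not> Q a j" for a v
    using that by (simp add: M'_def matrix_vector_mult_def if_distrib [of "\<lambda>x. x * _"] cong: if_cong)
  have on: "M *v v = M' *v v" if v: "\<And>b. v $ b \<noteq> 0 \<Longrightarrow> Q b j" for v
  proof (subst vec_eq_iff, intro allI)
    fix a
    show "(M *v v) $ a = (M' *v v) $ a"
    proof (cases "Q a j")
      case True
      show ?thesis unfolding matrix_vector_nth
      proof (rule sum.cong [OF refl])
        fix b show "M $ a $ b * v $ b = M' $ a $ b * v $ b"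
          using v [of b] True by (cases "Q b j") (auto simp: M'_def)
      qed
    next
      case False
      have "M $ a $ b * v $ b = 0" for b
      proof (rule ccontr)
        assume "M $ a $ b * v $ b \<noteq> 0"
        then have "Q a b" "Q b j" using v patternD [OF M] by auto
        then show False using False Q(2) by (meson transpD)
      qed
      then have "(M *v v) $ a = 0" unfolding matrix_vector_nth by (intro sum.neutral) blast
      moreover have "v $ a = 0" using v False by blast
      ultimately show ?thesis using off [OF False] by simp
    qed
  qed
  have "invertible M'"
  proof (rule invertible_if_kernel_trivial)
    fix v assume v: "M' *v v = 0"
    then have "v $ b \<noteq> 0 \<Longrightarrow> Q b j" for b using off [of b v] by auto
    with v on inj show "v = 0" by metis
  qed
  then obtain v where v: "M' *v v = axis j 1" by (rule invertible_solve)
  have vD: "v $ b \<noteq> 0 \<Longrightarrow> Q b j" for b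
    using off [of b v] v reflpD [OF Q(1), of j] by (cases "b = j"; cases "Q b j") (simp_all add: axis_def)
  have "v = N *v (M *v v)" by (simp add: matrix_vector_mul_assoc NM)
  also have "\<dots> = N *v axis j 1" using on [OF vD] v by simp
  finally have "v $ i = N $ i $ j"
    by (simp add: matrix_vector_nth axis_def if_distrib [of "\<lambda>x. _ * x"] cong: if_cong)
  then show False using vD nz nQ by metis
qed

text \<open>Padded with the identity, the Gram matrix of a coordinate subspace keeps the full index
  type; its invertibility expresses that the form is nondegenerate on that subspace.\<close>

definition truncate :: "'n set \<Rightarrow> complex^'n^'n \<Rightarrow> complex^'n::finite^'n" where
  "truncate K G = (\<chi> i j. if i \<in> K \<and> j \<in> K then G $ i $ j else if i = j then 1 else 0)"

lemma truncate_mult_off: "i \<notin> K \<Longrightarrow> (truncate K G *v v) $ i = v $ i"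
  by (simp add: truncate_def matrix_vector_mult_def if_distrib [of "\<lambda>x. x * _"] cong: if_cong)

lemma truncate_mult_on:
  assumes "i \<in> K" "\<And>j. v $ j \<noteq> 0 \<Longrightarrow> j \<in> K"
  shows "(truncate K G *v v) $ i = (\<Sum>j\<in>UNIV. G $ i $ j * v $ j)"
  unfolding matrix_vector_nth
proof (rule sum.cong [OF refl])
  fix j show "truncate K G $ i $ j * v $ j = G $ i $ j * v $ j"
    using assms(2) [of j] assms(1) by (cases "j \<in> K") (auto simp: truncate_def)
qed

lemma truncate_nondegenerate:
  assumes "invertible (truncate K G)" "\<And>j. v $ j \<noteq> 0 \<Longrightarrow> j \<in> K"
    and "\<And>i. i \<in> K \<Longrightarrow> (\<Sum>j\<in>UNIV. G $ i $ j * v $ j) = 0"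
  shows "v = 0"
proof (rule invertible_kernel_trivial [OF assms(1)])
  show "truncate K G *v v = 0"
    unfolding vec_eq_iff
    using truncate_mult_off [of _ K G v] truncate_mult_on [OF _ assms(2), where G = G] assms by (metis zero_index)
qed

text \<open>Block Gram-Schmidt. Column k of \<open>g\<close> is the basis vector at k, corrected by
  lower-level vectors so that it becomes orthogonal to all lower levels; the correction exists
  because the form on the lower levels is nondegenerate.\<close>

lemma block_LDL:
  fixes G :: "complex^'n::finite^'n" and l :: "'n \<Rightarrow> nat"
  assumes sym: "transpose G = G" and G_off: "\<And>i j. i \<notin> I \<Longrightarrow> i \<noteq> j \<Longrightarrow> G $ i $ j = 0"
    and I: "\<And>a b. a \<in> I \<Longrightarrow> b \<notin> I \<Longrightarrow> l a < l b"
    and inv: "\<And>t. invertible (truncate {a \<in> I. l a < t} G)"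
  obtains g where "g - mat 1 \<in> raising l I 1" "transpose g ** G \<in> pattern (\<lambda>i j. l i \<le> l j)"
proof -
  have sym': "G $ i $ j = G $ j $ i" for i j using sym by (metis transpose_nth)
  have "\<exists>v. (\<forall>i. v $ i \<noteq> 0 \<longrightarrow> k \<in> I \<and> i \<in> I \<and> l i < l k) \<and>
       (\<forall>i. l i < l k \<longrightarrow> G $ i $ k + (\<Sum>j\<in>UNIV. G $ i $ j * v $ j) = 0)" for k
  proof (cases "k \<in> I")
    case True
    let ?K = "{a \<in> I. l a < l k}"
    \<comment> \<open>The right-hand side asks the correction to cancel the pairing of the basis
      vector at k with each lower one.\<close>
    obtain v where v: "truncate ?K G *v v = (\<chi> i. if i \<in> ?K then - G $ i $ k else 0)"
      using inv invertible_solve by blast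
    have vK: "i \<in> ?K" if "v $ i \<noteq> 0" for i
      using that truncate_mult_off [of i ?K G v] v by (cases "i \<in> I"; cases "l i < l k") simp_all
    have "G $ i $ k + (\<Sum>j\<in>UNIV. G $ i $ j * v $ j) = 0" if i: "l i < l k" for i
    proof -
      have "i \<in> ?K" using i I [OF True, of i] by auto
      then show ?thesis using truncate_mult_on [of i ?K v G] vK v by (simp add: add_eq_0_iff)
    qed
    then show ?thesis using vK True by blast
  next
    \<comment> \<open>Rows outside \<open>I\<close> are diagonal, so such a column gets the
      correction 0.\<close>
    case False
    then have "G $ i $ k = 0" if "l i < l k" for i
      using that G_off [of k i] sym' [of i k] by force
    then show ?thesis by (intro exI [of _ 0]) auto
  qed
  then obtain w where w: "\<And>k i. w k $ i \<noteq> 0 \<Longrightarrow> k \<in> I \<and> i \<in> I \<and> l i < l k"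
    and wG: "\<And>k i. l i < l k \<Longrightarrow> G $ i $ k + (\<Sum>j\<in>UNIV. G $ i $ j * w k $ j) = 0" by metis
  define g where "g = mat 1 + (\<chi> i k. w k $ i)"
  have "g - mat 1 \<in> raising l I 1"
    by (rule raisingI) (use w in \<open>fastforce simp: g_def\<close>)
  moreover have "transpose g ** G \<in> pattern (\<lambda>i j. l i \<le> l j)"
  proof (rule patternI, rule ccontr)
    fix k i assume nz: "(transpose g ** G) $ k $ i \<noteq> 0" and "\<not> l k \<le> l i"
    have "(transpose g ** G) $ k $ i = (\<Sum>j\<in>UNIV. (if j = k then 1 else 0) * G $ j $ i + w k $ j * G $ j $ i)"
      unfolding matrix_mult_nth by (rule sum.cong) (auto simp: g_def mat_def transpose_nth ring_distribs)
    also have "\<dots> = G $ i $ k + (\<Sum>j\<in>UNIV. G $ i $ j * w k $ j)"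
      by (simp add: sum.distrib if_distrib [of "\<lambda>x. x * _"] if_distrib [of "\<lambda>x. _ * x"] sym' [of _ i] mult.commute cong: if_cong)
    also have "\<dots> = 0" using wG \<open>\<not> l k \<le> l i\<close> by simp
    finally show False using nz by simp
  qed
  ultimately show ?thesis using that by blast
qed

text \<open>The symmetric parts of the elements of a generic stabiliser, when \<open>G\<close> is
  the Gram matrix of the functional. The last condition says that S ** G preserves the flag of
  coordinate subspaces of bounded level.\<close>

definition flag_forms :: "('n \<Rightarrow> nat) \<Rightarrow> 'n set \<Rightarrow> complex^'n^'n \<Rightarrow> (complex^'n::finite^'n) set" where
  "flag_forms l I G = {S. transpose S = S \<and> S \<in> pattern (\<lambda>a b. a \<in> I \<and> b \<in> I) \<and> S ** G \<in> pattern (\<lambda>i j. l i \<le> l j)}"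

lemma raising_imp_pattern:
  assumes "g - mat 1 \<in> raising l I 1"
  shows "g \<in> pattern (\<lambda>i j. i = j \<or> i \<in> I \<and> j \<in> I \<and> l i < l j)"
proof (rule patternI)
  fix i j assume nz: "g $ i $ j \<noteq> 0"
  show "i = j \<or> i \<in> I \<and> j \<in> I \<and> l i < l j"
  proof (cases "i = j")
    case False
    then have "(g - mat 1) $ i $ j \<noteq> 0" using nz by (simp add: mat_def)
    from raisingD [OF assms this] show ?thesis by simp
  qed simp
qed

lemma raising_diag:
  assumes "g - mat 1 \<in> raising l I 1"
  shows "g $ i $ i = 1"
  using raisingD [OF assms, of i i] by (auto simp: mat_def)

text \<open>Written as an exponential, \<open>g\<close> is inverted by the exponential of the
  negative.\<close>

lemma unipotent_kernel:
  fixes l :: "'n::finite \<Rightarrow> nat"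
  assumes g: "g - mat 1 \<in> raising l I 1" and v: "g *v v = 0"
  shows "v = 0"
proof -
  obtain A where A: "A \<in> raising l I 1" "matrix_exp A = g" using matrix_exp_surj_raising [OF g] .
  have "mpow A (Suc (Max (range l))) = 0"
    by (rule mpow_raising_eq_0 [OF A(1)]) (auto simp: le_imp_less_Suc)
  from matrix_exp_mult_minus [OF this] have "matrix_exp (- A) ** g = mat 1"
    using A(2) matrix_left_right_inverse by blast
  then show ?thesis using v by (metis matrix_vector_mul_assoc matrix_vector_mul_lid matrix_vector_mult_0_right)
qed

text \<open>\<open>pattern_inverse\<close> for the relation "equal, or strictly raised within I"
  gives everything but the diagonal of the inverse, which is read off from the diagonal of g **
  h.\<close>

lemma unipotent_inverse:
  fixes l :: "'n::finite \<Rightarrow> nat"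
  assumes g: "g - mat 1 \<in> raising l I 1"
  obtains h where "h - mat 1 \<in> raising l I 1" "g ** h = mat 1" "h ** g = mat 1"
proof -
  obtain h where h: "g ** h = mat 1" "h ** g = mat 1"
    using invertible_if_kernel_trivial [OF unipotent_kernel [OF g]] by (auto simp: invertible_def)
  let ?Q = "\<lambda>i j. i = j \<or> i \<in> I \<and> j \<in> I \<and> l i < l j"
  have hQ: "h \<in> pattern ?Q"
    by (rule pattern_inverse [OF _ _ raising_imp_pattern [OF g] h(1)]) (auto intro!: reflpI transpI)
  have "h $ i $ i = 1" for i
  proof -
    have "1 = (g ** h) $ i $ i" by (simp add: h mat_def)
    also have "\<dots> = (\<Sum>k\<in>UNIV. if k = i then h $ i $ i else 0)"
      unfolding matrix_mult_nth
    proof (rule sum.cong [OF refl])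
      fix k
      show "g $ i $ k * h $ k $ i = (if k = i then h $ i $ i else 0)"
        using patternD [OF hQ, of k i] patternD [OF raising_imp_pattern [OF g], of i k] raising_diag [OF g, of i]
        by (cases "k = i"; cases "g $ i $ k = 0") auto
    qed
    finally show ?thesis by simp
  qed
  then have "h - mat 1 \<in> raising l I 1"
    using patternD [OF hQ] by (intro raisingI) (fastforce simp: mat_def split: if_splits)
  with h that show ?thesis by blast
qed

lemma unipotent_mult:
  assumes "g - mat 1 \<in> raising l I 1" "h - mat 1 \<in> raising l I 1"
  shows "g ** h - mat 1 \<in> raising l I 1"
proof -
  have "g ** h - mat 1 = (g - mat 1) ** (h - mat 1) + ((g - mat 1) + (h - mat 1))"
    by (simp add: matrix_add_rdistrib matrix_diff_ldistrib matrix_add_ldistrib matrix_diff_rdistrib)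
  moreover have "(g - mat 1) ** (h - mat 1) \<in> raising l I 1"
    using raising_mono [OF raising_mult [OF assms], of 1] by simp
  ultimately show ?thesis
    using assms by (simp only: raising_add)
qed

text \<open>With \<open>h\<close> inverse to \<open>g\<close> and D = transpose g ** G ** g, the
  matrices S ** G and S0 ** D are conjugate by \<open>g\<close>, which is itself block triangular.
  The inverse of D is block triangular too, so D can be cancelled, and what is left is that
  \<open>S0\<close> be block triangular: \<open>G\<close> no longer occurs.\<close>

lemma flag_forms_eq_image:
  fixes G :: "complex^'n::finite^'n" and l :: "'n \<Rightarrow> nat"
  assumes sym: "transpose G = G" and G_off: "\<And>i j. i \<notin> I \<Longrightarrow> G $ i $ j = (if i = j then 1 else 0)"
    and I: "\<And>a b. a \<in> I \<Longrightarrow> b \<notin> I \<Longrightarrow> l a < l b"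
    and inv: "\<And>t. invertible (truncate {a \<in> I. l a < t} G)"
  obtains g where "g - mat 1 \<in> raising l I 1"
    "flag_forms l I G = (\<lambda>S. g ** S ** transpose g) ` flag_forms l I (mat 1)"
proof -
  let ?U = "pattern (\<lambda>i j. l i \<le> l j) :: (complex^'n^'n) set" and ?P = "pattern (\<lambda>a b. a \<in> I \<and> b \<in> I)  :: (complex^'n^'n) set"
  let ?R = "pattern (\<lambda>i j. i = j \<or> i \<in> I \<and> j \<in> I) :: (complex^'n^'n) set"
  have tU: "transp (\<lambda>i j. l i \<le> l j)" "reflp (\<lambda>i j. l i \<le> l j)" by (auto intro!: transpI reflpI)
  note U = pattern_mult [OF tU(1)]
  obtain g where g: "g - mat 1 \<in> raising l I 1" and gG: "transpose g ** G \<in> ?U"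
    using block_LDL [OF sym _ I inv] G_off by metis
  obtain h where h: "h - mat 1 \<in> raising l I 1" and gh: "g ** h = mat 1" "h ** g = mat 1"
    using unipotent_inverse [OF g] .
  have UR: "x \<in> ?U" "x \<in> ?R" if "x - mat 1 \<in> raising l I 1" for x
    using patternD [OF raising_imp_pattern [OF that]] by (auto intro!: patternI intro: less_imp_le)
  have PR: "x ** S ** transpose x \<in> ?P" if "x \<in> ?R" "S \<in> ?P" for x S
  proof -
    have 1: "x ** S \<in> ?P"
    proof (rule patternI)
      fix i j assume "(x ** S) $ i $ j \<noteq> 0"
      then obtain k where "x $ i $ k * S $ k $ j \<noteq> 0"
        unfolding matrix_mult_nth by (rule sum.not_neutral_contains_not_neutral)
      then show "i \<in> I \<and> j \<in> I" using patternD [OF that(1), of i k] patternD [OF that(2), of k j] by auto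
    qed
    show ?thesis
    proof (rule patternI)
      fix i j assume "(x ** S ** transpose x) $ i $ j \<noteq> 0"
      then obtain k where "(x ** S) $ i $ k * transpose x $ k $ j \<noteq> 0"
        unfolding matrix_mult_nth [of "x ** S"] by (rule sum.not_neutral_contains_not_neutral)
      then show "i \<in> I \<and> j \<in> I" using patternD [OF 1, of i k] patternD [OF that(1), of j k] by (auto simp: transpose_nth)
    qed
  qed
  have ghT: "transpose g ** transpose h = mat 1" "transpose h ** transpose g = mat 1"
    by (simp_all add: matrix_transpose_mul [symmetric] gh transpose_mat)
  have "flag_forms l I G = (\<lambda>S. g ** S ** transpose g) ` flag_forms l I (mat 1)"
  proof (intro equalityI subsetI)
    fix S assume "S \<in> flag_forms l I G"
    then have S: "transpose S = S" "S \<in> ?P" "S ** G \<in> ?U" by (auto simp: flag_forms_def)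
    define S0 where "S0 = h ** S ** transpose h"
    have eq: "S = g ** S0 ** transpose g"
      unfolding S0_def by (metis gh(1) ghT(2) matrix_mul_assoc matrix_mul_lid matrix_mul_rid)
    \<comment> \<open>For t above all levels the truncation reproduces \<open>G\<close>, which is
      the identity outside \<open>I\<close>; so \<open>G\<close> is itself among the matrices
      assumed invertible.\<close>
    have "G = truncate {a \<in> I. l a < Suc (Max (range l))} G"
      using G_off sym by (auto simp: truncate_def le_imp_less_Suc matrix_eq_iff) (metis transpose_nth)+
    with inv have "invertible G" by metis
    then obtain H where H: "G ** H = mat 1" unfolding invertible_def by blast
    define D where "D = transpose g ** G ** g"
    have "D \<in> ?U" unfolding D_def using U gG UR(1) [OF g] by blast
    \<comment> \<open>This exhibits the inverse of D, to which \<open>pattern_inverse\<close>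
      applies.\<close>
    have "D ** (h ** H ** transpose h) = transpose g ** (G ** ((g ** h) ** H)) ** transpose h"
      by (simp add: D_def matrix_mul_assoc)
    also have "\<dots> = mat 1" by (simp add: gh H ghT)
    finally have DH: "D ** (h ** H ** transpose h) = mat 1" .
    from pattern_inverse [OF tU(2,1) \<open>D \<in> ?U\<close> DH] have HU: "h ** H ** transpose h \<in> ?U" .
    have "S0 ** D = h ** (S ** (transpose h ** transpose g) ** G) ** g"
      by (simp add: D_def S0_def matrix_mul_assoc)
    also have "\<dots> = h ** (S ** G) ** g" by (simp add: ghT)
    also have "\<dots> \<in> ?U" using U UR(1) [OF h] UR(1) [OF g] S(3) by blast
    finally have "S0 ** D \<in> ?U" .
    then have "S0 ** D ** (h ** H ** transpose h) \<in> ?U" using HU U by blast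
    then have "S0 \<in> ?U" by (metis DH matrix_mul_assoc matrix_mul_rid)
    moreover have "transpose S0 = S0" by (simp add: S0_def matrix_transpose_mul S(1) matrix_mul_assoc)
    moreover have "S0 \<in> ?P" unfolding S0_def using PR UR(2) [OF h] S(2) by blast
    ultimately have "S0 \<in> flag_forms l I (mat 1)" by (simp add: flag_forms_def)
    then show "S \<in> (\<lambda>S. g ** S ** transpose g) ` flag_forms l I (mat 1)" using eq by blast
  next
    fix S assume "S \<in> (\<lambda>S. g ** S ** transpose g) ` flag_forms l I (mat 1)"
    then obtain S0 where S: "S = g ** S0 ** transpose g" and S0: "transpose S0 = S0" "S0 \<in> ?P" "S0 \<in> ?U"
      by (auto simp: flag_forms_def)
    have "transpose S = S" by (simp add: S matrix_transpose_mul S0(1) matrix_mul_assoc)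
    moreover have "S \<in> ?P" unfolding S using PR UR(2) [OF g] S0(2) by blast
    moreover have "S ** G \<in> ?U"
      unfolding S matrix_mul_assoc [symmetric] using U UR(1) [OF g] S0(3) gG by blast
    ultimately show "S \<in> flag_forms l I G" by (simp add: flag_forms_def)
  qed
  with g that show ?thesis by blast
qed

section \<open>Generic stabilisers for nilradicals in block form\<close>

text \<open>Functionals are linear only on \<nn>. Membership is asked just of the terms with nonzero
  coefficient, because the expansions below run over all indices and the remaining terms contribute
  0 on both sides.\<close>

lemma dual_space_sum:
  assumes xi: "\<xi> \<in> dual_space \<nn>" and n: "gl.subspace \<nn>"
    and y: "\<And>i. i \<in> T \<Longrightarrow> c i \<noteq> 0 \<Longrightarrow> y i \<in> \<nn>"
  shows "\<xi> (\<Sum>i\<in>T. cscale (c i) (y i)) = (\<Sum>i\<in>T. c i * \<xi> (y i))"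
proof -
  have add: "x \<in> \<nn> \<Longrightarrow> y \<in> \<nn> \<Longrightarrow> \<xi> (x + y) = \<xi> x + \<xi> y" for x y
    using xi by (auto simp: dual_space_def)
  have scale: "x \<in> \<nn> \<Longrightarrow> \<xi> (cscale c x) = c * \<xi> x" for c x
    using xi by (auto simp: dual_space_def)
  have 0: "\<xi> 0 = 0" using add [of 0 0] gl.subspace_0 [OF n] by simp
  have "(\<Sum>i\<in>T. cscale (c i) (y i)) \<in> \<nn> \<and> \<xi> (\<Sum>i\<in>T. cscale (c i) (y i)) = (\<Sum>i\<in>T. c i * \<xi> (y i))"
    using y
  proof (induction T rule: infinite_finite_induct)
    case (insert i T)
    then have IH: "(\<Sum>i\<in>T. cscale (c i) (y i)) \<in> \<nn>" "\<xi> (\<Sum>i\<in>T. cscale (c i) (y i)) = (\<Sum>i\<in>T. c i * \<xi> (y i))"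
      by auto
    show ?case
    proof (cases "c i = 0")
      case True
      then show ?thesis using insert.hyps IH by simp
    next
      case False
      then have "y i \<in> \<nn>" "cscale (c i) (y i) \<in> \<nn>" using insert.prems gl.subspace_scale [OF n] by auto
      then show ?thesis using insert.hyps IH by (simp add: add scale gl.subspace_add [OF n])
    qed
  next
    case (infinite T)
    then show ?case using 0 gl.subspace_0 [OF n] by simp
  next
    case empty
    then show ?case using 0 gl.subspace_0 [OF n] by simp
  qed
  then show ?thesis ..
qed

definition dual_restrict :: "(complex^'m^'m) set \<Rightarrow> (complex^'m^'m \<Rightarrow> complex) \<Rightarrow> complex^'m^'m \<Rightarrow> complex" where
  "dual_restrict \<nn> \<phi> = (\<lambda>x. if x \<in> \<nn> then \<phi> x else 0)"

lemma coadjoint_stabiliser_iff: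
  "x \<in> coadjoint_stabiliser \<nn> \<xi> \<longleftrightarrow> x \<in> \<nn> \<and> (\<forall>y\<in>\<nn>. \<xi> (lie_bracket x y) = 0)"
  by (auto simp: coadjoint_stabiliser_def coadjoint_def fun_eq_iff)

section \<open>Polynomial functions and principal open sets\<close>

lemma dual_polynomials_sum:
  assumes "\<And>i. i \<in> T \<Longrightarrow> p i \<in> dual_polynomials \<nn>"
  shows "(\<lambda>\<xi>. \<Sum>i\<in>T. p i \<xi>) \<in> dual_polynomials \<nn>"
  using assms
proof (induction T rule: infinite_finite_induct)
  case (insert i T)
  then have "(\<lambda>\<xi>. p i \<xi> + (\<Sum>i\<in>T. p i \<xi>)) \<in> dual_polynomials \<nn>"
    by (intro dual_polynomials.add [of "p i"]) simp_all
  then show ?case using insert.hyps by simp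
qed (simp_all add: dual_polynomials.const)

lemma dual_polynomials_prod:
  assumes "\<And>i. i \<in> T \<Longrightarrow> p i \<in> dual_polynomials \<nn>"
  shows "(\<lambda>\<xi>. \<Prod>i\<in>T. p i \<xi>) \<in> dual_polynomials \<nn>"
  using assms
proof (induction T rule: infinite_finite_induct)
  case (insert i T)
  then have "(\<lambda>\<xi>. p i \<xi> * (\<Prod>i\<in>T. p i \<xi>)) \<in> dual_polynomials \<nn>"
    by (intro dual_polynomials.mult [of "p i"]) simp_all
  then show ?case using insert.hyps by simp
qed (simp_all add: dual_polynomials.const)

lemma dual_polynomials_det:
  assumes "\<And>i j. (\<lambda>\<xi>. M \<xi> $ i $ j) \<in> dual_polynomials \<nn>"
  shows "(\<lambda>\<xi>. det (M \<xi>)) \<in> dual_polynomials \<nn>"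
  unfolding det_def
proof (rule dual_polynomials_sum)
  fix \<sigma>
  show "(\<lambda>\<xi>. of_int (sign \<sigma>) * (\<Prod>i\<in>UNIV. M \<xi> $ i $ \<sigma> i)) \<in> dual_polynomials \<nn>"
    by (rule dual_polynomials.mult [OF dual_polynomials.const dual_polynomials_prod]) (rule assms)
qed

lemma dual_polynomial_on_line:
  assumes "p \<in> dual_polynomials \<nn>"
  shows "\<exists>P. \<forall>t. p (\<lambda>x. \<xi> x + t * \<eta> x) = poly P t"
  using assms
proof induction
  case (const c)
  show ?case by (rule exI [of _ "[:c:]"]) simp
next
  case (eval x)
  show ?case by (rule exI [of _ "[:\<xi> x, \<eta> x:]"]) simp
next
  case (add p q)
  then show ?case by (metis poly_add)
next
  case (mult p q)
  then show ?case by (metis poly_mult)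
qed

lemma dual_space_line:
  "\<xi> \<in> dual_space \<nn> \<Longrightarrow> \<eta> \<in> dual_space \<nn> \<Longrightarrow> (\<lambda>x. \<xi> x + t * (\<eta> x - \<xi> x)) \<in> dual_space \<nn>"
  unfolding dual_space_def by (simp add: algebra_simps)

text \<open>The dual space is irreducible. On the line from an arbitrary point to \<xi>0, both
  \<open>f\<close> and an equation \<open>p\<close> of a closed set containing \<Omega> become
  polynomials in one variable; their product vanishes and the one from \<open>f\<close> is not 0, so
  \<open>p\<close> vanishes on the whole line.\<close>

lemma principal_open:
  assumes f: "f \<in> dual_polynomials \<nn>" and "\<xi>0 \<in> dual_space \<nn>" "f \<xi>0 \<noteq> 0"
  defines "\<Omega> \<equiv> {\<xi> \<in> dual_space \<nn>. f \<xi> \<noteq> 0}"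
  shows "zariski_open \<nn> \<Omega>" "zariski_dense \<nn> \<Omega>"
proof -
  have "zariski_closed \<nn> (dual_space \<nn> - \<Omega>)"
    unfolding zariski_closed_def using f by (intro exI [of _ "{f}"]) (auto simp: \<Omega>_def)
  then show "zariski_open \<nn> \<Omega>" by (auto simp: zariski_open_def \<Omega>_def)
  show "zariski_dense \<nn> \<Omega>"
    unfolding zariski_dense_def
  proof (intro conjI allI impI)
    show "\<Omega> \<subseteq> dual_space \<nn>" by (auto simp: \<Omega>_def)
    fix Z assume Z: "zariski_closed \<nn> Z \<and> \<Omega> \<subseteq> Z"
    then obtain F where F: "F \<subseteq> dual_polynomials \<nn>" and ZF: "Z = {\<xi> \<in> dual_space \<nn>. \<forall>f\<in>F. f \<xi> = 0}"
      by (auto simp: zariski_closed_def)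
    have "p \<xi> = 0" if p: "p \<in> F" and xi: "\<xi> \<in> dual_space \<nn>" for p \<xi>
    proof -
      let ?L = "\<lambda>t x. \<xi> x + t * (\<xi>0 x - \<xi> x)"
      obtain P where P: "\<And>t. p (?L t) = poly P t" using dual_polynomial_on_line [of p \<nn> \<xi> "\<lambda>x. \<xi>0 x - \<xi> x"] p F by auto
      obtain Q where Q: "\<And>t. f (?L t) = poly Q t" using dual_polynomial_on_line [OF f, of \<xi> "\<lambda>x. \<xi>0 x - \<xi> x"] by auto
      have L1: "?L 1 = \<xi>0" and L0: "?L 0 = \<xi>" by auto
      have "Q \<noteq> 0" using assms(3) Q [of 1] unfolding L1 by auto
      have "poly (P * Q) t = 0" for t
      proof (cases "poly Q t = 0")
        case False
        then have "?L t \<in> \<Omega>" using dual_space_line [OF xi assms(2)] Q by (simp add: \<Omega>_def)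
        then have "p (?L t) = 0" using Z p unfolding ZF by blast
        then show ?thesis using P by simp
      qed simp
      then have "P * Q = 0" using poly_all_0_iff_0 by blast
      then have "P = 0" using \<open>Q \<noteq> 0\<close> by simp
      then show ?thesis using P [of 0] unfolding L0 by simp
    qed
    then show "Z = dual_space \<nn>" using ZF by blast
  qed
qed

lemma matrix_inv_eqI:
  assumes "A ** B = mat 1" "B ** A = mat 1"
  shows "matrix_inv A = B"
  unfolding matrix_inv_def
proof (rule some_equality)
  fix C assume "A ** C = mat 1 \<and> C ** A = mat 1"
  then have "C = (B ** A) ** C" using assms(2) by simp
  also have "\<dots> = B" using \<open>A ** C = mat 1 \<and> C ** A = mat 1\<close> by (simp flip: matrix_mul_assoc)
  finally show "C = B" .
qed (use assms in simp)

section \<open>Symmetric matrices in the upper right block\<close>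

definition unipotent_block :: "complex^'n^'n \<Rightarrow> complex^('n::finite + 'n)^('n + 'n)" where
  "unipotent_block S = block 0 S 0 0"

text \<open>For a = b the two summands add up to 2. This keeps the expansions free of case
  distinctions and of factors 1/2; the diagonal of \<open>gram\<close> is doubled
  accordingly.\<close>

definition sym_unit :: "'n \<Rightarrow> 'n \<Rightarrow> complex^'n^'n::finite" where
  "sym_unit a b = (\<chi> i j. (if i = a \<and> j = b then 1 else 0) + (if i = b \<and> j = a then 1 else 0))"

lemma sym_unit_commute: "sym_unit a b = sym_unit b a"
  by (simp add: sym_unit_def add.commute)

lemma transpose_sym_unit [simp]: "transpose (sym_unit a b) = sym_unit a b"
  by (simp add: sym_unit_def transpose_nth vec_eq_iff conj_commute add.commute)

lemma unipotent_block_add: "unipotent_block (S + T) = unipotent_block S + unipotent_block T"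
  by (simp add: unipotent_block_def block_add)

lemma unipotent_block_cscale: "unipotent_block (cscale c S) = cscale c (unipotent_block S)"
  by (simp add: unipotent_block_def block_cscale)

lemma unipotent_block_0 [simp]: "unipotent_block 0 = 0"
  by (simp add: unipotent_block_def block_zero)

lemma unipotent_block_sum:
  "unipotent_block (\<Sum>i\<in>T. cscale (c i) (S i)) = (\<Sum>i\<in>T. cscale (c i) (unipotent_block (S i)))"
  by (induction T rule: infinite_finite_induct) (auto simp: unipotent_block_add unipotent_block_cscale)

lemma sum_sym_unit:
  "(\<Sum>i\<in>UNIV. f i * sym_unit i c $ p $ q) = (if q = c then f p else 0) + (if p = c then f q else 0)"
proof -
  have "(\<Sum>i\<in>UNIV. f i * sym_unit i c $ p $ q)
      = (\<Sum>i\<in>UNIV. (if i = p then if q = c then f i else 0 else 0) + (if i = q then if p = c then f i else 0 else 0))"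
    by (rule sum.cong) (auto simp: sym_unit_def)
  then show ?thesis by (simp add: sum.distrib)
qed

lemma sum_sum_sym_unit:
  "(\<Sum>c\<in>UNIV. \<Sum>j\<in>UNIV. f c j * sym_unit c j $ p $ q) = f p q + f q p"
proof -
  have "(\<Sum>j\<in>UNIV. f c j * sym_unit c j $ p $ q) = (if q = c then f c p else 0) + (if p = c then f c q else 0)" for c
    using sum_sym_unit [of "f c" c p q] by (simp add: sym_unit_commute)
  then show ?thesis by (simp add: sum.distrib)
qed

lemma pattern_add:
  assumes "A \<in> pattern Q" "B \<in> pattern Q"
  shows "A + B \<in> pattern Q"
proof (rule patternI)
  fix i j assume "(A + B) $ i $ j \<noteq> 0"
  then have "A $ i $ j \<noteq> 0 \<or> B $ i $ j \<noteq> 0" by auto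
  then show "Q i j" using assms patternD by blast
qed

lemma pattern_cscale: "A \<in> pattern Q \<Longrightarrow> cscale c A \<in> pattern Q"
  by (auto simp: pattern_def cscale_def)

lemma pattern_0 [simp]: "0 \<in> pattern Q"
  by (simp add: pattern_def)

lemma transpose_add: "transpose (A + B) = transpose A + transpose (B :: complex^'n^'m)"
  by (simp add: vec_eq_iff transpose_nth)

lemma transpose_cscale: "transpose (cscale c A) = cscale c (transpose A)"
  by (simp add: vec_eq_iff transpose_def cscale_def)

lemma transpose_0 [simp]: "transpose 0 = (0 :: complex^'n^'m)"
  by (simp add: vec_eq_iff transpose_def)

lemma cscale_minus: "cscale c (- A) = - cscale c A"
  by (simp add: vec_eq_iff cscale_def)

text \<open>The combinatorics of a parabolic subalgebra: \<open>l\<close> orders the basis vectors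
  by the step of the flag at which they enter, and \<open>I\<close> indexes the isotropic space W.
  Indices outside \<open>I\<close> belong to the symplectic factor of the Levi subalgebra and share
  one top level.\<close>

locale level_data =
  fixes l :: "'n::finite \<Rightarrow> nat" and I :: "'n set"
  assumes I_less: "\<And>a b. a \<in> I \<Longrightarrow> b \<notin> I \<Longrightarrow> l a < l b"
    and not_I_eq: "\<And>a b. a \<notin> I \<Longrightarrow> b \<notin> I \<Longrightarrow> l a = l b"
begin

definition block_nil :: "(complex^('n + 'n)^('n + 'n)) set" where
  "block_nil = {block A S 0 (- transpose A) | A S. A \<in> pattern (\<lambda>a b. l a < l b) \<and> transpose S = S
            \<and> S \<in> pattern (\<lambda>a b. a \<in> I \<or> b \<in> I)}"

lemma less_in_I: "l a < l b \<Longrightarrow> a \<in> I"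
  using I_less [of b a] not_I_eq [of a b] by (cases "a \<in> I"; cases "b \<in> I") auto

lemma block_nil_mem_iff: "block A S 0 (- transpose A) \<in> block_nil \<longleftrightarrow> A \<in> pattern (\<lambda>a b. l a < l b) \<and> transpose S = S
            \<and> S \<in> pattern (\<lambda>a b. a \<in> I \<or> b \<in> I)"
  by (auto simp: block_nil_def)

lemma unipotent_mem_iff: "unipotent_block S \<in> block_nil \<longleftrightarrow> transpose S = S \<and> S \<in> pattern (\<lambda>a b. a \<in> I \<or> b \<in> I)"
  using block_nil_mem_iff [of 0 S] by (simp add: unipotent_block_def)

lemma sym_unit_mem:
  assumes "a \<in> I \<or> b \<in> I"
  shows "unipotent_block (sym_unit a b) \<in> block_nil"
proof -
  have "i \<in> I \<or> j \<in> I" if "sym_unit a b $ i $ j \<noteq> 0" for i j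
  proof -
    have "i = a \<and> j = b \<or> i = b \<and> j = a"
      using that by (cases "i = a"; cases "i = b"; cases "j = a"; cases "j = b") (simp_all add: sym_unit_def)
    with assms show ?thesis by blast
  qed
  then show ?thesis unfolding unipotent_mem_iff by (intro conjI transpose_sym_unit patternI)
qed

lemma subspace_block_nil: "gl.subspace block_nil"
proof (rule gl.subspaceI)
  show "0 \<in> block_nil" unfolding block_nil_def
    by (intro CollectI exI [of _ 0]) (simp add: block_zero)
next
  fix x y assume "x \<in> block_nil" "y \<in> block_nil"
  then obtain A S B T where x: "x = block A S 0 (- transpose A)" and y: "y = block B T 0 (- transpose B)"
    and "A \<in> pattern (\<lambda>a b. l a < l b)" "transpose S = S" "S \<in> pattern (\<lambda>a b. a \<in> I \<or> b \<in> I)"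
    and "B \<in> pattern (\<lambda>a b. l a < l b)" "transpose T = T" "T \<in> pattern (\<lambda>a b. a \<in> I \<or> b \<in> I)"
    unfolding block_nil_def by blast
  then have "A + B \<in> pattern (\<lambda>a b. l a < l b)" "transpose (S + T) = S + T" "S + T \<in> pattern (\<lambda>a b. a \<in> I \<or> b \<in> I)"
    by (simp_all add: pattern_add transpose_add)
  moreover have "x + y = block (A + B) (S + T) 0 (- transpose (A + B))"
    by (simp add: x y block_add transpose_add)
  ultimately show "x + y \<in> block_nil" unfolding block_nil_def by blast
next
  fix c x assume "x \<in> block_nil"
  then obtain A S where x: "x = block A S 0 (- transpose A)"
    and "A \<in> pattern (\<lambda>a b. l a < l b)" "transpose S = S" "S \<in> pattern (\<lambda>a b. a \<in> I \<or> b \<in> I)"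
    unfolding block_nil_def by blast
  then have "cscale c A \<in> pattern (\<lambda>a b. l a < l b)" "transpose (cscale c S) = cscale c S" "cscale c S \<in> pattern (\<lambda>a b. a \<in> I \<or> b \<in> I)"
    by (simp_all add: pattern_cscale transpose_cscale)
  moreover have "cscale c x = block (cscale c A) (cscale c S) 0 (- transpose (cscale c A))"
    by (simp add: x block_cscale transpose_cscale cscale_minus)
  ultimately show "cscale c x \<in> block_nil" unfolding block_nil_def by blast
qed

text \<open>The form \<gamma> in coordinates. For \<xi> in \<open>dual_space block_nil\<close> the
  values with both indices outside \<open>I\<close> are 0 by the convention on functionals; for
  nondegenerate \<xi> the values on \<open>I\<close> govern the stabiliser.\<close>

definition gram :: "(complex^('n + 'n)^('n + 'n) \<Rightarrow> complex) \<Rightarrow> 'n \<Rightarrow> 'n \<Rightarrow> complex" where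
  "gram \<xi> a b = \<xi> (unipotent_block (sym_unit a b))"

lemma gram_commute: "gram \<xi> a b = gram \<xi> b a"
  by (simp add: gram_def sym_unit_commute)

text \<open>Only columns k and c of \<open>A\<close> occur, which lets the stabiliser condition kill
  \<open>A\<close> column by column.\<close>

lemma bracket_sym_unit:
  "lie_bracket (block A S 0 (- transpose A)) (unipotent_block (sym_unit k c))
    = (\<Sum>i\<in>UNIV. cscale (A $ i $ k) (unipotent_block (sym_unit i c)))
    + (\<Sum>i\<in>UNIV. cscale (A $ i $ c) (unipotent_block (sym_unit i k)))"
proof -
  have E: "A ** sym_unit k c + sym_unit k c ** transpose A
     = (\<Sum>i\<in>UNIV. cscale (A $ i $ k) (sym_unit i c)) + (\<Sum>i\<in>UNIV. cscale (A $ i $ c) (sym_unit i k))"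
    (is "?L = ?R")
  proof -
    have L: "(A ** sym_unit k c) $ p $ q = (if q = c then A $ p $ k else 0) + (if q = k then A $ p $ c else 0)" for p q
    proof -
      have "(A ** sym_unit k c) $ p $ q
          = (\<Sum>i\<in>UNIV. (if i = k then if q = c then A $ p $ i else 0 else 0) + (if i = c then if q = k then A $ p $ i else 0 else 0))"
        unfolding matrix_mult_nth
      proof (rule sum.cong [OF refl])
        fix i
        show "A $ p $ i * sym_unit k c $ i $ q = (if i = k then if q = c then A $ p $ i else 0 else 0) + (if i = c then if q = k then A $ p $ i else 0 else 0)"
          by (cases "i = k"; cases "i = c"; simp add: sym_unit_def)
      qed
      then show ?thesis by (simp add: sum.distrib)
    qed
    have "sym_unit k c ** transpose A = transpose (A ** sym_unit k c)" by (simp add: matrix_transpose_mul)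
    then have "?L $ p $ q = ?R $ p $ q" for p q
      by (simp add: L transpose_nth cscale_def sum_sym_unit)
    then show ?thesis by (simp add: matrix_eq_iff)
  qed
  have B: "lie_bracket (block A S 0 (- transpose A)) (unipotent_block T) = unipotent_block (A ** T + T ** transpose A)" for T
    by (simp add: lie_bracket_def unipotent_block_def block_mult block_diff matrix_mult_minus_right)
  show ?thesis unfolding B E unipotent_block_add unipotent_block_sum ..
qed

lemma dual_bracket_sym_unit:
  assumes xi: "\<xi> \<in> dual_space block_nil" and x: "block A S 0 (- transpose A) \<in> block_nil" and kc: "k \<in> I \<or> c \<in> I"
  shows "\<xi> (lie_bracket (block A S 0 (- transpose A)) (unipotent_block (sym_unit k c)))
     = (\<Sum>i\<in>UNIV. A $ i $ k * gram \<xi> i c) + (\<Sum>i\<in>UNIV. A $ i $ c * gram \<xi> i k)"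
proof -
  have A: "A $ i $ j \<noteq> 0 \<Longrightarrow> i \<in> I" for i j
    using x less_in_I unfolding block_nil_mem_iff pattern_def by blast
  have mem: "(\<Sum>i\<in>UNIV. cscale (A $ i $ k) (unipotent_block (sym_unit i c))) \<in> block_nil" for k c
  proof (rule gl.subspace_sum [OF subspace_block_nil])
    fix i show "cscale (A $ i $ k) (unipotent_block (sym_unit i c)) \<in> block_nil"
      using A [of i k] sym_unit_mem [of i c] gl.subspace_0 [OF subspace_block_nil] gl.subspace_scale [OF subspace_block_nil]
      by (cases "A $ i $ k = 0") auto
  qed
  have "\<xi> (x + y) = \<xi> x + \<xi> y" if "x \<in> block_nil" "y \<in> block_nil" for x y using xi that by (simp add: dual_space_def)
  then show ?thesis
    unfolding bracket_sym_unit gram_def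
    by (simp add: mem dual_space_sum [OF xi subspace_block_nil] sym_unit_mem A)
qed

text \<open>For any X, the symmetric matrix X + transpose X is the sum over all ordered pairs (c, j)
  of the entries of X times \<open>sym_unit c j\<close>; here X = - (A ** S).\<close>

lemma bracket_unipotent:
  assumes S: "transpose S = S"
  shows "lie_bracket (unipotent_block S) (block A T 0 (- transpose A))
    = (\<Sum>(c,j)\<in>UNIV. cscale (- (A ** S) $ c $ j) (unipotent_block (sym_unit c j)))"
proof -
  have "- (A ** S + S ** transpose A) = (\<Sum>(c,j)\<in>UNIV. cscale (- (A ** S) $ c $ j) (sym_unit c j))"
    (is "?L = ?R")
  proof -
    have "?R $ p $ q = (\<Sum>c\<in>UNIV. \<Sum>j\<in>UNIV. - (A ** S) $ c $ j * sym_unit c j $ p $ q)" for p q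
      by (simp add: sum.cartesian_product case_prod_unfold cscale_def flip: UNIV_Times_UNIV)
    moreover have "S ** transpose A = transpose (A ** S)" by (simp add: matrix_transpose_mul S)
    ultimately have "?R $ p $ q = ?L $ p $ q" for p q
      by (simp only: sum_sum_sym_unit) (simp add: transpose_nth)
    then show ?thesis by (simp add: matrix_eq_iff)
  qed
  moreover have "lie_bracket (unipotent_block S) (block A T 0 (- transpose A)) = unipotent_block (- (A ** S + S ** transpose A))"
    by (simp add: lie_bracket_def unipotent_block_def block_mult block_diff matrix_mult_minus_right)
  ultimately show ?thesis
    by (simp only: unipotent_block_sum case_prod_unfold)
qed

text \<open>The double sum is the trace of A ** S ** \<Gamma> with \<Gamma> the matrix of
  \<open>gram \<xi>\<close>. As \<open>A\<close> ranges over the strictly triangular matrices, it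
  tests exactly the entries of S ** \<Gamma> below the block diagonal.\<close>

lemma dual_bracket_unipotent:
  assumes xi: "\<xi> \<in> dual_space block_nil" and S: "transpose S = S" and A: "A \<in> pattern (\<lambda>a b. l a < l b)"
  shows "\<xi> (lie_bracket (unipotent_block S) (block A T 0 (- transpose A)))
    = - (\<Sum>c\<in>UNIV. \<Sum>k\<in>UNIV. A $ c $ k * (\<Sum>j\<in>UNIV. S $ k $ j * gram \<xi> j c))"
proof -
  have AS: "c \<in> I" if "(A ** S) $ c $ j \<noteq> 0" for c j
  proof -
    from that obtain k where "A $ c $ k * S $ k $ j \<noteq> 0"
      unfolding matrix_mult_nth by (rule sum.not_neutral_contains_not_neutral)
    then show ?thesis using patternD [OF A, of c k] less_in_I by auto
  qed
  have "\<xi> (lie_bracket (unipotent_block S) (block A T 0 (- transpose A)))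
    = \<xi> (\<Sum>x\<in>UNIV. cscale (- (A ** S) $ fst x $ snd x) (unipotent_block (sym_unit (fst x) (snd x))))"
    unfolding bracket_unipotent [OF S] by (simp add: case_prod_unfold)
  also have "\<dots> = (\<Sum>x\<in>UNIV. - (A ** S) $ fst x $ snd x * \<xi> (unipotent_block (sym_unit (fst x) (snd x))))"
    by (rule dual_space_sum [OF xi subspace_block_nil]) (use AS sym_unit_mem in auto)
  also have "\<dots> = - (\<Sum>c\<in>UNIV. \<Sum>j\<in>UNIV. (A ** S) $ c $ j * gram \<xi> j c)"
    by (simp add: sum.cartesian_product case_prod_unfold gram_def sum_negf sym_unit_commute flip: UNIV_Times_UNIV)
  also have "(\<Sum>c\<in>UNIV. \<Sum>j\<in>UNIV. (A ** S) $ c $ j * gram \<xi> j c)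
     = (\<Sum>c\<in>UNIV. \<Sum>j\<in>UNIV. \<Sum>k\<in>UNIV. A $ c $ k * (S $ k $ j * gram \<xi> j c))"
    by (simp add: matrix_mult_nth sum_distrib_right mult.assoc)
  also have "\<dots> = (\<Sum>c\<in>UNIV. \<Sum>k\<in>UNIV. \<Sum>j\<in>UNIV. A $ c $ k * (S $ k $ j * gram \<xi> j c))"
    by (rule sum.cong [OF refl]) (rule sum.swap)
  finally show ?thesis by (simp add: sum_distrib_left)
qed

text \<open>Completed by the identity outside \<open>I\<close>, so that the results on square
  matrices over the whole index type apply.\<close>

definition gram_matrix :: "(complex^('n + 'n)^('n + 'n) \<Rightarrow> complex) \<Rightarrow> complex^'n^'n" where
  "gram_matrix \<xi> = (\<chi> i j. if i \<in> I \<and> j \<in> I then gram \<xi> i j else if i = j then 1 else 0)"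

abbreviation nondegenerate :: "(complex^('n + 'n)^('n + 'n) \<Rightarrow> complex) \<Rightarrow> bool" where
  "nondegenerate \<xi> \<equiv> \<forall>t. invertible (truncate {a \<in> I. l a < t} (gram_matrix \<xi>))"

lemma sum_gram_matrix:
  assumes "\<And>j. v j \<noteq> 0 \<Longrightarrow> j \<in> I" "c \<in> I"
  shows "(\<Sum>j\<in>UNIV. v j * gram_matrix \<xi> $ j $ c) = (\<Sum>j\<in>UNIV. v j * gram \<xi> j c)"
proof (rule sum.cong [OF refl])
  fix j show "v j * gram_matrix \<xi> $ j $ c = v j * gram \<xi> j c"
    using assms by (cases "v j = 0") (auto simp: gram_matrix_def)
qed

lemma transpose_gram_matrix: "transpose (gram_matrix \<xi>) = gram_matrix \<xi>"
  by (simp add: vec_eq_iff transpose_nth gram_matrix_def gram_commute conj_commute eq_commute)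

lemma gram_nondegenerate:
  assumes nd: "nondegenerate \<xi>" and v: "\<And>i. v $ i \<noteq> 0 \<Longrightarrow> i \<in> I \<and> l i < t"
    and eq: "\<And>j. j \<in> I \<Longrightarrow> l j < t \<Longrightarrow> (\<Sum>i\<in>UNIV. v $ i * gram \<xi> i j) = 0"
  shows "v = 0"
proof (rule truncate_nondegenerate)
  show "invertible (truncate {a \<in> I. l a < t} (gram_matrix \<xi>))" using nd by blast
  show "j \<in> {a \<in> I. l a < t}" if "v $ j \<noteq> 0" for j using v [OF that] by simp
  fix i assume "i \<in> {a \<in> I. l a < t}"
  then have i: "i \<in> I" "l i < t" by auto
  have "(\<Sum>j\<in>UNIV. gram_matrix \<xi> $ i $ j * v $ j) = (\<Sum>j\<in>UNIV. v $ j * gram_matrix \<xi> $ j $ i)"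
    by (rule sum.cong [OF refl]) (metis mult.commute transpose_gram_matrix transpose_nth)
  also have "\<dots> = 0" using sum_gram_matrix [of "\<lambda>j. v $ j" i \<xi>] v i eq by simp
  finally show "(\<Sum>j\<in>UNIV. gram_matrix \<xi> $ i $ j * v $ j) = 0" .
qed

lemma coadjoint_stabiliser_block_nil:
  assumes xi: "\<xi> \<in> dual_space block_nil" and nd: "nondegenerate \<xi>"
  shows "coadjoint_stabiliser block_nil \<xi> = unipotent_block ` flag_forms l I (gram_matrix \<xi>)"
proof (intro equalityI subsetI)
  fix x assume "x \<in> coadjoint_stabiliser block_nil \<xi>"
  then have "x \<in> block_nil" and stab: "\<And>y. y \<in> block_nil \<Longrightarrow> \<xi> (lie_bracket x y) = 0"
    by (auto simp: coadjoint_stabiliser_iff)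
  then obtain A S where x: "x = block A S 0 (- transpose A)" and A: "A \<in> pattern (\<lambda>a b. l a < l b)"
    and S: "transpose S = S" "S \<in> pattern (\<lambda>a b. a \<in> I \<or> b \<in> I)"
    unfolding block_nil_def by blast
  \<comment> \<open>Column k is supported on the part of \<open>I\<close> below level l k.
    Bracketing with \<open>sym_unit k j\<close>, for j in that part, pairs the column with j up to a
    term in column j, which is 0 by induction. So the column is orthogonal to the space in which it
    lies.\<close>
  have "column k A = 0" for k
  proof (induction "l k" arbitrary: k rule: less_induct)
    case less
    show ?case
    proof (rule gram_nondegenerate [OF nd, where t = "l k"])
      fix i assume "column k A $ i \<noteq> 0"
      then have "l i < l k" using patternD [OF A, of i k] by (simp add: column_def)
      then show "i \<in> I \<and> l i < l k" using less_in_I by blast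
    next
      fix j assume j: "j \<in> I" "l j < l k"
      have "A $ i $ j = 0" for i
        using less [OF j(2)] by (simp add: column_def vec_eq_iff)
      then show "(\<Sum>i\<in>UNIV. column k A $ i * gram \<xi> i j) = 0"
        using dual_bracket_sym_unit [OF xi \<open>x \<in> block_nil\<close> [unfolded x], of k j] stab [OF sym_unit_mem [of k j]] j(1)
        by (simp add: x column_def)
    qed
  qed
  then have "A = 0" by (simp add: vec_eq_iff column_def)
  then have x: "x = unipotent_block S" by (simp add: x unipotent_block_def)
  have orth: "(\<Sum>j\<in>UNIV. S $ k $ j * gram \<xi> j c) = 0" if "l c < l k" for c k
  proof -
    \<comment> \<open>A matrix unit isolates a single entry of S ** \<Gamma> in the trace.\<close>
    let ?A = "(\<chi> a b. if a = c \<and> b = k then 1 else 0) :: complex^'n^'n"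
    have A: "?A \<in> pattern (\<lambda>a b. l a < l b)" using that by (intro patternI) (auto split: if_splits)
    then have "block ?A 0 0 (- transpose ?A) \<in> block_nil" unfolding block_nil_mem_iff by simp
    from stab [OF this] have "(\<Sum>c'\<in>UNIV. \<Sum>k'\<in>UNIV. ?A $ c' $ k' * (\<Sum>j\<in>UNIV. S $ k' $ j * gram \<xi> j c')) = 0"
      unfolding x dual_bracket_unipotent [OF xi S(1) A] by simp
    also have "(\<Sum>c'\<in>UNIV. \<Sum>k'\<in>UNIV. ?A $ c' $ k' * (\<Sum>j\<in>UNIV. S $ k' $ j * gram \<xi> j c'))
      = (\<Sum>c'\<in>UNIV. \<Sum>k'\<in>UNIV. if k' = k then if c' = c then \<Sum>j\<in>UNIV. S $ k' $ j * gram \<xi> j c' else 0 else 0)"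
      by (intro sum.cong refl) simp
    finally show ?thesis by simp
  qed
  have S_I: "k \<in> I" if "S $ k $ j \<noteq> 0" for k j
  proof (rule ccontr)
    assume k: "k \<notin> I"
    \<comment> \<open>All of \<open>I\<close> lies below level l k, so this row is a vector of W
      that is orthogonal to all of W.\<close>
    have "row k S = 0"
    proof (rule gram_nondegenerate [OF nd, where t = "l k"])
      fix i assume "row k S $ i \<noteq> 0"
      then show "i \<in> I \<and> l i < l k" using patternD [OF S(2), of k i] k I_less by (auto simp: row_def)
    qed (use orth in \<open>simp add: row_def\<close>)
    then show False using that by (simp add: row_def vec_eq_iff)
  qed
  have S_sym: "S $ i $ j = S $ j $ i" for i j using S(1) by (metis transpose_nth)
  have "S \<in> pattern (\<lambda>a b. a \<in> I \<and> b \<in> I)"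
  proof (rule patternI)
    fix i j assume nz: "S $ i $ j \<noteq> 0"
    show "i \<in> I \<and> j \<in> I" using S_I [OF nz] S_I [of j i] S_sym [of i j] nz by simp
  qed
  moreover have "S ** gram_matrix \<xi> \<in> pattern (\<lambda>i j. l i \<le> l j)"
  proof (rule patternI, rule ccontr)
    fix k c assume nz: "(S ** gram_matrix \<xi>) $ k $ c \<noteq> 0" and "\<not> l k \<le> l c"
    then have less: "l c < l k" by simp
    have "(S ** gram_matrix \<xi>) $ k $ c = (\<Sum>j\<in>UNIV. S $ k $ j * gram \<xi> j c)"
      unfolding matrix_mult_nth
    proof (rule sum_gram_matrix)
      show "j \<in> I" if "S $ k $ j \<noteq> 0" for j using that S_I [of j k] S_sym [of k j] by simp
    qed (rule less_in_I [OF less])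
    then show False using nz orth [OF less] by simp
  qed
  ultimately show "x \<in> unipotent_block ` flag_forms l I (gram_matrix \<xi>)"
    using S(1) x by (auto simp: flag_forms_def)
next
  fix x assume "x \<in> unipotent_block ` flag_forms l I (gram_matrix \<xi>)"
  then obtain S where x: "x = unipotent_block S" and S: "transpose S = S" "S \<in> pattern (\<lambda>a b. a \<in> I \<and> b \<in> I)"
    and SG: "S ** gram_matrix \<xi> \<in> pattern (\<lambda>i j. l i \<le> l j)" by (auto simp: flag_forms_def)
  have "x \<in> block_nil" unfolding x unipotent_mem_iff using S patternD [OF S(2)] by (blast intro: patternI)
  moreover have "\<xi> (lie_bracket x y) = 0" if "y \<in> block_nil" for y
  proof -
    obtain A T where y: "y = block A T 0 (- transpose A)" and A: "A \<in> pattern (\<lambda>a b. l a < l b)"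
      using \<open>y \<in> block_nil\<close> unfolding block_nil_def by blast
    have "A $ c $ k * (\<Sum>j\<in>UNIV. S $ k $ j * gram \<xi> j c) = 0" for c k
    proof (cases "A $ c $ k = 0")
      case False
      then have less: "l c < l k" using patternD [OF A] by blast
      have "(\<Sum>j\<in>UNIV. S $ k $ j * gram \<xi> j c) = (S ** gram_matrix \<xi>) $ k $ c"
        unfolding matrix_mult_nth
        by (rule sum_gram_matrix [symmetric]) (use patternD [OF S(2)] less_in_I [OF less] in blast)+
      also have "\<dots> = 0" using patternD [OF SG, of k c] less by force
      finally show ?thesis by simp
    qed simp
    then show ?thesis unfolding x y dual_bracket_unipotent [OF xi S(1) A] by (simp only: sum.neutral_const minus_zero)
  qed
  ultimately show "x \<in> coadjoint_stabiliser block_nil \<xi>" by (simp add: coadjoint_stabiliser_iff)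
qed

text \<open>Both stabilisers come from the same space of block diagonal matrices, one through
  \<open>g\<close> and one through \<open>h\<close>. So T = h ** gi carries the first to the second;
  being unipotent, it has a logarithm, whose block diagonal lift lies in
  \<open>block_nil\<close>.\<close>

lemma conjugate_stabilisers:
  assumes "\<xi> \<in> dual_space block_nil" "nondegenerate \<xi>" "\<eta> \<in> dual_space block_nil" "nondegenerate \<eta>"
  shows "conjugate_under (matrix_exp ` block_nil) (coadjoint_stabiliser block_nil \<xi>) (coadjoint_stabiliser block_nil \<eta>)"
proof -
  have off: "gram_matrix \<zeta> $ i $ j = (if i = j then 1 else 0)" if "i \<notin> I" for \<zeta> i j
    using that by (simp add: gram_matrix_def)
  obtain g where g: "g - mat 1 \<in> raising l I 1"
    and gF: "flag_forms l I (gram_matrix \<xi>) = (\<lambda>S. g ** S ** transpose g) ` flag_forms l I (mat 1)"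
    by (rule flag_forms_eq_image [OF transpose_gram_matrix [of \<xi>] off I_less spec [OF assms(2)]])
  obtain h where h: "h - mat 1 \<in> raising l I 1"
    and hF: "flag_forms l I (gram_matrix \<eta>) = (\<lambda>S. h ** S ** transpose h) ` flag_forms l I (mat 1)"
    by (rule flag_forms_eq_image [OF transpose_gram_matrix [of \<eta>] off I_less spec [OF assms(4)]])
  obtain gi where gi: "gi - mat 1 \<in> raising l I 1" "g ** gi = mat 1" "gi ** g = mat 1"
    using unipotent_inverse [OF g] .
  define T where "T = h ** gi"
  have Tg: "T ** g = h" by (simp add: T_def matrix_mul_assoc [symmetric] gi)
  have "T - mat 1 \<in> raising l I 1" unfolding T_def by (rule unipotent_mult [OF h gi(1)])
  then obtain A where A: "A \<in> raising l I 1" "matrix_exp A = T" by (rule matrix_exp_surj_raising)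
  let ?x = "block A 0 0 (- transpose A)"
  have "A \<in> pattern (\<lambda>a b. l a < l b)" using raisingD [OF A(1)] by (intro patternI) force
  then have "?x \<in> block_nil" unfolding block_nil_mem_iff by simp
  obtain K where K: "mpow A K = 0"
    using mpow_raising_eq_0 [OF A(1), of "Suc (Max (range l))"] by (auto simp: le_imp_less_Suc)
  define T' where "T' = matrix_exp (- A)"
  have T': "T ** T' = mat 1" "T' ** T = mat 1"
    using matrix_exp_mult_minus [OF K] A(2) matrix_left_right_inverse by (auto simp: T'_def)
  have K': "mpow (- A) K = 0" by (simp add: mpow_minus K)
  have "matrix_exp (transpose (- A)) = transpose T'" unfolding T'_def by (rule matrix_exp_transpose [OF K'])
  moreover have "mpow (transpose (- A)) K = 0" by (simp add: mpow_transpose K')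
  moreover have "transpose (- A) = - transpose A" by (simp add: vec_eq_iff transpose_nth)
  ultimately have ex: "matrix_exp ?x = block T 0 0 (transpose T')"
    using matrix_exp_block [OF K] A(2) by metis
  have "transpose T' ** transpose T = mat 1" "transpose T ** transpose T' = mat 1"
    by (simp_all add: matrix_transpose_mul [symmetric] T' transpose_mat)
  then have inv: "matrix_inv (matrix_exp ?x) = block T' 0 0 (transpose T)"
    unfolding ex by (intro matrix_inv_eqI) (simp_all add: block_mult T' block_one)
  \<comment> \<open>The lower right block of the lift is the inverse transpose of T, so conjugation
    becomes congruence on symmetric matrices.\<close>
  have conj: "matrix_exp ?x ** unipotent_block S ** matrix_inv (matrix_exp ?x) = unipotent_block (T ** S ** transpose T)" for S
    unfolding inv unfolding ex by (simp add: block_mult unipotent_block_def)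
  have "T ** (g ** S ** transpose g) ** transpose T = h ** S ** transpose h" for S
    unfolding Tg [symmetric] by (simp add: matrix_transpose_mul matrix_mul_assoc)
  then have "coadjoint_stabiliser block_nil \<eta> = (\<lambda>x. matrix_exp ?x ** x ** matrix_inv (matrix_exp ?x)) ` coadjoint_stabiliser block_nil \<xi>"
    using assms by (simp add: coadjoint_stabiliser_block_nil gF hF image_image conj)
  then show ?thesis unfolding conjugate_under_def using \<open>?x \<in> block_nil\<close> by blast
qed

theorem generic_stabiliser_block_nil: "has_generic_coadjoint_stabiliser block_nil"
proof -
  let ?M = "\<lambda>t \<xi>. truncate {a \<in> I. l a < t} (gram_matrix \<xi>)"
  \<comment> \<open>From this value of t on, the truncation no longer changes, so finitely many
    determinants decide nondegeneracy.\<close>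
  let ?N = "Suc (Max (range l))"
  define f where "f = (\<lambda>\<xi>. \<Prod>t\<in>{..?N}. det (?M t \<xi>))"
  have entry: "(\<lambda>\<xi>. ?M t \<xi> $ i $ j) \<in> dual_polynomials block_nil" for t i j
  proof (cases "i \<in> {a \<in> I. l a < t} \<and> j \<in> {a \<in> I. l a < t}")
    case True
    then have "(\<lambda>\<xi>. ?M t \<xi> $ i $ j) = (\<lambda>\<xi>. \<xi> (unipotent_block (sym_unit i j)))"
      by (simp add: truncate_def gram_matrix_def gram_def)
    then show ?thesis using True by (simp add: dual_polynomials.eval sym_unit_mem)
  next
    case False
    then have "(\<lambda>\<xi>. ?M t \<xi> $ i $ j) = (\<lambda>\<xi>. if i = j then 1 else 0)"
      by (auto simp: truncate_def)
    then show ?thesis by (simp add: dual_polynomials.const)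
  qed
  have f_poly: "f \<in> dual_polynomials block_nil"
    unfolding f_def by (intro dual_polynomials_prod dual_polynomials_det entry)
  have f_nz: "f \<xi> \<noteq> 0 \<longleftrightarrow> nondegenerate \<xi>" for \<xi>
  proof
    assume "f \<xi> \<noteq> 0"
    then have det: "det (?M t \<xi>) \<noteq> 0" if "t \<le> ?N" for t using that \<open>f \<xi> \<noteq> 0\<close> unfolding f_def prod_zero_iff [OF finite_atMost] by blast
    show "nondegenerate \<xi>"
    proof
      fix t
      have "{a \<in> I. l a < t} = {a \<in> I. l a < min t ?N}" by (auto simp: le_imp_less_Suc)
      then show "invertible (?M t \<xi>)" using det [of "min t ?N"] by (simp only: invertible_det_nz) simp
    qed
  qed (auto simp: f_def invertible_det_nz)
  \<comment> \<open>The trace of the upper right block: its Gram matrix is twice the identity on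
    \<open>I\<close>, so all truncations are diagonal and invertible.\<close>
  define \<xi>0 where "\<xi>0 = dual_restrict block_nil (\<lambda>x. \<Sum>a\<in>UNIV. x $ Inl a $ Inr a)"
  have xi0: "\<xi>0 \<in> dual_space block_nil"
    using gl.subspace_add [OF subspace_block_nil] gl.subspace_scale [OF subspace_block_nil]
    by (auto simp: dual_space_def \<xi>0_def dual_restrict_def sum.distrib cscale_def sum_distrib_left)
  have gram0: "gram \<xi>0 i j = (if i = j then 2 else 0)" if "i \<in> I" for i j
  proof -
    have "gram \<xi>0 i j = (\<Sum>a\<in>UNIV. sym_unit i j $ a $ a)"
      using that by (simp add: gram_def \<xi>0_def dual_restrict_def sym_unit_mem) (simp add: unipotent_block_def)
    also have "\<dots> = (\<Sum>a\<in>UNIV. if a = i then if i = j then 2 else 0 else 0)"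
    proof (rule sum.cong [OF refl])
      fix a show "sym_unit i j $ a $ a = (if a = i then if i = j then 2 else 0 else 0)"
        by (cases "a = i"; cases "a = j") (simp_all add: sym_unit_def)
    qed
    finally show ?thesis by simp
  qed
  have "det (?M t \<xi>0) \<noteq> 0" for t
  proof -
    have "det (?M t \<xi>0) = (\<Prod>i\<in>UNIV. ?M t \<xi>0 $ i $ i)"
      by (rule det_diagonal) (auto simp: truncate_def gram_matrix_def gram0)
    moreover have "?M t \<xi>0 $ i $ i \<noteq> 0" for i by (simp add: truncate_def gram_matrix_def gram0)
    ultimately show ?thesis by simp
  qed
  then have "f \<xi>0 \<noteq> 0" by (simp add: f_def)
  from principal_open [OF f_poly xi0 this] show ?thesis
    unfolding has_generic_coadjoint_stabiliser_def
    by (intro exI [of _ "{\<xi> \<in> dual_space block_nil. f \<xi> \<noteq> 0}"]) (simp add: f_nz conjugate_stabilisers)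
qed

end

section \<open>Root vectors\<close>

text \<open>The matrix unit at (i, j) made symplectic. For j = flip i both summands sit at the same
  place and give twice a matrix unit, a long root vector; for i = j the result is a diagonal element
  of the Cartan subalgebra.\<close>

definition root_vector :: "'n + 'n \<Rightarrow> 'n + 'n \<Rightarrow> complex^('n::finite + 'n)^('n + 'n)" where
  "root_vector i j = (\<chi> p q. (if p = i \<and> q = j then 1 else 0)
      - eps i * eps j * (if p = flip j \<and> q = flip i then 1 else 0))"

text \<open>The weight of the basis vector p under the Cartan element
  \<open>root_vector k k\<close>.\<close>

definition wt :: "'n + 'n \<Rightarrow> 'n + 'n \<Rightarrow> complex" where
  "wt k p = (if p = k then 1 else 0) - (if p = flip k then 1 else 0)"

lemma wt_flip: "wt k (flip p) = - wt k p"
  by (auto simp: wt_def eq_flip_commute)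

lemma spD: "A \<in> sp \<Longrightarrow> A $ flip j $ flip i = - eps i * eps j * A $ i $ j"
  by (simp add: sp_iff)

lemma root_vector_mem_sp: "root_vector i j \<in> sp"
proof -
  have 1: "flip q = i \<and> flip p = j \<longleftrightarrow> p = flip j \<and> q = flip i" for p q :: "'a + 'a" by auto
  have 2: "flip q = flip j \<and> flip p = flip i \<longleftrightarrow> p = i \<and> q = j" for p q :: "'a + 'a" by auto
  have "root_vector i j $ flip q $ flip p = - eps p * eps q * root_vector i j $ p $ q" for p q
  proof -
    have "root_vector i j $ flip q $ flip p
        = (if p = flip j \<and> q = flip i then 1 else 0) - eps i * eps j * (if p = i \<and> q = j then 1 else 0)"
      by (simp only: root_vector_def vec_lambda_beta 1 2)
    moreover have "eps i * eps j * (eps i * eps j) = 1" by (cases i; cases j) auto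
    ultimately show ?thesis
      by (cases "p = i \<and> q = j"; cases "p = flip j \<and> q = flip i") (auto simp: root_vector_def mult_ac)
  qed
  then show ?thesis by (simp add: sp_iff)
qed

lemma root_vector_flip: "root_vector (flip j) (flip i) = cscale (- eps i * eps j) (root_vector i j)"
proof -
  have "eps i * eps j * (eps i * eps j) = 1" by (cases i; cases j) auto
  then show ?thesis by (auto simp: vec_eq_iff root_vector_def cscale_def algebra_simps)
qed

lemma root_vector_diag: "root_vector k k $ p $ q = (if p = q then wt k p else 0)"
  by (auto simp: root_vector_def wt_def)

lemma diagonal_bracket:
  assumes "\<And>p q. D $ p $ q = (if p = q then d p else 0)"
  shows "lie_bracket D A $ p $ q = (d p - d q) * A $ p $ q"
proof -
  have "(\<Sum>k\<in>UNIV. (if p = k then d p else 0) * A $ k $ q) = d p * A $ p $ q"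
    by (subst sum.cong [OF refl, of _ _ "\<lambda>k. if k = p then d p * A $ p $ q else 0"]) auto
  moreover have "(\<Sum>k\<in>UNIV. A $ p $ k * (if k = q then d k else 0)) = A $ p $ q * d q"
    by (subst sum.cong [OF refl, of _ _ "\<lambda>k. if k = q then A $ p $ q * d q else 0"]) auto
  ultimately show ?thesis
    by (simp add: lie_bracket_def matrix_mult_nth assms algebra_simps)
qed

lemma diagonal_bracket_root_vector:
  assumes D: "\<And>p q. D $ p $ q = (if p = q then d p else 0)" and d: "\<And>p. d (flip p) = - d p"
  shows "lie_bracket D (root_vector i j) = cscale (d i - d j) (root_vector i j)"
  unfolding matrix_eq_iff diagonal_bracket [OF D] by (auto simp: root_vector_def cscale_def d)

lemma sp_subspace: "gl.subspace sp"
  by (rule gl.subspaceI) (simp_all add: sp_iff cscale_def distrib_left)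

text \<open>Each entry is reached through its own index pair and once more through the reflected
  pair, whence the factor 1/2.\<close>

lemma sp_eq_sum_root_vectors:
  assumes "A \<in> sp"
  shows "A = (\<Sum>(i,j)\<in>UNIV. cscale (A $ i $ j / 2) (root_vector i j))"
proof -
  have "(\<Sum>(i,j)\<in>UNIV. cscale (A $ i $ j / 2) (root_vector i j)) $ p $ q = A $ p $ q" for p q
  proof -
    have "(\<Sum>(i,j)\<in>UNIV. cscale (A $ i $ j / 2) (root_vector i j)) $ p $ q
        = (\<Sum>x\<in>UNIV. (if x = (p, q) then A $ p $ q / 2 else 0)
            + (if x = (flip q, flip p) then - eps (flip q) * eps (flip p) * A $ flip q $ flip p / 2 else 0))"
      unfolding sum_component
    proof (rule sum.cong [OF refl])
      fix x :: "('a + 'a) \<times> ('a + 'a)"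
      obtain i j where x: "x = (i, j)" by fastforce
      have c1: "x = (p, q) \<longleftrightarrow> p = i \<and> q = j" unfolding x prod.inject by blast
      have c2: "x = (flip q, flip p) \<longleftrightarrow> p = flip j \<and> q = flip i"
        unfolding x prod.inject by (metis flip_flip)
      have "(case x of (i, j) \<Rightarrow> cscale (A $ i $ j / 2) (root_vector i j)) $ p $ q
        = (if p = i \<and> q = j then A $ i $ j / 2 else 0)
            + (if p = flip j \<and> q = flip i then - eps i * eps j * A $ i $ j / 2 else 0)"
        unfolding x root_vector_def cscale_def prod.case vec_lambda_beta
        by (cases "p = i \<and> q = j"; cases "p = flip j \<and> q = flip i";
            simp only: if_True if_False simp_thms; simp add: field_simps)
      moreover have "(if p = i \<and> q = j then A $ i $ j / 2 else 0) = (if p = i \<and> q = j then A $ p $ q / 2 else 0)" by simp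
      moreover have "(if p = flip j \<and> q = flip i then - eps i * eps j * A $ i $ j / 2 else 0)
         = (if p = flip j \<and> q = flip i then - eps (flip q) * eps (flip p) * A $ flip q $ flip p / 2 else 0)" by simp
      ultimately show "(case x of (i, j) \<Rightarrow> cscale (A $ i $ j / 2) (root_vector i j)) $ p $ q
        = (if x = (p, q) then A $ p $ q / 2 else 0)
            + (if x = (flip q, flip p) then - eps (flip q) * eps (flip p) * A $ flip q $ flip p / 2 else 0)"
        unfolding c1 c2 by simp
    qed
    also have "\<dots> = A $ p $ q / 2 + - eps (flip q) * eps (flip p) * A $ flip q $ flip p / 2"
      by (simp add: sum.distrib)
    also have "\<dots> = A $ p $ q"
      using spD [OF assms, of q p] by (cases p; cases q) auto
    finally show ?thesis .
  qed
  then show ?thesis by (simp add: matrix_eq_iff)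
qed

lemma mem_if_root_vectors_mem:
  assumes S: "gl.subspace S" and A: "A \<in> sp" and "\<And>i j. A $ i $ j \<noteq> 0 \<Longrightarrow> root_vector i j \<in> S"
  shows "A \<in> S"
proof -
  have "cscale (A $ i $ j / 2) (root_vector i j) \<in> S" for i j
    using assms(3) gl.subspace_scale [OF S] gl.subspace_0 [OF S] by (cases "A $ i $ j = 0") auto
  then have "(\<Sum>(i,j)\<in>UNIV. cscale (A $ i $ j / 2) (root_vector i j)) \<in> S"
    by (intro gl.subspace_sum [OF S]) auto
  then show ?thesis using sp_eq_sum_root_vectors [OF A] by simp
qed

text \<open>The projection onto a weight space of \<open>ad (root_vector k k)\<close> is a polynomial in that operator.\<close>

lemma weight_projection_mem:
  assumes S: "gl.subspace S" and ad: "\<And>A. A \<in> S \<Longrightarrow> lie_bracket (root_vector k k) A \<in> S"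
    and A: "A \<in> S"
  shows "(\<chi> p q. if wt k p - wt k q = w then A $ p $ q else 0) \<in> S"
proof -
  let ?W = "range (\<lambda>(p, q). wt k p - wt k q) - {w}"
  have prod: "(\<chi> p q. (\<Prod>c\<in>W. wt k p - wt k q - c) * A $ p $ q) \<in> S" if "finite W" for W
    using that
  proof induction
    case empty
    then show ?case using A by simp
  next
    case (insert c W)
    let ?B = "\<chi> p q. (\<Prod>c\<in>W. wt k p - wt k q - c) * A $ p $ q"
    have "lie_bracket (root_vector k k) ?B - cscale c ?B \<in> S"
      using insert by (intro gl.subspace_diff [OF S] gl.subspace_scale [OF S] ad)
    moreover have "lie_bracket (root_vector k k) ?B - cscale c ?B
        = (\<chi> p q. (\<Prod>c\<in>insert c W. wt k p - wt k q - c) * A $ p $ q)"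
      using insert.hyps by (simp add: matrix_eq_iff diagonal_bracket [OF root_vector_diag] cscale_def algebra_simps)
    ultimately show ?case by simp
  qed
  let ?P = "\<Prod>c\<in>?W. w - c"
  have "?P \<noteq> 0" by simp
  have "(\<chi> p q. if wt k p - wt k q = w then A $ p $ q else 0)
      = cscale (1 / ?P) (\<chi> p q. (\<Prod>c\<in>?W. wt k p - wt k q - c) * A $ p $ q)"
  proof -
    have "(\<Prod>c\<in>?W. wt k p - wt k q - c) = (if wt k p - wt k q = w then ?P else 0)" for p q
    proof (cases "wt k p - wt k q = w")
      case False
      then have "wt k p - wt k q \<in> ?W" by auto
      then have "(\<Prod>c\<in>?W. wt k p - wt k q - c) = 0" by (intro prod_zero) auto
      then show ?thesis using False by simp
    qed simp
    then show ?thesis using \<open>?P \<noteq> 0\<close> by (simp add: matrix_eq_iff cscale_def)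
  qed
  then show ?thesis using prod [of ?W] gl.subspace_scale [OF S] by simp
qed

text \<open>Two Cartan elements suffice to isolate a short root space; the excluded cases are the
  diagonal and the long roots.\<close>

lemma weights_determine_root:
  assumes "i \<noteq> j" "j \<noteq> flip i"
  shows "wt i p - wt i q = 1 \<and> wt j p - wt j q = - 1 \<longleftrightarrow> p = i \<and> q = j \<or> p = flip j \<and> q = flip i"
proof -
  have ne: "i \<noteq> flip j" "flip i \<noteq> j" "j \<noteq> i" "flip i \<noteq> flip j" using assms by (auto simp: eq_flip_commute)
  show ?thesis
    using assms ne
    by (cases "p = i"; cases "p = flip i"; cases "p = j"; cases "p = flip j";
        cases "q = i"; cases "q = flip i"; cases "q = j"; cases "q = flip j"; simp add: wt_def)
qed

text \<open>For a long root one Cartan element suffices, because the eigenvalue 2 is attained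
  nowhere else.\<close>

lemma weight_determines_long_root: "wt i p - wt i q = 2 \<longleftrightarrow> p = i \<and> q = flip i"
  by (cases "p = i"; cases "p = flip i"; cases "q = i"; cases "q = flip i"; simp add: wt_def)

text \<open>A subspace stable under the diagonal Cartan subalgebra contains the weight components of
  its elements, and each root space is spanned by one root vector.\<close>

lemma root_vector_mem_if_entry:
  assumes S: "gl.subspace S" "S \<subseteq> sp" and ad: "\<And>k A. A \<in> S \<Longrightarrow> lie_bracket (root_vector k k) A \<in> S"
    and A: "A \<in> S" "A $ i $ j \<noteq> 0" "i \<noteq> j"
  shows "root_vector i j \<in> S"
proof -
  have proj: "(\<chi> p q. if wt k p - wt k q = w then B $ p $ q else 0) \<in> S" if "B \<in> S" for k w B
    by (rule weight_projection_mem [OF S(1) _ that]) (rule ad)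
  have "A \<in> sp" using A S by blast
  have "\<exists>c. c \<noteq> 0 \<and> cscale c (root_vector i j) \<in> S"
  proof (cases "j = flip i")
    case True
    have "cscale (A $ i $ j / 2) (root_vector i j) = (\<chi> p q. if wt i p - wt i q = 2 then A $ p $ q else 0)"
      unfolding weight_determines_long_root by (auto simp: matrix_eq_iff root_vector_def cscale_def True)
    then have "cscale (A $ i $ j / 2) (root_vector i j) \<in> S" using proj [OF A(1)] by simp
    then show ?thesis using A(2) by (intro exI [of _ "A $ i $ j / 2"]) simp
  next
    case False
    let ?B = "\<chi> p q. if wt i p - wt i q = 1 then A $ p $ q else 0"
    have "(\<chi> p q. if wt j p - wt j q = -1 then ?B $ p $ q else 0) \<in> S" by (intro proj A(1))
    also have "(\<chi> p q. if wt j p - wt j q = -1 then ?B $ p $ q else 0)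
        = (\<chi> p q. if wt i p - wt i q = 1 \<and> wt j p - wt j q = -1 then A $ p $ q else 0)"
      by (simp add: matrix_eq_iff)
    also have "\<dots> = cscale (A $ i $ j) (root_vector i j)"
      unfolding weights_determine_root [OF A(3) False] using False A(3) spD [OF \<open>A \<in> sp\<close>, of j i]
      by (auto simp: matrix_eq_iff root_vector_def cscale_def)
    finally show ?thesis using A(2) by blast
  qed
  then obtain c where "c \<noteq> 0" "cscale c (root_vector i j) \<in> S" by blast
  then have "cscale (1 / c) (cscale c (root_vector i j)) \<in> S" using gl.subspace_scale [OF S(1)] by blast
  then show ?thesis using \<open>c \<noteq> 0\<close> by simp
qed

text \<open>The two products in the commutator contribute with equal sign, so nothing cancels in the
  degenerate cases where \<open>flip\<close> relates the indices. A nonzero entry is all that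
  \<open>root_vector_mem_if_entry\<close> asks for.\<close>

lemma bracket_root_vectors_entry:
  assumes "i \<noteq> j" "j \<noteq> k" "i \<noteq> k"
  shows "lie_bracket (root_vector i j) (root_vector j k) $ i $ k \<noteq> 0"
proof -
  have 1: "root_vector i j $ i $ m = (if m = j then if j = flip i then 2 else 1 else 0)" for m
    using assms by (cases "j = flip i") (auto simp: root_vector_def eq_flip_commute)
  have 2: "root_vector j k $ j $ k = (if k = flip j then 2 else 1)"
    by (cases "k = flip j") (auto simp: root_vector_def eq_flip_commute)
  have 3: "root_vector j k $ i $ m = (if m = flip j then if k = flip i then - eps j * eps k else 0 else 0)" for m
    using assms by (auto simp: root_vector_def eq_flip_commute)
  have 4: "k = flip i \<Longrightarrow> root_vector i j $ flip j $ k = - eps i * eps j"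
    using assms by (auto simp: root_vector_def eq_flip_commute)
  have "(root_vector i j ** root_vector j k) $ i $ k
      = (if j = flip i then 2 else 1) * (if k = flip j then 2 else 1)"
    unfolding matrix_mult_nth 1
    by (subst sum.cong [OF refl, of _ _ "\<lambda>m. if m = j then (if j = flip i then 2 else 1) * root_vector j k $ j $ k else 0"])
      (auto simp: 2)
  moreover have "(root_vector j k ** root_vector i j) $ i $ k = (if k = flip i then -1 else 0)"
    unfolding matrix_mult_nth 3
  proof (subst sum.cong [OF refl, of _ _ "\<lambda>m. if m = flip j then (if k = flip i then -1 else 0) else 0"])
    fix m
    have "eps j * eps (flip i) * (eps i * eps j) = -1" by (cases i; cases j) auto
    then show "(if m = flip j then if k = flip i then - eps j * eps k else 0 else 0) * root_vector i j $ m $ k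
       = (if m = flip j then (if k = flip i then -1 else 0) else 0)"
      using 4 by (auto simp: mult_ac)
  qed simp
  ultimately show ?thesis by (simp add: lie_bracket_def)
qed

text \<open>A copy of sl_2: opposite root vectors bracket to a multiple of the coroot, on which the
  root does not vanish. This will keep such pairs out of nilpotent ideals. Long roots are treated
  apart because their vectors are single matrix units up to a factor.\<close>

lemma double_bracket_root_vectors:
  assumes "i \<noteq> j"
  shows "\<exists>c. c \<noteq> 0 \<and> lie_bracket (lie_bracket (root_vector j i) (root_vector i j)) (root_vector i j) = cscale c (root_vector i j)"
proof (cases "j = flip i")
  case True
  define d where "d = (\<lambda>p. - 4 * wt i p)"
  have X: "root_vector i j $ p $ q = (if p = i \<and> q = j then 2 else 0)"
     "root_vector j i $ p $ q = (if p = j \<and> q = i then 2 else 0)" for p q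
    by (auto simp: root_vector_def True)
  have "lie_bracket (root_vector j i) (root_vector i j) $ p $ q = (if p = q then d p else 0)" for p q
  proof -
    have "(root_vector j i ** root_vector i j) $ p $ q = (if p = j \<and> q = j then 4 else 0)"
      unfolding matrix_mult_nth X
      by (subst sum.cong [OF refl, of _ _ "\<lambda>m. if m = i then (if p = j \<and> q = j then 4 else 0) else 0"]) auto
    moreover have "(root_vector i j ** root_vector j i) $ p $ q = (if p = i \<and> q = i then 4 else 0)"
      unfolding matrix_mult_nth X
      by (subst sum.cong [OF refl, of _ _ "\<lambda>m. if m = j then (if p = i \<and> q = i then 4 else 0) else 0"]) auto
    ultimately show ?thesis using True by (auto simp: lie_bracket_def d_def wt_def)
  qed
  from diagonal_bracket_root_vector [OF this]
  have "lie_bracket (lie_bracket (root_vector j i) (root_vector i j)) (root_vector i j) = cscale (d i - d j) (root_vector i j)"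
    by (simp add: d_def wt_flip)
  moreover have "d i - d j \<noteq> 0" by (simp add: d_def wt_def True)
  ultimately show ?thesis by blast
next
  case False
  define d where "d = (\<lambda>p. wt j p - wt i p)"
  define e where "e = eps i * eps j"
  have e: "e * e = 1" by (cases i; cases j) (auto simp: e_def)
  have ne: "i \<noteq> flip j" "flip i \<noteq> j" "j \<noteq> i" "flip j \<noteq> i" using assms False by (auto simp: eq_flip_commute)
  have "lie_bracket (root_vector j i) (root_vector i j) $ p $ q = (if p = q then d p else 0)" for p q
  proof -
    have "(root_vector j i ** root_vector i j) $ p $ q = (if p = q \<and> p \<in> {j, flip i} then 1 else 0)"
      unfolding matrix_mult_nth
    proof (subst sum.cong [OF refl, of _ _ "\<lambda>m. (if m = i then (if p = j \<and> q = j then 1 else 0) else 0) + (if m = flip j then if p = flip i \<and> q = flip i then 1 else 0 else 0)"])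
      fix m show "root_vector j i $ p $ m * root_vector i j $ m $ q
        = (if m = i then (if p = j \<and> q = j then 1 else 0) else 0) + (if m = flip j then if p = flip i \<and> q = flip i then 1 else 0 else 0)"
        using e ne assms False by (cases "m = i"; cases "m = flip j") (auto simp: root_vector_def e_def mult_ac)
    qed (use ne assms in \<open>auto simp: sum.distrib\<close>)
    moreover have "(root_vector i j ** root_vector j i) $ p $ q = (if p = q \<and> p \<in> {i, flip j} then 1 else 0)"
      unfolding matrix_mult_nth
    proof (subst sum.cong [OF refl, of _ _ "\<lambda>m. (if m = j then (if p = i \<and> q = i then 1 else 0) else 0) + (if m = flip i then if p = flip j \<and> q = flip j then 1 else 0 else 0)"])
      fix m show "root_vector i j $ p $ m * root_vector j i $ m $ q
        = (if m = j then (if p = i \<and> q = i then 1 else 0) else 0) + (if m = flip i then if p = flip j \<and> q = flip j then 1 else 0 else 0)"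
        using e ne assms False by (cases "m = j"; cases "m = flip i") (auto simp: root_vector_def e_def mult_ac)
    qed (use ne assms in \<open>auto simp: sum.distrib\<close>)
    ultimately show ?thesis using ne assms by (auto simp: lie_bracket_def d_def wt_def)
  qed
  from diagonal_bracket_root_vector [OF this]
  have "lie_bracket (lie_bracket (root_vector j i) (root_vector i j)) (root_vector i j) = cscale (d i - d j) (root_vector i j)"
    by (simp add: d_def wt_flip)
  moreover have "d i - d j \<noteq> 0" using ne assms by (simp add: d_def wt_def)
  ultimately show ?thesis by blast
qed

section \<open>Nilradicals of standard parabolic subalgebras\<close>

lemma bracket_mem_bracket_span: "x \<in> \<aa> \<Longrightarrow> y \<in> \<bb> \<Longrightarrow> lie_bracket x y \<in> bracket_span \<aa> \<bb>"
  unfolding bracket_span_def by (rule gl.span_base) blast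

lemma bracket_span_minimal:
  assumes "\<And>x y. x \<in> \<aa> \<Longrightarrow> y \<in> \<bb> \<Longrightarrow> lie_bracket x y \<in> S" "gl.subspace S"
  shows "bracket_span \<aa> \<bb> \<subseteq> S"
  unfolding bracket_span_def by (rule gl.span_minimal) (use assms in auto)

lemma subspace_bracket_span: "gl.subspace (bracket_span \<aa> \<bb>)"
  unfolding bracket_span_def by (rule gl.subspace_span)

lemma subspace_pattern: "gl.subspace (pattern Q)"
  by (rule gl.subspaceI) (auto intro: pattern_add pattern_cscale)

lemma lie_bracket_minus: "lie_bracket x y = - lie_bracket y x"
  by (simp add: lie_bracket_def)

lemma transpose_diff: "transpose (A - B) = transpose A - transpose (B :: complex^'n^'m)"
  by (simp add: vec_eq_iff transpose_nth)

lemma sp_bracket: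
  assumes A: "A \<in> sp" and B: "B \<in> sp"
  shows "lie_bracket A B \<in> sp"
proof -
  let ?J = symplectic_form
  have "transpose A ** ?J = - (?J ** A)" "transpose B ** ?J = - (?J ** B)"
    using A B by (simp_all add: sp_def eq_neg_iff_add_eq_0)
  then have "transpose (A ** B) ** ?J = ?J ** (B ** A)" "transpose (B ** A) ** ?J = ?J ** (A ** B)"
    unfolding matrix_transpose_mul matrix_mul_assoc [symmetric]
    by (simp_all add: matrix_mult_minus_right) (simp_all add: matrix_mul_assoc matrix_mult_minus_left)
  then show ?thesis
    unfolding sp_def lie_bracket_def
    by (simp add: matrix_diff_ldistrib matrix_diff_rdistrib transpose_diff)
qed

text \<open>Bracketing with \<open>h\<close> reproduces \<open>x\<close> up to the factor
  \<open>c\<close>, so the lower central series never loses it.\<close>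

lemma not_lie_nilpotent:
  assumes h: "h \<in> \<ii>" and x: "x \<in> \<ii>" "x \<noteq> 0" and hx: "lie_bracket h x = cscale c x" "c \<noteq> 0"
  shows "\<not> lie_nilpotent \<ii>"
proof -
  have "x \<in> lower_central_series \<ii> k" for k
  proof (induction k)
    case (Suc k)
    have "cscale c x \<in> lower_central_series \<ii> (Suc k)"
      using bracket_mem_bracket_span [OF h Suc] by (simp add: hx)
    then have "cscale (1 / c) (cscale c x) \<in> lower_central_series \<ii> (Suc k)"
      using gl.subspace_scale [OF subspace_bracket_span] by (simp only: lower_central_series.simps)
    then show ?case using hx(2) by simp
  qed (use x in simp)
  then show ?thesis using x(2) by (auto simp: lie_nilpotent_def)
qed

lemma pattern_less_mult:
  fixes lev :: "'m::finite \<Rightarrow> nat"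
  assumes "A \<in> pattern (\<lambda>i j. lev i + p \<le> lev j)" "B \<in> pattern (\<lambda>i j. lev i + q \<le> lev j)"
  shows "A ** B \<in> pattern (\<lambda>i j. lev i + (p + q) \<le> lev j)"
proof (rule patternI)
  fix i j assume "(A ** B) $ i $ j \<noteq> 0"
  then obtain k where "A $ i $ k * B $ k $ j \<noteq> 0"
    unfolding matrix_mult_nth by (rule sum.not_neutral_contains_not_neutral)
  then show "lev i + (p + q) \<le> lev j" using patternD [OF assms(1), of i k] patternD [OF assms(2), of k j] by auto
qed

lemma pattern_bracket:
  fixes lev :: "'m::finite \<Rightarrow> nat"
  assumes "A \<in> pattern (\<lambda>i j. lev i + p \<le> lev j)" "B \<in> pattern (\<lambda>i j. lev i + q \<le> lev j)"
  shows "lie_bracket A B \<in> pattern (\<lambda>i j. lev i + (p + q) \<le> lev j)"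
  unfolding lie_bracket_def
  using pattern_less_mult [OF assms] pattern_less_mult [OF assms(2,1)]
  by (intro gl.subspace_diff [OF subspace_pattern]) (simp_all add: add.commute)

text \<open>The order of a symplectic basis adapted to a full isotropic flag: the isotropic half
  comes first, and \<open>flip\<close> reverses the order.\<close>

locale symplectic_order =
  fixes rk :: "'n::finite + 'n \<Rightarrow> nat"
  assumes inj_rk: "inj rk"
    and rk_flip: "\<And>i j. rk i < rk j \<longleftrightarrow> rk (flip j) < rk (flip i)"
    and rk_Inl_Inr: "\<And>a b. rk (Inl a) < rk (Inr b)"
begin

definition std_borel :: "(complex^('n + 'n)^('n + 'n)) set" where
  "std_borel = sp \<inter> pattern (\<lambda>i j. rk i \<le> rk j)"

lemma root_vector_mem_std_borel:
  assumes "rk i \<le> rk j"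
  shows "root_vector i j \<in> std_borel"
proof -
  have "rk p \<le> rk q" if "root_vector i j $ p $ q \<noteq> 0" for p q
  proof -
    have "p = i \<and> q = j \<or> p = flip j \<and> q = flip i"
      using that by (cases "p = i \<and> q = j"; cases "p = flip j \<and> q = flip i") (simp_all add: root_vector_def)
    moreover have "rk (flip j) \<le> rk (flip i)" using rk_flip [of j i] assms by linarith
    ultimately show ?thesis using assms by blast
  qed
  then show ?thesis unfolding std_borel_def by (blast intro: patternI root_vector_mem_sp)
qed

end

locale std_parabolic = symplectic_order rk for rk :: "'n::finite + 'n \<Rightarrow> nat" +
  fixes \<pp> :: "(complex^('n + 'n)^('n + 'n)) set"
  assumes parabolic: "standard_parabolic \<pp> std_borel sp"
begin

lemma subspace: "gl.subspace \<pp>" and bracket: "x \<in> \<pp> \<Longrightarrow> y \<in> \<pp> \<Longrightarrow> lie_bracket x y \<in> \<pp>"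
  and sub_sp: "\<pp> \<subseteq> sp" and borel_sub: "std_borel \<subseteq> \<pp>"
  using parabolic by (auto simp: standard_parabolic_def lie_subalgebra_def)

definition root_le :: "'n + 'n \<Rightarrow> 'n + 'n \<Rightarrow> bool" where
  "root_le i j \<longleftrightarrow> root_vector i j \<in> \<pp>"

lemma root_le_rk: "rk i \<le> rk j \<Longrightarrow> root_le i j"
  using root_vector_mem_std_borel borel_sub by (auto simp: root_le_def)

lemma root_le_entry:
  assumes "A \<in> \<pp>" "A $ i $ j \<noteq> 0"
  shows "root_le i j"
proof (cases "i = j")
  case False
  have "root_vector k k \<in> \<pp>" for k using root_le_rk [of k k] by (simp add: root_le_def)
  then show ?thesis unfolding root_le_def
    using root_vector_mem_if_entry [OF subspace sub_sp _ assms False] bracket by blast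
qed (simp add: root_le_rk)

text \<open>The bracket of the two root vectors lies in \<pp> and has a nonzero entry at (i, k),
  from which \<open>root_le_entry\<close> returns the third root vector.\<close>

lemma root_le_trans:
  assumes "root_le i j" "root_le j k"
  shows "root_le i k"
proof (cases "i = j \<or> j = k \<or> i = k")
  case False
  then show ?thesis
    using bracket_root_vectors_entry [of i j k] bracket root_le_entry assms unfolding root_le_def by blast
qed (use assms root_le_rk in auto)

lemma root_le_total: "root_le i j \<or> root_le j i"
  using root_le_rk nat_le_linear by blast

lemma root_le_flip: "root_le i j \<Longrightarrow> root_le (flip j) (flip i)"
  unfolding root_le_def root_vector_flip by (rule gl.subspace_scale [OF subspace])

text \<open>Counting predecessors turns the total preorder into a level function: equivalent indices
  have the same predecessors, and a strict step adds at least one.\<close>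

definition lev :: "'n + 'n \<Rightarrow> nat" where
  "lev i = card {k. root_le k i}"

lemma root_le_iff_lev: "root_le i j \<longleftrightarrow> lev i \<le> lev j"
proof
  assume "root_le i j"
  then show "lev i \<le> lev j" unfolding lev_def by (intro card_mono) (auto intro: root_le_trans)
next
  assume le: "lev i \<le> lev j"
  show "root_le i j"
  proof (rule ccontr)
    assume n: "\<not> root_le i j"
    then have ji: "root_le j i" using root_le_total by blast
    have "{k. root_le k j} \<subset> {k. root_le k i}"
    proof
      show "{k. root_le k j} \<subseteq> {k. root_le k i}" using ji root_le_trans by blast
      have "i \<in> {k. root_le k i}" "i \<notin> {k. root_le k j}" using n root_le_rk by auto
      then show "{k. root_le k j} \<noteq> {k. root_le k i}" by blast
    qed
    then have "lev j < lev i" unfolding lev_def by (intro psubset_card_mono) auto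
    then show False using le by simp
  qed
qed

lemma parabolic_mem_iff: "A \<in> \<pp> \<longleftrightarrow> A \<in> sp \<and> A \<in> pattern (\<lambda>i j. lev i \<le> lev j)"
proof
  assume "A \<in> \<pp>"
  then show "A \<in> sp \<and> A \<in> pattern (\<lambda>i j. lev i \<le> lev j)"
    using sub_sp root_le_entry root_le_iff_lev by (blast intro: patternI)
next
  assume A: "A \<in> sp \<and> A \<in> pattern (\<lambda>i j. lev i \<le> lev j)"
  then have "A $ i $ j \<noteq> 0 \<Longrightarrow> root_vector i j \<in> \<pp>" for i j
    using patternD [of A _ i j] root_le_iff_lev [of i j] by (auto simp: root_le_def)
  then show "A \<in> \<pp>" using mem_if_root_vectors_mem [OF subspace] A by blast
qed

definition strict :: "(complex^('n + 'n)^('n + 'n)) set" where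
  "strict = sp \<inter> pattern (\<lambda>i j. lev i < lev j)"

lemma subspace_strict: "gl.subspace strict"
  unfolding strict_def by (intro gl.subspace_inter sp_subspace subspace_pattern)

lemma strict_pattern: "pattern (\<lambda>i j. lev i < lev j) = pattern (\<lambda>i j. lev i + 1 \<le> lev j)"
  by (simp add: Suc_le_eq)

lemma lie_ideal_strict: "lie_ideal strict \<pp>"
  unfolding lie_ideal_def
proof (intro conjI ballI)
  show "strict \<subseteq> \<pp>"
  proof
    fix A assume "A \<in> strict"
    then have "A \<in> sp" "lev i < lev j" if "A $ i $ j \<noteq> 0" for i j
      using patternD [of A] that unfolding strict_def by blast+
    moreover have "A \<in> sp" using \<open>A \<in> strict\<close> by (simp add: strict_def)
    ultimately show "A \<in> \<pp>" unfolding parabolic_mem_iff by (blast intro: patternI less_imp_le)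
  qed
  fix x y assume "x \<in> \<pp>" "y \<in> strict"
  then have x: "x \<in> sp" "x \<in> pattern (\<lambda>i j. lev i + 0 \<le> lev j)"
    and y: "y \<in> sp" "y \<in> pattern (\<lambda>i j. lev i + 1 \<le> lev j)"
    by (simp_all add: parabolic_mem_iff strict_def Suc_le_eq)
  show "lie_bracket x y \<in> strict"
    using pattern_bracket [OF x(2) y(2)] sp_bracket [OF x(1) y(1)] by (simp add: strict_def Suc_le_eq)
qed (rule subspace_strict)

lemma lie_nilpotent_strict: "lie_nilpotent strict"
proof -
  have "lower_central_series strict k \<subseteq> pattern (\<lambda>i j. lev i + Suc k \<le> lev j)" for k
  proof (induction k)
    case 0
    then show ?case by (auto simp: strict_def strict_pattern)
  next
    case (Suc k)
    show ?case unfolding lower_central_series.simps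
    proof (rule bracket_span_minimal [OF _ subspace_pattern])
      fix x y assume "x \<in> strict" "y \<in> lower_central_series strict k"
      then show "lie_bracket x y \<in> pattern (\<lambda>i j. lev i + Suc (Suc k) \<le> lev j)"
        using pattern_bracket [of x lev 1 y "Suc k"] Suc unfolding strict_def strict_pattern by auto
    qed
  qed
  moreover have "pattern (\<lambda>i j. lev i + Suc (Max (range lev)) \<le> lev j) = {0}"
  proof -
    have "\<not> lev i + Suc (Max (range lev)) \<le> lev j" for i j
    proof -
      have "lev j \<le> Max (range lev)" by (rule Max_ge) auto
      then show ?thesis by linarith
    qed
    then show ?thesis by (auto simp: pattern_def matrix_eq_iff)
  qed
  ultimately have "lower_central_series strict (Max (range lev)) \<subseteq> {0}" by metis
  moreover have "0 \<in> lower_central_series strict k" for k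
    by (cases k) (auto intro: gl.subspace_0 subspace_strict subspace_bracket_span)
  ultimately show ?thesis unfolding lie_nilpotent_def by blast
qed

text \<open>A root vector in the ideal whose opposite lies in \<pp> would bring its coroot into the
  ideal, and the coroot acts on it by a nonzero scalar. On the diagonal, the long roots detect every
  entry.\<close>

lemma nilpotent_ideal_sub_strict:
  assumes ideal: "lie_ideal \<ii> \<pp>" and nilp: "lie_nilpotent \<ii>"
  shows "\<ii> \<subseteq> strict"
proof
  fix A assume A: "A \<in> \<ii>"
  have sub: "gl.subspace \<ii>" "\<ii> \<subseteq> \<pp>" and br: "\<And>x y. x \<in> \<pp> \<Longrightarrow> y \<in> \<ii> \<Longrightarrow> lie_bracket x y \<in> \<ii>"
    using ideal by (auto simp: lie_ideal_def)
  have "\<ii> \<subseteq> sp" using sub(2) sub_sp by blast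
  have "root_vector k k \<in> \<pp>" for k using root_le_rk [of k k] by (simp add: root_le_def)
  then have root: "root_vector i j \<in> \<ii>" if "B \<in> \<ii>" "B $ i $ j \<noteq> 0" "i \<noteq> j" for B i j
    using root_vector_mem_if_entry [OF sub(1) \<open>\<ii> \<subseteq> sp\<close> _ that] br by blast
  have root_nz: "root_vector i j \<noteq> 0" for i j :: "'n + 'n"
  proof -
    have "root_vector i j $ i $ j \<noteq> 0" by (cases "i = flip j") (auto simp: root_vector_def)
    then show ?thesis by (metis zero_index)
  qed
  have "\<not> root_le j i" if "A $ i $ j \<noteq> 0" "i \<noteq> j" for i j
  proof
    assume "root_le j i"
    have X: "root_vector i j \<in> \<ii>" by (rule root [OF A that])
    then have "lie_bracket (root_vector j i) (root_vector i j) \<in> \<ii>" using br \<open>root_le j i\<close> by (simp add: root_le_def)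
    from not_lie_nilpotent [OF this X root_nz] double_bracket_root_vectors [OF that(2)] nilp
    show False by blast
  qed
  moreover have "A $ i $ i = 0" for i
  proof -
    define D where "D = (\<chi> p q. if p = q then A $ p $ p else 0)"
    have D: "D $ p $ q = (if p = q then A $ p $ p else 0)" for p q by (simp add: D_def)
    have A_flip: "A $ flip p $ flip p = - (A $ p $ p)" for p
      using spD [of A p p] A \<open>\<ii> \<subseteq> sp\<close> by auto
    have "D \<in> sp" unfolding sp_iff D by (auto simp: A_flip)
    \<comment> \<open>The off-diagonal part is a combination of root vectors already known to lie in
      \<ii>, so the diagonal part D lies there too.\<close>
    have "A - D \<in> \<ii>"
    proof (rule mem_if_root_vectors_mem [OF sub(1)])
      show "A - D \<in> sp" using \<open>D \<in> sp\<close> A \<open>\<ii> \<subseteq> sp\<close> gl.subspace_diff [OF sp_subspace] by blast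
      fix i j assume "(A - D) $ i $ j \<noteq> 0"
      then have "A $ i $ j \<noteq> 0 \<and> i \<noteq> j" by (cases "i = j") (simp_all add: D)
      then show "root_vector i j \<in> \<ii>" using root A by blast
    qed
    from gl.subspace_diff [OF sub(1) A this] have D_mem: "D \<in> \<ii>" by simp
    \<comment> \<open>The long root at j takes the value 2 * A $ j $ j on D. Its root vector lies in
      \<pp>, so a bracket with D moves it into the ideal. The other half of the diagonal is the
      negative of this one.\<close>
    have zero: "A $ j $ j = 0" if "rk j < rk (flip j)" for j
    proof (rule ccontr)
      assume nz: "A $ j $ j \<noteq> 0"
      let ?X = "root_vector j (flip j)"
      have DX: "lie_bracket D ?X = cscale (2 * A $ j $ j) ?X"
        using diagonal_bracket_root_vector [OF D A_flip, of j "flip j"] by (simp add: A_flip)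
      have "?X \<in> \<pp>" using root_le_rk that by (simp add: root_le_def)
      then have "cscale (- (1 / (2 * A $ j $ j))) (lie_bracket ?X D) \<in> \<ii>"
        by (intro gl.subspace_scale [OF sub(1)] br D_mem)
      also have "cscale (- (1 / (2 * A $ j $ j))) (lie_bracket ?X D) = ?X"
        unfolding lie_bracket_minus [of ?X D] DX using nz by (simp add: matrix_eq_iff cscale_def)
      finally have "?X \<in> \<ii>" .
      from not_lie_nilpotent [OF D_mem this root_nz DX] nz nilp show False by simp
    qed
    show ?thesis
    proof (cases "rk i < rk (flip i)")
      case False
      have "rk i \<noteq> rk (flip i)" using inj_rk by (metis flip_neq(2) injD)
      then have "rk (flip i) < rk (flip (flip i))" using False by simp
      then show ?thesis using zero [of "flip i"] A_flip by simp
    qed (rule zero)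
  qed
  ultimately have "lev i < lev j" if "A $ i $ j \<noteq> 0" for i j
    using that root_le_iff_lev [of j i] by (cases "i = j") auto
  then show "A \<in> strict" unfolding strict_def using A \<open>\<ii> \<subseteq> sp\<close> by (blast intro: patternI)
qed

lemma nilradical_eq_strict: "nilradical \<pp> = strict"
proof
  show "nilradical \<pp> \<subseteq> strict"
    unfolding nilradical_def
    by (rule gl.span_minimal) (use nilpotent_ideal_sub_strict subspace_strict in auto)
  show "strict \<subseteq> nilradical \<pp>"
    unfolding nilradical_def
    by (rule order_trans [OF Union_upper gl.span_superset]) (simp add: lie_ideal_strict lie_nilpotent_strict)
qed

lemma lev_flip: "lev (flip j) \<le> lev (flip i) \<longleftrightarrow> lev i \<le> lev j"
  using root_le_flip [of i j] root_le_flip [of "flip j" "flip i"] unfolding root_le_iff_lev flip_flip by blast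

lemma lev_Inl_Inr: "lev (Inl a) \<le> lev (Inr b)"
  using root_le_rk rk_Inl_Inr by (simp add: root_le_iff_lev [symmetric] less_imp_le)

lemma lev_Inr_Inr: "lev (Inr a) < lev (Inr b) \<longleftrightarrow> lev (Inl b) < lev (Inl a)"
  using lev_flip [where i = "Inr b" and j = "Inr a"] by (simp add: not_le [symmetric])

lemma lev_Inl_Inr_commute: "lev (Inl a) < lev (Inr b) \<longleftrightarrow> lev (Inl b) < lev (Inr a)"
  using lev_flip [where i = "Inr b" and j = "Inl a"] by (simp add: not_le [symmetric])

abbreviation l :: "'n \<Rightarrow> nat" where "l a \<equiv> lev (Inl a)"
abbreviation I :: "'n set" where "I \<equiv> {a. lev (Inl a) < lev (Inr a)}"

text \<open>For a outside \<open>I\<close> the levels of \<open>Inl a\<close> and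
  \<open>Inr a\<close> agree; as every \<open>Inl\<close> is at most every \<open>Inr\<close>, all
  these levels are equal. Separation of \<open>I\<close> from its complement comes from the reversal
  of levels by \<open>flip\<close>.\<close>

sublocale level_data l I
proof
  fix a b assume "a \<in> I" "b \<notin> I"
  then show "l a < l b"
    using lev_Inl_Inr_commute [of a b] lev_Inr_Inr [of a b] lev_Inl_Inr [of b b] by auto
next
  fix a b assume "a \<notin> I" "b \<notin> I"
  then show "l a = l b"
    using lev_Inl_Inr [of a b] lev_Inl_Inr [of b a] lev_Inl_Inr [of a a] lev_Inl_Inr [of b b] by auto
qed

text \<open>With both indices outside \<open>I\<close> all four levels coincide. Otherwise a pair
  \<open>Inl\<close>, \<open>Inr\<close> with the same index is separated, and reversal by
  \<open>flip\<close> transfers the separation to (a, b).\<close>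

lemma Inl_Inr_less_iff: "lev (Inl a) < lev (Inr b) \<longleftrightarrow> a \<in> I \<or> b \<in> I"
  using lev_Inl_Inr_commute [of a b] lev_Inr_Inr [of a b] lev_Inl_Inr [of a a] lev_Inl_Inr [of b b]
    lev_Inl_Inr [of b a] lev_Inl_Inr [of a b] by auto

lemma strict_eq_block_nil: "strict = block_nil"
proof (intro equalityI subsetI)
  fix x assume x: "x \<in> strict"
  obtain A S C D where b: "x = block A S C D" by (rule block_cases)
  have sp: "transpose S = S" "D = - transpose A"
    using x unfolding strict_def b by (simp_all add: block_mem_sp_iff)
  have less: "lev i < lev j" if "x $ i $ j \<noteq> 0" for i j
    using x that patternD unfolding strict_def by blast
  have "C $ a $ b = 0" for a b
    using less [of "Inr a" "Inl b"] lev_Inl_Inr [of b a] by (auto simp: b)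
  then have "C = 0" by (simp add: matrix_eq_iff)
  moreover have "A \<in> pattern (\<lambda>a b. l a < l b)"
  proof (rule patternI)
    fix i j assume "A $ i $ j \<noteq> 0"
    then show "l i < l j" using less [of "Inl i" "Inl j"] by (simp add: b)
  qed
  moreover have "S \<in> pattern (\<lambda>a b. a \<in> I \<or> b \<in> I)"
  proof (rule patternI)
    fix i j assume "S $ i $ j \<noteq> 0"
    then have "lev (Inl i) < lev (Inr j)" by (intro less) (simp add: b)
    then show "i \<in> I \<or> j \<in> I" by (rule Inl_Inr_less_iff [THEN iffD1])
  qed
  ultimately show "x \<in> block_nil" using sp by (simp add: b block_nil_mem_iff)
next
  fix x assume "x \<in> block_nil"
  then obtain A S where x: "x = block A S 0 (- transpose A)" and A: "A \<in> pattern (\<lambda>a b. l a < l b)"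
    and S: "transpose S = S" "S \<in> pattern (\<lambda>a b. a \<in> I \<or> b \<in> I)"
    unfolding block_nil_def by blast
  have "x \<in> sp" using S(1) by (simp add: x block_mem_sp_iff)
  moreover have "lev i < lev j" if nz: "x $ i $ j \<noteq> 0" for i j
  proof (cases i; cases j)
    fix a b assume ij: "i = Inl a" "j = Inl b"
    then show ?thesis using nz patternD [OF A, of a b] by (simp add: x)
  next
    fix a b assume ij: "i = Inl a" "j = Inr b"
    then have "a \<in> I \<or> b \<in> I" using nz by (intro patternD [OF S(2), of a b]) (simp add: x)
    then show ?thesis unfolding ij by (rule Inl_Inr_less_iff [THEN iffD2])
  next
    fix a b assume ij: "i = Inr a" "j = Inl b"
    then show ?thesis using nz by (simp add: x)
  next
    fix a b assume ij: "i = Inr a" "j = Inr b"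
    then show ?thesis using nz patternD [OF A, of b a] lev_Inr_Inr [of a b] by (simp add: x transpose_nth)
  qed
  ultimately show "x \<in> strict" unfolding strict_def by (blast intro: patternI)
qed

theorem generic_stabiliser_nilradical: "has_generic_coadjoint_stabiliser (nilradical \<pp>)"
  using generic_stabiliser_block_nil by (simp only: nilradical_eq_strict strict_eq_block_nil)

end

section \<open>Lie's theorem for subquotients\<close>

lemma lie_bracket_mult_vector: "lie_bracket x y *v v = x *v (y *v v) - y *v (x *v v)"
  by (simp add: lie_bracket_def matrix_vector_mult_diff_rdistrib matrix_vector_mul_assoc)

lemma mult_vector_scale: "A *v (c *s v) = c *s (A *v (v :: complex^'m::finite))"
  by (simp add: vector_scalar_commute)

lemma mult_vector_sum: "A *v (\<Sum>i\<in>T. f i) = (\<Sum>i\<in>T. A *v (f i :: complex^'m::finite))"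
  by (induction T rule: infinite_finite_induct) (auto simp: matrix_vector_right_distrib)

section \<open>Krylov spaces modulo a subspace\<close>

definition orbit :: "complex^'m^'m \<Rightarrow> complex^'m \<Rightarrow> nat \<Rightarrow> complex^'m::finite" where
  "orbit y v k = (((*v) y) ^^ k) v"

lemma orbit_0 [simp]: "orbit y v 0 = v"
  and orbit_Suc: "orbit y v (Suc k) = y *v orbit y v k"
  by (simp_all add: orbit_def)

text \<open>The Krylov filtration of the quotient by \<open>W\<close>, kept as subspaces containing
  \<open>W\<close> so that no quotient space has to be formed.\<close>

definition krylov :: "(complex^'m) set \<Rightarrow> complex^'m^'m \<Rightarrow> complex^'m::finite \<Rightarrow> nat \<Rightarrow> (complex^'m) set" where
  "krylov W y v k = vec.span (W \<union> orbit y v ` {..<k})"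

lemma subspace_krylov: "vec.subspace (krylov W y v k)"
  by (simp add: krylov_def)

lemma krylov_mono: "j \<le> k \<Longrightarrow> krylov W y v j \<subseteq> krylov W y v k"
  unfolding krylov_def by (intro vec.span_mono) auto

lemma subset_krylov: "W \<subseteq> krylov W y v k"
  unfolding krylov_def by (meson Un_upper1 order_trans vec.span_superset)

lemma orbit_mem_krylov: "i < k \<Longrightarrow> orbit y v i \<in> krylov W y v k"
  unfolding krylov_def by (intro vec.span_base) auto

lemma krylov_0: "vec.subspace W \<Longrightarrow> krylov W y v 0 = W"
  by (simp add: krylov_def)

lemma krylov_induct:
  assumes "\<And>w. w \<in> W \<Longrightarrow> A *v w \<in> S" "\<And>i. i < k \<Longrightarrow> A *v orbit y v i \<in> S" "vec.subspace S" "u \<in> krylov W y v k"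
  shows "A *v u \<in> S"
  using assms(4) unfolding krylov_def
proof (induction rule: vec.span_induct_alt)
  case base
  then show ?case using vec.subspace_0 [OF assms(3)] by simp
next
  case (step c x z)
  then have "A *v x \<in> S" using assms(1,2) by auto
  then show ?case using step(2) assms(3)
    by (simp add: matrix_vector_right_distrib mult_vector_scale vec.subspace_add vec.subspace_scale)
qed

lemma krylov_step:
  assumes "\<And>w. w \<in> W \<Longrightarrow> y *v w \<in> W" "u \<in> krylov W y v k"
  shows "y *v u \<in> krylov W y v (Suc k)"
proof (rule krylov_induct [OF _ _ subspace_krylov assms(2)])
  show "y *v w \<in> krylov W y v (Suc k)" if "w \<in> W" for w
    using subset_krylov assms(1) that by blast
  show "y *v orbit y v i \<in> krylov W y v (Suc k)" if "i < k" for i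
    using orbit_mem_krylov [of "Suc i" "Suc k"] that by (simp add: orbit_Suc)
qed

text \<open>Otherwise every further orbit vector would raise the dimension by one, beyond that of
  the whole space.\<close>

lemma krylov_stabilises: "\<exists>m. orbit y v m \<in> krylov W y v m"
proof (rule ccontr)
  assume n: "\<nexists>m. orbit y v m \<in> krylov W y v m"
  let ?G = "\<lambda>k. W \<union> orbit y v ` {..<k}"
  have "k \<le> vec.dim (?G k)" for k
  proof (induction k)
    case (Suc k)
    have "?G (Suc k) = insert (orbit y v k) (?G k)" by (auto simp: lessThan_Suc)
    then have "vec.dim (?G (Suc k)) = vec.dim (?G k) + 1"
      using n vec.dim_insert [of "orbit y v k" "?G k"] by (simp add: krylov_def)
    then show ?case using Suc by simp
  qed simp
  then have "Suc CARD('a) \<le> vec.dim (?G (Suc CARD('a)))" .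
  also have "\<dots> \<le> CARD('a)" by (rule dim_subset_UNIV_cart_gen)
  finally show False by simp
qed

text \<open>As \<open>v\<close> is outside \<open>W\<close>, the first dependent orbit vector has
  positive index, and m is the predecessor of that index.\<close>

lemma krylov_least:
  assumes "vec.subspace W" "v \<notin> W"
  obtains m where "orbit y v (Suc m) \<in> krylov W y v (Suc m)" "orbit y v m \<notin> krylov W y v m"
proof -
  define n where "n = (LEAST m. orbit y v m \<in> krylov W y v m)"
  have n: "orbit y v n \<in> krylov W y v n" unfolding n_def by (rule LeastI_ex [OF krylov_stabilises])
  then obtain m where m: "n = Suc m" using assms by (cases n) (auto simp: krylov_0)
  then have "orbit y v m \<notin> krylov W y v m" using not_less_Least [of m "\<lambda>m. orbit y v m \<in> krylov W y v m"] by (simp add: n_def)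
  then show ?thesis using that n m by blast
qed

lemma krylov_coefficients:
  assumes "vec.subspace W" "u \<in> krylov W y v k"
  shows "\<exists>a. u - (\<Sum>i<k. a i *s orbit y v i) \<in> W"
  using assms(2)
proof (induction k arbitrary: u)
  case 0
  then show ?case using assms(1) by (simp add: krylov_0)
next
  case (Suc k)
  have "W \<union> orbit y v ` {..<Suc k} = insert (orbit y v k) (W \<union> orbit y v ` {..<k})" by (auto simp: lessThan_Suc)
  then obtain c where "u - c *s orbit y v k \<in> krylov W y v k"
    using Suc.prems unfolding krylov_def by (metis vec.span_breakdown_eq)
  from Suc.IH [OF this] obtain a where a: "u - c *s orbit y v k - (\<Sum>i<k. a i *s orbit y v i) \<in> W" by blast
  have "(\<Sum>i<k. (a (k := c)) i *s orbit y v i) = (\<Sum>i<k. a i *s orbit y v i)" by (rule sum.cong) auto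
  then have "u - (\<Sum>i<Suc k. (a (k := c)) i *s orbit y v i) = u - c *s orbit y v k - (\<Sum>i<k. a i *s orbit y v i)"
    by (simp add: algebra_simps)
  then show ?case using a by metis
qed

text \<open>The first dependence among the orbit vectors is a monic polynomial p with p(y) v in
  \<open>W1\<close>. A root \<mu> splits off, p = (X - \<mu>) q, and u = q(y) v works: its leading
  term is the last orbit vector still independent of \<open>W1\<close> and its predecessors.\<close>

lemma relative_eigenvector:
  fixes W1 W2 :: "(complex^'m::finite) set"
  assumes W1: "vec.subspace W1" and W2: "vec.subspace W2"
    and inv: "\<And>w. w \<in> W2 \<Longrightarrow> y *v w \<in> W2"
    and v: "v \<in> W2" "v \<notin> W1"
  obtains u \<mu> where "u \<in> W2" "u \<notin> W1" "y *v u - \<mu> *s u \<in> W1"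
proof -
  obtain m where m: "orbit y v (Suc m) \<in> krylov W1 y v (Suc m)" "orbit y v m \<notin> krylov W1 y v m"
    using krylov_least [OF W1 v(2)] .
  obtain a where a: "orbit y v (Suc m) - (\<Sum>i<Suc m. a i *s orbit y v i) \<in> W1"
    using krylov_coefficients [OF W1 m(1)] by blast
  define p where "p = monom 1 (Suc m) - (\<Sum>i<Suc m. monom (a i) i)"
  have cp: "coeff p i = (if i = Suc m then 1 else if i < Suc m then - a i else 0)" for i
  proof -
    have "coeff (\<Sum>j<Suc m. monom (a j) j) i = (\<Sum>j<Suc m. if j = i then a i else 0)"
      unfolding coeff_sum by (rule sum.cong) (auto simp: coeff_monom)
    then show ?thesis by (simp add: p_def coeff_monom del: sum.lessThan_Suc)
  qed
  have "degree p = Suc m"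
    by (rule antisym) (auto intro!: degree_le le_degree simp: cp)
  then have "\<not> constant (poly p)" by (simp add: constant_degree)
  then obtain \<mu> where "poly p \<mu> = 0" using fundamental_theorem_of_algebra by blast
  then obtain q where q: "p = [:- \<mu>, 1:] * q" by (metis dvdE poly_eq_0_iff_dvd)
  have "q \<noteq> 0" using \<open>degree p = Suc m\<close> q by auto
  then have "degree p = degree [:- \<mu>, 1:] + degree q" unfolding q by (intro degree_mult_eq) auto
  then have dq: "degree q = m" using \<open>degree p = Suc m\<close> by simp
  have cq: "coeff p (Suc i) = coeff q i - \<mu> * coeff q (Suc i)" "coeff p 0 = - \<mu> * coeff q 0" for i
    by (simp_all add: q)
  have lead: "coeff q m = 1" using cq(1) [of m] cp [of "Suc m"] dq by (simp add: coeff_eq_0)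
  define u where "u = (\<Sum>i<Suc m. coeff q i *s orbit y v i)"
  have orbit_W2: "orbit y v i \<in> W2" for i
    by (induction i) (auto simp: orbit_Suc v inv)
  have "u \<in> W2" unfolding u_def by (intro vec.subspace_sum [OF W2] vec.subspace_scale [OF W2] orbit_W2)
  moreover have "u \<notin> W1"
  proof
    assume "u \<in> W1"
    then have "u - (\<Sum>i<m. coeff q i *s orbit y v i) \<in> krylov W1 y v m"
      using subset_krylov [of W1 y v m]
      by (intro vec.subspace_diff subspace_krylov vec.subspace_sum vec.subspace_scale orbit_mem_krylov) auto
    then show False using m(2) lead by (simp add: u_def)
  qed
  moreover have "y *v u - \<mu> *s u \<in> W1"
  proof -
    \<comment> \<open>Comparing the coefficients of p with those of (X - \<mu>) q rewrites p(y) v as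
      y *v u - \<mu> *s u.\<close>
    have "orbit y v (Suc m) - (\<Sum>i<Suc m. a i *s orbit y v i) = (\<Sum>i<Suc (Suc m). coeff p i *s orbit y v i)"
    proof -
      have "(\<Sum>i<Suc m. coeff p i *s orbit y v i) = (\<Sum>i<Suc m. - (a i *s orbit y v i))"
        by (rule sum.cong) (auto simp: cp)
      then show ?thesis by (simp add: sum.lessThan_Suc [of _ "Suc m"] cp sum_negf del: sum.lessThan_Suc)
    qed
    also have "\<dots> = coeff p 0 *s orbit y v 0 + (\<Sum>i<Suc m. coeff p (Suc i) *s orbit y v (Suc i))"
      by (rule sum.lessThan_Suc_shift)
    also have "\<dots> = (\<Sum>i<Suc m. coeff q i *s orbit y v (Suc i))
        - (\<mu> *s (coeff q 0 *s orbit y v 0) + (\<Sum>i<Suc m. \<mu> *s (coeff q (Suc i) *s orbit y v (Suc i))))"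
      by (simp add: cq vector_sub_rdistrib sum_subtractf del: sum.lessThan_Suc orbit_0)
    also have "\<mu> *s (coeff q 0 *s orbit y v 0) + (\<Sum>i<Suc m. \<mu> *s (coeff q (Suc i) *s orbit y v (Suc i)))
       = (\<Sum>i<Suc (Suc m). \<mu> *s (coeff q i *s orbit y v i))"
      by (rule sum.lessThan_Suc_shift [symmetric])
    also have "\<dots> = \<mu> *s u" using dq by (simp add: u_def vec.scale_sum_right coeff_eq_0 vector_add_ldistrib)
    also have "(\<Sum>i<Suc m. coeff q i *s orbit y v (Suc i)) = y *v u"
      by (simp add: u_def orbit_Suc mult_vector_sum mult_vector_scale del: sum.lessThan_Suc)
    finally show ?thesis using a by simp
  qed
  ultimately show ?thesis using that by blast
qed

text \<open>A trace-free form of the invariance argument in Lie's theorem: modulo \<open>W\<close>, the operator \<open>x - \<mu>\<close> lowers the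
  Krylov filtration of \<open>y\<close>, and its leading coefficient on the first dependent vector \<open>orbit y v m\<close> is \<open>m * c\<close>.\<close>

lemma scalar_commutator_zero:
  assumes W: "vec.subspace W" and v: "v \<notin> W" and xW: "\<And>w. w \<in> W \<Longrightarrow> x *v w \<in> W"
    and x: "\<And>k. x *v orbit y v k - \<mu> *s orbit y v k - (of_nat k * c) *s orbit y v (k - 1) \<in> krylov W y v (k - 1)"
  shows "c = 0"
proof -
  define B where "B = x - (\<chi> i j. if i = j then \<mu> else 0)"
  have B: "B *v u = x *v u - \<mu> *s u" for u
  proof -
    have "(\<chi> i j. if i = j then \<mu> else 0) *v u = \<mu> *s u"
      by (simp add: vec_eq_iff matrix_vector_nth if_distrib [of "\<lambda>x. x * _"] cong: if_cong)
    then show ?thesis by (simp add: B_def matrix_vector_mult_diff_rdistrib)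
  qed
  obtain m where m: "orbit y v (Suc m) \<in> krylov W y v (Suc m)" "orbit y v m \<notin> krylov W y v m"
    using krylov_least [OF W v] .
  have low: "B *v orbit y v i \<in> krylov W y v i" for i
  proof -
    have *: "B *v orbit y v i - (of_nat i * c) *s orbit y v (i - 1) \<in> krylov W y v i"
      using x [of i] krylov_mono [of "i - 1" i W y v] by (auto simp: B)
    have "(of_nat i * c) *s orbit y v (i - 1) \<in> krylov W y v i"
    proof (cases i)
      case 0
      then show ?thesis using vec.subspace_0 [OF subspace_krylov] by simp
    next
      case (Suc j)
      then show ?thesis by (intro vec.subspace_scale subspace_krylov orbit_mem_krylov) auto
    qed
    from vec.subspace_add [OF subspace_krylov * this] show ?thesis by simp
  qed
  have "B *v orbit y v (Suc m) \<in> krylov W y v m"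
  proof (rule krylov_induct [OF _ _ subspace_krylov m(1)])
    fix w assume "w \<in> W"
    then have "B *v w \<in> W" unfolding B by (intro vec.subspace_diff vec.subspace_scale W xW)
    then show "B *v w \<in> krylov W y v m" using subset_krylov by blast
  next
    fix i assume "i < Suc m"
    then show "B *v orbit y v i \<in> krylov W y v m" using low [of i] krylov_mono [of i m W y v] by auto
  qed
  note 1 = this
  have 2: "B *v orbit y v (Suc m) - (of_nat (Suc m) * c) *s orbit y v m \<in> krylov W y v m"
    using x [of "Suc m"] by (simp add: B)
  have "(of_nat (Suc m) * c) *s orbit y v m \<in> krylov W y v m"
    using vec.subspace_diff [OF subspace_krylov 1 2] by (simp only: diff_diff_eq2 add_diff_cancel_left')
  note mem = this
  show ?thesis
  proof (rule ccontr)
    assume "c \<noteq> 0"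
    then have "of_nat (Suc m) * c \<noteq> 0" by (simp del: of_nat_Suc)
    then have "orbit y v m = (1 / (of_nat (Suc m) * c)) *s ((of_nat (Suc m) * c) *s orbit y v m)"
      unfolding vector_smult_assoc by (simp del: of_nat_Suc)
    also have "\<dots> \<in> krylov W y v m" by (intro vec.subspace_scale subspace_krylov mem)
    finally show False using m(2) by blast
  qed
qed

lemma subspace_weight_space:
  fixes W1 W :: "(complex^'m::finite) set"
  assumes W1: "vec.subspace W1" and W: "vec.subspace W"
  shows "vec.subspace {v \<in> W. \<forall>z\<in>Z. z *v v - \<kappa> z *s v \<in> W1}" (is "vec.subspace ?W'")
proof (rule vec.subspaceI)
  show "0 \<in> ?W'" using vec.subspace_0 [OF W1] vec.subspace_0 [OF W] by simp
next
  fix u v assume uv: "u \<in> ?W'" "v \<in> ?W'"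
  have "z *v (u + v) - \<kappa> z *s (u + v) = (z *v u - \<kappa> z *s u) + (z *v v - \<kappa> z *s v)" for z
    by (simp add: matrix_vector_right_distrib vector_add_ldistrib)
  then show "u + v \<in> ?W'"
    using uv vec.subspace_add [OF W1] vec.subspace_add [OF W] unfolding mem_Collect_eq by metis
next
  fix c v assume v: "v \<in> ?W'"
  have "z *v (c *s v) - \<kappa> z *s (c *s v) = c *s (z *v v - \<kappa> z *s v)" for z
    by (simp add: mult_vector_scale vector_ssub_ldistrib vector_smult_assoc mult.commute)
  then show "c *s v \<in> ?W'"
    using v vec.subspace_scale [OF W1] vec.subspace_scale [OF W] unfolding mem_Collect_eq by metis
qed

lemma derived_series_bracket_span: "derived_series (bracket_span \<bb> \<bb>) k = derived_series \<bb> (Suc k)"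
  by (induction k) simp_all

text \<open>Induction on the derived length, over an irreducible subquotient W / W1. The derived
  algebra acts on some vector by scalars \<kappa>, irreducibility spreads this to all of W, and then
  every element of \<bb> has an invariant eigenspace modulo \<open>W1\<close>, which is again all of
  W.\<close>

theorem lie_theorem:
  fixes W1 W2 :: "(complex^'m::finite) set"
  assumes "lie_subalgebra \<bb>" "derived_series \<bb> K = {0}"
    and "vec.subspace W1" "vec.subspace W2" "W1 \<subset> W2"
    and "\<And>x w. x \<in> \<bb> \<Longrightarrow> w \<in> W1 \<Longrightarrow> x *v w \<in> W1" "\<And>x w. x \<in> \<bb> \<Longrightarrow> w \<in> W2 \<Longrightarrow> x *v w \<in> W2"
  shows "\<exists>v \<kappa>. v \<in> W2 \<and> v \<notin> W1 \<and> (\<forall>x\<in>\<bb>. x *v v - \<kappa> x *s v \<in> W1)"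
  using assms
proof (induction K arbitrary: \<bb> W2)
  case 0
  then have "\<bb> = {0}" by simp
  moreover obtain v where "v \<in> W2" "v \<notin> W1" using 0 by blast
  ultimately show ?case using vec.subspace_0 [OF \<open>vec.subspace W1\<close>]
    by (intro exI [of _ v] exI [of _ "\<lambda>_. 0"]) simp
next
  case (Suc K)
  note W1 = \<open>vec.subspace W1\<close> and invW1 = Suc.prems(6)
  have sub: "gl.subspace \<bb>" and br: "\<And>x y. x \<in> \<bb> \<Longrightarrow> y \<in> \<bb> \<Longrightarrow> lie_bracket x y \<in> \<bb>"
    using Suc.prems(1) by (auto simp: lie_subalgebra_def)
  let ?good = "\<lambda>W. vec.subspace W \<and> W1 \<subset> W \<and> W \<subseteq> W2 \<and> (\<forall>x\<in>\<bb>. \<forall>w\<in>W. x *v w \<in> W)"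
  have "?good W2" using Suc.prems by blast
  then obtain W where good: "?good W" and min: "\<And>W'. ?good W' \<Longrightarrow> vec.dim W \<le> vec.dim W'"
    using ex_has_least_nat [of ?good W2 vec.dim] by blast
  then have W: "vec.subspace W" "W1 \<subset> W" "W \<subseteq> W2" and invW: "\<And>x w. x \<in> \<bb> \<Longrightarrow> w \<in> W \<Longrightarrow> x *v w \<in> W" by auto
  have minimal: "W' = W" if W': "vec.subspace W'" "W1 \<subseteq> W'" "W' \<subseteq> W" "\<And>x w. x \<in> \<bb> \<Longrightarrow> w \<in> W' \<Longrightarrow> x *v w \<in> W'"
    and "v \<in> W'" "v \<notin> W1" for W' v
  proof -
    have "?good W'" using that W by blast
    from min [OF this] show ?thesis using vec.subspace_dim_equal [OF W'(1) W(1) W'(3)] by blast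
  qed
  let ?a = "bracket_span \<bb> \<bb>"
  have a_sub: "?a \<subseteq> \<bb>" unfolding bracket_span_def by (rule gl.span_minimal) (use br sub in auto)
  have a_br: "lie_bracket x y \<in> ?a" if "x \<in> \<bb>" "y \<in> \<bb>" for x y
    unfolding bracket_span_def by (rule gl.span_base) (use that in blast)
  have "lie_subalgebra ?a"
    unfolding lie_subalgebra_def using a_sub a_br by (auto simp: bracket_span_def)
  moreover have "derived_series ?a K = {0}" using Suc.prems(2) by (simp only: derived_series_bracket_span)
  ultimately obtain v0 \<kappa> where v0: "v0 \<in> W" "v0 \<notin> W1" and \<kappa>: "\<And>z. z \<in> ?a \<Longrightarrow> z *v v0 - \<kappa> z *s v0 \<in> W1"
    using Suc.IH [of ?a W] W1 W a_sub invW1 invW by (metis subsetD)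
  \<comment> \<open>This vanishing is what makes the weight space of \<kappa> stable under
    \<bb>.\<close>
  have \<kappa>0: "\<kappa> (lie_bracket z y) = 0" if z: "z \<in> ?a" and y: "y \<in> \<bb>" for z y
  proof (rule scalar_commutator_zero [OF W1 v0(2)])
    show "z *v w \<in> W1" if "w \<in> W1" for w using that z a_sub invW1 by blast
    have yW: "y *v w \<in> W1" if "w \<in> W1" for w using that y invW1 by blast
    \<comment> \<open>The induction is over all z at once, since the step for z uses the hypothesis
      for \<open>lie_bracket z y\<close> as well.\<close>
    have "\<forall>z\<in>?a. z *v orbit y v0 k - \<kappa> z *s orbit y v0 k - (of_nat k * \<kappa> (lie_bracket z y)) *s orbit y v0 (k - 1) \<in> krylov W1 y v0 (k - 1)" for k
    proof (induction k)
      case 0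
      then show ?case using \<kappa> by (simp add: krylov_0 [OF W1])
    next
      case (Suc k)
      let ?v = "orbit y v0" and ?S = "krylov W1 y v0 k"
      show ?case
      proof
        fix z assume z: "z \<in> ?a"
        let ?z = "lie_bracket z y"
        have zy: "?z \<in> ?a" using z y a_sub a_br by blast
        define s where "s = z *v ?v k - \<kappa> z *s ?v k - (of_nat k * \<kappa> ?z) *s ?v (k - 1)"
        have s: "s \<in> krylov W1 y v0 (k - 1)" unfolding s_def using Suc z by blast
        have ys: "y *v s \<in> ?S"
        proof (cases k)
          case 0
          then show ?thesis using s yW by (simp add: krylov_0 [OF W1])
        next
          case (Suc j)
          then show ?thesis using krylov_step [OF yW s] by simp
        qed
        \<comment> \<open>For k = 0 both sides are 0, so the truncated subtraction k - 1 is
          harmless.\<close>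
        have yv: "of_nat k *s (y *v ?v (k - 1)) = of_nat k *s ?v k" by (cases k) (simp_all add: orbit_Suc)
        have 1: "?z *v ?v k - \<kappa> ?z *s ?v k \<in> ?S"
        proof -
          have "(?z *v ?v k - \<kappa> ?z *s ?v k - (of_nat k * \<kappa> (lie_bracket ?z y)) *s ?v (k - 1)) + (of_nat k * \<kappa> (lie_bracket ?z y)) *s ?v (k - 1) \<in> ?S"
          proof (rule vec.subspace_add [OF subspace_krylov])
            show "?z *v ?v k - \<kappa> ?z *s ?v k - (of_nat k * \<kappa> (lie_bracket ?z y)) *s ?v (k - 1) \<in> ?S"
              using Suc zy krylov_mono [of "k - 1" k W1 y v0] by auto
            show "(of_nat k * \<kappa> (lie_bracket ?z y)) *s ?v (k - 1) \<in> ?S"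
              using vec.subspace_0 [OF subspace_krylov]
              by (cases k) (auto intro!: vec.subspace_scale subspace_krylov orbit_mem_krylov)
          qed
          then show ?thesis by simp
        qed
        have "y *v s = y *v (z *v ?v k) - \<kappa> z *s ?v (Suc k) - \<kappa> ?z *s (of_nat k *s (y *v ?v (k - 1)))"
          by (simp add: s_def matrix_vector_mult_diff_distrib mult_vector_scale orbit_Suc vector_smult_assoc mult.commute)
        then have "z *v ?v (Suc k) - \<kappa> z *s ?v (Suc k) - (of_nat (Suc k) * \<kappa> ?z) *s ?v k
            = y *v s + (?z *v ?v k - \<kappa> ?z *s ?v k)"
          unfolding yv lie_bracket_mult_vector
          by (simp add: orbit_Suc vector_smult_assoc ring_distribs vector_sadd_rdistrib mult.commute)
        then show "z *v ?v (Suc k) - \<kappa> z *s ?v (Suc k) - (of_nat (Suc k) * \<kappa> ?z) *s ?v (Suc k - 1) \<in> krylov W1 y v0 (Suc k - 1)"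
          using vec.subspace_add [OF subspace_krylov ys 1] by simp
      qed
    qed
    then show "z *v orbit y v0 k - \<kappa> z *s orbit y v0 k - (of_nat k * \<kappa> (lie_bracket z y)) *s orbit y v0 (k - 1) \<in> krylov W1 y v0 (k - 1)" for k
      using z by blast
  qed
  \<comment> \<open>The weight space is stable by \<open>\<kappa>0\<close> and contains
    \<open>v0\<close>, so minimality of W makes it all of W.\<close>
  have "{v \<in> W. \<forall>z\<in>?a. z *v v - \<kappa> z *s v \<in> W1} = W" (is "?W' = W")
  proof (rule minimal)
    show "vec.subspace ?W'" by (rule subspace_weight_space [OF W1 W(1)])
    show "W1 \<subseteq> ?W'"
      using W(2) a_sub invW1 by (auto intro!: vec.subspace_diff [OF W1] vec.subspace_scale [OF W1])
    show "x *v v \<in> ?W'" if x: "x \<in> \<bb>" and v: "v \<in> ?W'" for x v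
    proof -
      have "z *v (x *v v) - \<kappa> z *s (x *v v) \<in> W1" if z: "z \<in> ?a" for z
      proof -
        have "lie_bracket z x \<in> ?a" using z x a_sub a_br by blast
        then have "lie_bracket z x *v v \<in> W1" using v \<kappa>0 [OF z x] by fastforce
        moreover have "x *v (z *v v - \<kappa> z *s v) \<in> W1" using v z x invW1 by blast
        ultimately have "x *v (z *v v - \<kappa> z *s v) + lie_bracket z x *v v \<in> W1" by (intro vec.subspace_add [OF W1])
        then show ?thesis
          by (simp add: lie_bracket_mult_vector matrix_vector_mult_diff_distrib mult_vector_scale)
      qed
      then show ?thesis using v x invW by blast
    qed
    show "v0 \<in> ?W'" using v0 \<kappa> by blast
  qed (use v0 in auto)
  then have weight: "z *v v - \<kappa> z *s v \<in> W1" if "z \<in> ?a" "v \<in> W" for z v using that by blast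
  have "\<exists>\<mu>. \<forall>v\<in>W. x *v v - \<mu> *s v \<in> W1" if x: "x \<in> \<bb>" for x
  proof -
    obtain u \<mu> where u: "u \<in> W" "u \<notin> W1" and \<mu>: "x *v u - \<mu> *s u \<in> W1"
      using relative_eigenvector [OF W1 W(1) invW [OF x] v0] by blast
    \<comment> \<open>The same argument for the single operator x; now the errors stay in
      \<open>W1\<close>, because \<open>lie_bracket x y\<close> already acts by a scalar on all of
      W.\<close>
    have comm: "\<kappa> (lie_bracket x y) = 0" if y: "y \<in> \<bb>" for y
    proof (rule scalar_commutator_zero [OF W1 u(2)])
      let ?c = "\<kappa> (lie_bracket x y)" and ?v = "orbit y u"
      show "x *v w \<in> W1" if "w \<in> W1" for w using that x invW1 by blast
      have vW: "?v k \<in> W" for k by (induction k) (auto simp: orbit_Suc u invW y)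
      have "x *v ?v k - \<mu> *s ?v k - (of_nat k * ?c) *s ?v (k - 1) \<in> W1" for k
      proof (induction k)
        case 0
        then show ?case using \<mu> by simp
      next
        case (Suc k)
        have yv: "of_nat k *s (y *v ?v (k - 1)) = of_nat k *s ?v k" by (cases k) (simp_all add: orbit_Suc)
        define s where "s = x *v ?v k - \<mu> *s ?v k - (of_nat k * ?c) *s ?v (k - 1)"
        have "y *v s \<in> W1" unfolding s_def using Suc invW1 y by blast
        moreover have "lie_bracket x y *v ?v k - ?c *s ?v k \<in> W1" using weight a_br x y vW by blast
        moreover have "y *v s = y *v (x *v ?v k) - \<mu> *s ?v (Suc k) - ?c *s (of_nat k *s (y *v ?v (k - 1)))"
          by (simp add: s_def matrix_vector_mult_diff_distrib mult_vector_scale orbit_Suc vector_smult_assoc mult.commute)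
        then have "x *v ?v (Suc k) - \<mu> *s ?v (Suc k) - (of_nat (Suc k) * ?c) *s ?v k
            = y *v s + (lie_bracket x y *v ?v k - ?c *s ?v k)"
          unfolding yv lie_bracket_mult_vector
          by (simp add: orbit_Suc vector_smult_assoc ring_distribs vector_sadd_rdistrib mult.commute)
        ultimately show ?case using vec.subspace_add [OF W1] by simp
      qed
      then show "x *v ?v k - \<mu> *s ?v k - (of_nat k * ?c) *s ?v (k - 1) \<in> krylov W1 y u (k - 1)" for k
        using subset_krylov by blast
    qed
    \<comment> \<open>By \<open>comm\<close> the eigenspace of x is stable under \<bb>, so it is
      W.\<close>
    have "{v \<in> W. x *v v - \<mu> *s v \<in> W1} = W" (is "?W' = W")
    proof (rule minimal)
      show "vec.subspace ?W'" using subspace_weight_space [OF W1 W(1), of "{x}" "\<lambda>_. \<mu>"] by simp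
      show "W1 \<subseteq> ?W'"
        using W(2) x invW1 by (auto intro!: vec.subspace_diff [OF W1] vec.subspace_scale [OF W1])
      show "y *v v \<in> ?W'" if y: "y \<in> \<bb>" and v: "v \<in> ?W'" for y v
      proof -
        have "lie_bracket x y *v v \<in> W1" using weight [OF a_br [OF x y], of v] v comm [OF y] by simp
        moreover have "y *v (x *v v - \<mu> *s v) \<in> W1" using v y invW1 by blast
        ultimately have "y *v (x *v v - \<mu> *s v) + lie_bracket x y *v v \<in> W1" by (intro vec.subspace_add [OF W1])
        then have "x *v (y *v v) - \<mu> *s (y *v v) \<in> W1"
          by (simp add: lie_bracket_mult_vector matrix_vector_mult_diff_distrib mult_vector_scale)
        then show ?thesis using v y invW by blast
      qed
    qed (use u \<mu> in auto)
    then show ?thesis by blast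
  qed
  then obtain \<nu> where "\<And>x v. x \<in> \<bb> \<Longrightarrow> v \<in> W \<Longrightarrow> x *v v - \<nu> x *s v \<in> W1" by metis
  then show ?case using v0 W(3) by blast
qed

section \<open>Transport along similarity\<close>

lemma matrix_mult_cscale: "cscale c A ** B = cscale c (A ** B)" "A ** cscale c B = cscale c (A ** (B :: complex^'m::finite^'m))"
  by (simp_all add: matrix_eq_iff matrix_mult_nth cscale_def sum_distrib_left mult_ac)

definition similar :: "complex^'m^'m \<Rightarrow> complex^'m^'m \<Rightarrow> complex^'m^'m \<Rightarrow> complex^'m::finite^'m" where
  "similar P Q x = P ** x ** Q"

locale similarity =
  fixes P Q :: "complex^'m::finite^'m"
  assumes PQ: "P ** Q = mat 1"
begin

lemma QP: "Q ** P = mat 1"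
  using PQ matrix_left_right_inverse by blast

lemma cancel [simp]: "similar Q P (similar P Q x) = x" "similar P Q (similar Q P x) = x"
proof -
  have "similar Q P (similar P Q x) = (Q ** P) ** x ** (Q ** P)" by (simp add: similar_def matrix_mul_assoc)
  then show "similar Q P (similar P Q x) = x" by (simp add: QP)
  have "similar P Q (similar Q P x) = (P ** Q) ** x ** (P ** Q)" by (simp add: similar_def matrix_mul_assoc)
  then show "similar P Q (similar Q P x) = x" by (simp add: PQ)
qed

lemma image_cancel: "similar Q P ` similar P Q ` S = S"
  by (simp add: image_image)

lemma mem_image_iff: "x \<in> similar P Q ` S \<longleftrightarrow> similar Q P x \<in> S"
proof
  assume "similar Q P x \<in> S"
  then have "similar P Q (similar Q P x) \<in> similar P Q ` S" by (rule imageI)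
  then show "x \<in> similar P Q ` S" by simp
qed auto

lemma similar_add: "similar P Q (x + y) = similar P Q x + similar P Q y"
  and similar_diff: "similar P Q (x - y) = similar P Q x - similar P Q y"
  and similar_cscale: "similar P Q (cscale c x) = cscale c (similar P Q x)"
  and similar_0 [simp]: "similar P Q 0 = 0"
  by (simp_all add: similar_def matrix_add_ldistrib matrix_add_rdistrib matrix_diff_ldistrib
      matrix_diff_rdistrib matrix_mult_cscale)

lemma similar_mult: "similar P Q (x ** y) = similar P Q x ** similar P Q y"
proof -
  have "similar P Q x ** similar P Q y = P ** x ** (Q ** P) ** y ** Q" by (simp add: similar_def matrix_mul_assoc)
  then show ?thesis by (simp add: QP similar_def matrix_mul_assoc)
qed

lemma similar_bracket: "similar P Q (lie_bracket x y) = lie_bracket (similar P Q x) (similar P Q y)"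
  by (simp add: lie_bracket_def similar_diff similar_mult)

lemma similar_one: "similar P Q (mat 1) = mat 1"
  by (simp add: similar_def PQ)

lemma subspace_image:
  assumes "gl.subspace S"
  shows "gl.subspace (similar P Q ` S)"
proof (rule gl.subspaceI)
  show "0 \<in> similar P Q ` S" using gl.subspace_0 [OF assms] by (rule image_eqI [rotated]) simp
next
  fix x y assume "x \<in> similar P Q ` S" "y \<in> similar P Q ` S"
  then show "x + y \<in> similar P Q ` S"
    using gl.subspace_add [OF assms] by (auto simp: similar_add [symmetric])
next
  fix c x assume "x \<in> similar P Q ` S"
  then show "cscale c x \<in> similar P Q ` S"
    using gl.subspace_scale [OF assms] by (auto simp: similar_cscale [symmetric])
qed

text \<open>Makes every fact of the locale available with the two matrices exchanged; images are
  undone in this way.\<close>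

lemma inverse: "similarity Q P"
  by unfold_locales (rule QP)

text \<open>One inclusion is minimality of the span, the other is that same inclusion for the
  inverse similarity.\<close>

lemma span_image: "gl.span (similar P Q ` S) = similar P Q ` gl.span S"
proof
  show "gl.span (similar P Q ` S) \<subseteq> similar P Q ` gl.span S"
    by (intro gl.span_minimal image_mono gl.span_superset subspace_image gl.subspace_span)
  have "S \<subseteq> similar Q P ` gl.span (similar P Q ` S)"
  proof -
    have "S = similar Q P ` similar P Q ` S" by (simp add: image_cancel)
    also have "\<dots> \<subseteq> similar Q P ` gl.span (similar P Q ` S)" by (intro image_mono gl.span_superset)
    finally show ?thesis .
  qed
  then have "gl.span S \<subseteq> similar Q P ` gl.span (similar P Q ` S)"
    by (intro gl.span_minimal similarity.subspace_image inverse gl.subspace_span)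
  then have "similar P Q ` gl.span S \<subseteq> similar P Q ` similar Q P ` gl.span (similar P Q ` S)" by (rule image_mono)
  then show "similar P Q ` gl.span S \<subseteq> gl.span (similar P Q ` S)"
    by (simp add: similarity.image_cancel [OF inverse])
qed

lemma bracket_span_image: "bracket_span (similar P Q ` \<aa>) (similar P Q ` \<bb>) = similar P Q ` bracket_span \<aa> \<bb>"
proof -
  have "{lie_bracket x y | x y. x \<in> similar P Q ` \<aa> \<and> y \<in> similar P Q ` \<bb>}
      = similar P Q ` {lie_bracket x y | x y. x \<in> \<aa> \<and> y \<in> \<bb>}"
  proof (intro equalityI subsetI)
    fix z assume "z \<in> {lie_bracket x y | x y. x \<in> similar P Q ` \<aa> \<and> y \<in> similar P Q ` \<bb>}"
    then obtain x y where xy: "x \<in> \<aa>" "y \<in> \<bb>" "z = lie_bracket (similar P Q x) (similar P Q y)" by blast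
    show "z \<in> similar P Q ` {lie_bracket x y | x y. x \<in> \<aa> \<and> y \<in> \<bb>}"
      by (rule image_eqI [of _ _ "lie_bracket x y"]) (use xy similar_bracket in auto)
  next
    fix z assume "z \<in> similar P Q ` {lie_bracket x y | x y. x \<in> \<aa> \<and> y \<in> \<bb>}"
    then show "z \<in> {lie_bracket x y | x y. x \<in> similar P Q ` \<aa> \<and> y \<in> similar P Q ` \<bb>}"
      using similar_bracket by blast
  qed
  then show ?thesis unfolding bracket_span_def by (simp only: span_image)
qed

lemma derived_series_image: "derived_series (similar P Q ` \<gg>) k = similar P Q ` derived_series \<gg> k"
  by (induction k) (simp_all add: bracket_span_image)

lemma lower_central_series_image: "lower_central_series (similar P Q ` \<gg>) k = similar P Q ` lower_central_series \<gg> k"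
  by (induction k) (simp_all add: bracket_span_image)

lemma lie_subalgebra_image: "lie_subalgebra \<gg> \<Longrightarrow> lie_subalgebra (similar P Q ` \<gg>)"
  unfolding lie_subalgebra_def
  by (intro conjI subspace_image ballI) (auto simp: similar_bracket [symmetric])

lemma lie_solvable_image: "lie_solvable \<gg> \<Longrightarrow> lie_solvable (similar P Q ` \<gg>)"
  unfolding lie_solvable_def derived_series_image by (metis image_empty image_insert similar_0)

lemma nilpotent_ideal_image:
  assumes "lie_ideal \<ii> \<gg> \<and> lie_nilpotent \<ii>"
  shows "lie_ideal (similar P Q ` \<ii>) (similar P Q ` \<gg>) \<and> lie_nilpotent (similar P Q ` \<ii>)"
proof
  show "lie_ideal (similar P Q ` \<ii>) (similar P Q ` \<gg>)"
    using assms unfolding lie_ideal_def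
    by (intro conjI subspace_image ballI) (auto simp: similar_bracket [symmetric])
  show "lie_nilpotent (similar P Q ` \<ii>)"
    using assms unfolding lie_nilpotent_def lower_central_series_image by (metis image_empty image_insert similar_0)
qed

lemma nilradical_image: "nilradical (similar P Q ` \<gg>) = similar P Q ` nilradical \<gg>"
proof -
  have "{\<ii>. lie_ideal \<ii> (similar P Q ` \<gg>) \<and> lie_nilpotent \<ii>}
      = (`) (similar P Q) ` {\<ii>. lie_ideal \<ii> \<gg> \<and> lie_nilpotent \<ii>}"
  proof (intro equalityI subsetI)
    fix \<ii> assume "\<ii> \<in> {\<ii>. lie_ideal \<ii> (similar P Q ` \<gg>) \<and> lie_nilpotent \<ii>}"
    then have "similar Q P ` \<ii> \<in> {\<ii>. lie_ideal \<ii> \<gg> \<and> lie_nilpotent \<ii>}"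
      using similarity.nilpotent_ideal_image [OF inverse, of \<ii> "similar P Q ` \<gg>"] by (simp add: image_cancel)
    then show "\<ii> \<in> (`) (similar P Q) ` {\<ii>. lie_ideal \<ii> \<gg> \<and> lie_nilpotent \<ii>}"
      by (rule image_eqI [rotated]) (simp add: similarity.image_cancel [OF inverse])
  qed (use nilpotent_ideal_image in auto)
  then have "\<Union>{\<ii>. lie_ideal \<ii> (similar P Q ` \<gg>) \<and> lie_nilpotent \<ii>}
      = similar P Q ` \<Union>{\<ii>. lie_ideal \<ii> \<gg> \<and> lie_nilpotent \<ii>}"
    by (simp add: image_Union)
  then show ?thesis unfolding nilradical_def by (simp only: span_image)
qed

section \<open>Transport of functionals, the Zariski topology and stabilisers\<close>

lemma dual_space_image:
  assumes "\<xi> \<in> dual_space \<nn>"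
  shows "\<xi> \<circ> similar Q P \<in> dual_space (similar P Q ` \<nn>)"
  using assms unfolding dual_space_def mem_Collect_eq mem_image_iff comp_def
  by (simp add: similarity.similar_add [OF inverse] similarity.similar_cscale [OF inverse])

lemma comp_similar_cancel: "\<xi> \<circ> similar Q P \<circ> similar P Q = \<xi>"
  by (simp add: fun_eq_iff)

lemma dual_polynomials_image:
  assumes "p \<in> dual_polynomials \<nn>"
  shows "(\<lambda>\<eta>. p (\<eta> \<circ> similar P Q)) \<in> dual_polynomials (similar P Q ` \<nn>)"
  using assms
proof induction
  case (const c)
  show ?case by (rule dual_polynomials.const)
next
  case (eval x)
  then have "(\<lambda>\<eta>. \<eta> (similar P Q x)) \<in> dual_polynomials (similar P Q ` \<nn>)"
    by (intro dual_polynomials.eval imageI)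
  then show ?case by (simp add: comp_def)
next
  case (add p q)
  from dual_polynomials.add [OF add.IH] show ?case .
next
  case (mult p q)
  from dual_polynomials.mult [OF mult.IH] show ?case .
qed

text \<open>Functionals move by composition with the inverse similarity, so that values at
  corresponding elements agree.\<close>

abbreviation push :: "(complex^'m^'m \<Rightarrow> complex) \<Rightarrow> complex^'m^'m \<Rightarrow> complex" where
  "push \<xi> \<equiv> \<xi> \<circ> similar Q P"

lemma zariski_closed_image:
  assumes "zariski_closed \<nn> Z"
  shows "zariski_closed (similar P Q ` \<nn>) (push ` Z)"
proof -
  obtain F where F: "F \<subseteq> dual_polynomials \<nn>" and Z: "Z = {\<xi> \<in> dual_space \<nn>. \<forall>f\<in>F. f \<xi> = 0}"
    using assms by (auto simp: zariski_closed_def)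
  let ?F = "(\<lambda>p \<eta>. p (\<eta> \<circ> similar P Q)) ` F"
  have "push ` Z = {\<eta> \<in> dual_space (similar P Q ` \<nn>). \<forall>f\<in>?F. f \<eta> = 0}"
  proof (intro equalityI subsetI)
    fix \<eta> assume "\<eta> \<in> push ` Z"
    then show "\<eta> \<in> {\<eta> \<in> dual_space (similar P Q ` \<nn>). \<forall>f\<in>?F. f \<eta> = 0}"
      using dual_space_image by (auto simp: Z comp_similar_cancel)
  next
    fix \<eta> assume \<eta>: "\<eta> \<in> {\<eta> \<in> dual_space (similar P Q ` \<nn>). \<forall>f\<in>?F. f \<eta> = 0}"
    have "\<eta> \<circ> similar P Q \<in> dual_space (similar Q P ` similar P Q ` \<nn>)"
      by (rule similarity.dual_space_image [OF inverse]) (use \<eta> in blast)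
    then have "\<eta> \<circ> similar P Q \<in> Z" using \<eta> by (auto simp: Z image_cancel)
    then have "push (\<eta> \<circ> similar P Q) \<in> push ` Z" by (rule imageI)
    then show "\<eta> \<in> push ` Z" by (simp add: similarity.comp_similar_cancel [OF inverse])
  qed
  moreover have "?F \<subseteq> dual_polynomials (similar P Q ` \<nn>)"
    using F dual_polynomials_image by auto
  ultimately show ?thesis unfolding zariski_closed_def by blast
qed

lemma dual_space_image_eq: "push ` dual_space \<nn> = dual_space (similar P Q ` \<nn>)"
proof (intro equalityI subsetI)
  fix \<eta> assume "\<eta> \<in> dual_space (similar P Q ` \<nn>)"
  then have "\<eta> \<circ> similar P Q \<in> dual_space (similar Q P ` similar P Q ` \<nn>)"
    by (rule similarity.dual_space_image [OF inverse])
  then have "\<eta> \<circ> similar P Q \<in> dual_space \<nn>" by (simp only: image_cancel)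
  then have "push (\<eta> \<circ> similar P Q) \<in> push ` dual_space \<nn>" by (rule imageI)
  then show "\<eta> \<in> push ` dual_space \<nn>" by (simp add: similarity.comp_similar_cancel [OF inverse])
qed (use dual_space_image in auto)

lemma inj_push: "inj push"
  by (rule inj_on_inverseI [of _ "\<lambda>\<eta>. \<eta> \<circ> similar P Q"]) (rule comp_similar_cancel)

lemma coadjoint_stabiliser_image:
  "coadjoint_stabiliser (similar P Q ` \<nn>) (push \<xi>) = similar P Q ` coadjoint_stabiliser \<nn> \<xi>"
proof -
  have "x \<in> coadjoint_stabiliser (similar P Q ` \<nn>) (push \<xi>) \<longleftrightarrow> similar Q P x \<in> coadjoint_stabiliser \<nn> \<xi>" for x
    unfolding coadjoint_stabiliser_iff mem_image_iff by (simp add: similarity.similar_bracket [OF inverse])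
  then show ?thesis using mem_image_iff by blast
qed

lemma mpow_similar: "mpow (similar P Q A) k = similar P Q (mpow A k)"
  by (induction k) (simp_all add: mpow_Suc similar_mult similar_one)

lemma matrix_exp_similar:
  assumes "mpow A K = 0"
  shows "matrix_exp (similar P Q A) = similar P Q (matrix_exp A)"
proof -
  have "mpow (similar P Q A) K = 0" by (simp add: mpow_similar assms)
  then show ?thesis
    by (simp add: matrix_exp_finite [where K = K] assms mpow_similar)
      (simp add: similar_def matrix_mult_sum_left matrix_mult_sum_right matrix_mult_scaleR_left matrix_mult_scaleR_right)
qed

text \<open>\<open>matrix_inv\<close> is defined by choice. Nilpotency supplies exp(-a) as the
  inverse of exp(a), and its image is then the inverse of the image.\<close>

lemma conjugate_under_image:
  assumes nil: "\<And>x. x \<in> \<nn> \<Longrightarrow> \<exists>K. mpow x K = 0"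
    and conj: "conjugate_under (matrix_exp ` \<nn>) \<ss> \<tt>"
  shows "conjugate_under (matrix_exp ` similar P Q ` \<nn>) (similar P Q ` \<ss>) (similar P Q ` \<tt>)"
proof -
  obtain a where a: "a \<in> \<nn>" and t: "\<tt> = (\<lambda>x. matrix_exp a ** x ** matrix_inv (matrix_exp a)) ` \<ss>"
    using conj by (auto simp: conjugate_under_def)
  obtain K where K: "mpow a K = 0" using nil a by blast
  let ?g = "matrix_exp a" and ?h = "matrix_exp (- a)"
  have gh: "?g ** ?h = mat 1" "?h ** ?g = mat 1"
    using matrix_exp_mult_minus [OF K] matrix_left_right_inverse by blast+
  then have inv: "matrix_inv ?g = ?h" by (rule matrix_inv_eqI)
  have g': "matrix_exp (similar P Q a) = similar P Q ?g" by (rule matrix_exp_similar [OF K])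
  have inv': "matrix_inv (similar P Q ?g) = similar P Q ?h"
    by (rule matrix_inv_eqI) (simp_all add: similar_mult [symmetric] gh similar_one)
  have "similar P Q ` \<tt> = (\<lambda>x. similar P Q ?g ** x ** matrix_inv (similar P Q ?g)) ` similar P Q ` \<ss>"
    unfolding t inv inv' image_image by (simp add: similar_mult)
  then show ?thesis unfolding conjugate_under_def using a g' by (metis imageI)
qed

lemma generic_stabiliser_image:
  assumes nil: "\<And>x. x \<in> \<nn> \<Longrightarrow> \<exists>K. mpow x K = 0"
    and gen: "has_generic_coadjoint_stabiliser \<nn>"
  shows "has_generic_coadjoint_stabiliser (similar P Q ` \<nn>)"
proof -
  obtain \<Omega> where op: "zariski_open \<nn> \<Omega>" and dense: "zariski_dense \<nn> \<Omega>"
    and conj: "\<And>\<xi> \<eta>. \<xi> \<in> \<Omega> \<Longrightarrow> \<eta> \<in> \<Omega> \<Longrightarrow> conjugate_under (matrix_exp ` \<nn>)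
             (coadjoint_stabiliser \<nn> \<xi>) (coadjoint_stabiliser \<nn> \<eta>)"
    using gen by (auto simp: has_generic_coadjoint_stabiliser_def)
  have sub: "push ` \<Omega> \<subseteq> dual_space (similar P Q ` \<nn>)"
    using op unfolding zariski_open_def dual_space_image_eq [symmetric] by (intro image_mono) blast
  have "zariski_open (similar P Q ` \<nn>) (push ` \<Omega>)"
    unfolding zariski_open_def
  proof (intro conjI sub)
    have "dual_space (similar P Q ` \<nn>) - push ` \<Omega> = push ` (dual_space \<nn> - \<Omega>)"
      unfolding dual_space_image_eq [symmetric] by (rule image_set_diff [OF inj_push, symmetric])
    then show "zariski_closed (similar P Q ` \<nn>) (dual_space (similar P Q ` \<nn>) - push ` \<Omega>)"
      using op zariski_closed_image by (simp add: zariski_open_def)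
  qed
  moreover have "zariski_dense (similar P Q ` \<nn>) (push ` \<Omega>)"
    unfolding zariski_dense_def
  proof (intro conjI sub allI impI)
    fix Z assume Z: "zariski_closed (similar P Q ` \<nn>) Z \<and> push ` \<Omega> \<subseteq> Z"
    let ?Z = "(\<lambda>\<eta>. \<eta> \<circ> similar P Q) ` Z"
    have "zariski_closed \<nn> ?Z"
      using similarity.zariski_closed_image [OF inverse, of "similar P Q ` \<nn>" Z] Z by (simp add: image_cancel)
    moreover have "\<Omega> \<subseteq> ?Z"
    proof
      fix \<xi> assume "\<xi> \<in> \<Omega>"
      then have "push \<xi> \<in> Z" using Z by blast
      then have "push \<xi> \<circ> similar P Q \<in> ?Z" by (rule imageI)
      then show "\<xi> \<in> ?Z" by (simp only: comp_similar_cancel)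
    qed
    ultimately have "?Z = dual_space \<nn>" using dense by (simp add: zariski_dense_def)
    then have "push ` ?Z = dual_space (similar P Q ` \<nn>)" by (simp only: dual_space_image_eq)
    moreover have "push ` ?Z = Z"
      unfolding image_image by (simp add: similarity.comp_similar_cancel [OF inverse])
    ultimately show "Z = dual_space (similar P Q ` \<nn>)" by simp
  qed
  moreover have "conjugate_under (matrix_exp ` similar P Q ` \<nn>)
      (coadjoint_stabiliser (similar P Q ` \<nn>) \<xi>) (coadjoint_stabiliser (similar P Q ` \<nn>) \<eta>)"
    if "\<xi> \<in> push ` \<Omega>" "\<eta> \<in> push ` \<Omega>" for \<xi> \<eta>
  proof -
    from that(1) obtain \<xi>' where "\<xi> = push \<xi>'" "\<xi>' \<in> \<Omega>" by (rule imageE)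
    moreover from that(2) obtain \<eta>' where "\<eta> = push \<eta>'" "\<eta>' \<in> \<Omega>" by (rule imageE)
    ultimately show ?thesis
      by (simp only: coadjoint_stabiliser_image) (intro conjugate_under_image nil conj)
  qed
  ultimately show ?thesis unfolding has_generic_coadjoint_stabiliser_def by blast
qed

end

section \<open>Borel subalgebras of the symplectic Lie algebra\<close>

definition sform :: "complex^('n::finite + 'n) \<Rightarrow> complex^('n + 'n) \<Rightarrow> complex" where
  "sform u v = (\<Sum>i\<in>UNIV. eps i * (u $ i * v $ flip i))"

lemma sum_flip: "(\<Sum>i\<in>UNIV. f (flip i)) = (\<Sum>i\<in>(UNIV :: ('n::finite + 'n) set). f i)"
  by (rule sum.reindex_bij_witness [of _ flip flip]) auto

lemma sform_swap: "sform v u = - sform u v"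
proof -
  have "sform v u = (\<Sum>i\<in>UNIV. eps (flip i) * (v $ flip i * u $ flip (flip i)))"
    unfolding sform_def by (rule sum_flip [symmetric])
  then show ?thesis by (simp add: sform_def sum_negf mult_ac)
qed

lemma sform_add_right: "sform u (v + w) = sform u v + sform u w"
  and sform_scale_right: "sform u (c *s v) = c * sform u v"
  and sform_add_left: "sform (v + w) u = sform v u + sform w u"
  and sform_scale_left: "sform (c *s v) u = c * sform v u"
  and sform_0_right [simp]: "sform u 0 = 0"
  and sform_0_left [simp]: "sform 0 u = 0"
  by (simp_all add: sform_def sum.distrib sum_distrib_left ring_distribs mult_ac)

lemma sform_sum_right: "sform u (\<Sum>i\<in>T. f i) = (\<Sum>i\<in>T. sform u (f i))"
  by (induction T rule: infinite_finite_induct) (auto simp: sform_add_right)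

lemma sform_sum_left: "sform (\<Sum>i\<in>T. f i) u = (\<Sum>i\<in>T. sform (f i) u)"
  by (induction T rule: infinite_finite_induct) (auto simp: sform_add_left)

lemma sform_self [simp]: "sform u u = 0"
  using sform_swap [of u u] by simp

lemma sform_sp:
  fixes x :: "complex^('n::finite + 'n)^('n + 'n)"
  assumes "x \<in> sp"
  shows "sform (x *v u) v = - sform u (x *v v)"
proof -
  have "sform u (x *v v) = (\<Sum>k\<in>UNIV. \<Sum>j\<in>UNIV. eps k * (u $ k * (x $ flip k $ j * v $ j)))"
    by (simp add: sform_def matrix_vector_nth sum_distrib_left)
  also have "\<dots> = (\<Sum>k\<in>UNIV. \<Sum>i\<in>UNIV. eps k * (u $ k * (x $ flip k $ flip i * v $ flip i)))"
    by (rule sum.cong [OF refl]) (rule sum_flip [symmetric])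
  also have "\<dots> = (\<Sum>k\<in>UNIV. \<Sum>i\<in>UNIV. - (eps i * (x $ i $ k * u $ k * v $ flip i)))"
  proof (intro sum.cong refl)
    fix k i :: "'n + 'n"
    have "eps k * (eps i * eps k) = eps i" by (cases i; cases k) auto
    then show "eps k * (u $ k * (x $ flip k $ flip i * v $ flip i)) = - (eps i * (x $ i $ k * u $ k * v $ flip i))"
      using spD [OF assms, of k i] by (simp add: mult_ac)
  qed
  also have "\<dots> = (\<Sum>i\<in>UNIV. \<Sum>k\<in>UNIV. - (eps i * (x $ i $ k * u $ k * v $ flip i)))" by (rule sum.swap)
  also have "\<dots> = - sform (x *v u) v"
    by (simp add: sform_def matrix_vector_nth sum_distrib_left sum_distrib_right sum_negf)
  finally show ?thesis by simp
qed

text \<open>Nondegeneracy in the shape that dual bases need; the vector is explicit because the form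
  is a signed permutation.\<close>

lemma sform_represents: "\<exists>v. \<forall>u. sform u v = (\<Sum>i\<in>UNIV. u $ i * b i)"
proof
  show "\<forall>u. sform u (\<chi> j. eps (flip j) * b (flip j)) = (\<Sum>i\<in>UNIV. u $ i * b i)"
  proof
    fix u :: "complex^('a + 'a)"
    show "sform u (\<chi> j. eps (flip j) * b (flip j)) = (\<Sum>i\<in>UNIV. u $ i * b i)"
      unfolding sform_def
    proof (rule sum.cong [OF refl])
      fix i show "eps i * (u $ i * (\<chi> j. eps (flip j) * b (flip j)) $ flip i) = u $ i * b i"
        by (cases i) auto
    qed
  qed
qed

lemma subspace_perp: "vec.subspace {v. \<forall>u\<in>L. sform u v = 0}"
  by (rule vec.subspaceI) (auto simp: sform_add_right sform_scale_right)

lemma dim_hyperplane: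
  assumes V: "vec.subspace V"
  shows "vec.dim V \<le> Suc (vec.dim {v \<in> V. sform u v = 0})"
proof (cases "\<exists>w\<in>V. sform u w \<noteq> 0")
  case True
  then obtain w where w: "w \<in> V" "sform u w \<noteq> 0" by blast
  let ?H = "{v \<in> V. sform u v = 0}"
  have "V \<subseteq> vec.span (insert w ?H)"
  proof
    fix v assume v: "v \<in> V"
    let ?c = "sform u v / sform u w"
    have "sform u (v + (- ?c) *s w) = 0" using w(2) unfolding sform_add_right sform_scale_right by simp
    moreover have "v + (- ?c) *s w \<in> V" by (intro vec.subspace_add vec.subspace_scale V v w)
    ultimately have "v + (- ?c) *s w \<in> ?H" by blast
    then have "(v + (- ?c) *s w) + ?c *s w \<in> vec.span (insert w ?H)"
      by (intro vec.span_add vec.span_scale vec.span_base) auto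
    then show "v \<in> vec.span (insert w ?H)" by simp
  qed
  then have "vec.dim V \<le> vec.dim (insert w ?H)" by (rule vec.dim_mono)
  also have "\<dots> \<le> Suc (vec.dim ?H)" by (simp add: vec.dim_insert)
  finally show ?thesis .
next
  case False
  then have "{v \<in> V. sform u v = 0} = V" by blast
  then show ?thesis by simp
qed

text \<open>Each vector imposes one linear condition. For k < n the perpendicular space has
  dimension at least 2n - k > k, the surplus that lets an isotropic flag grow.\<close>

lemma dim_perp:
  fixes e :: "nat \<Rightarrow> complex^('n::finite + 'n)"
  shows "2 * CARD('n) \<le> vec.dim {v. \<forall>u\<in>e ` {..<k}. sform u v = 0} + k"
proof (induction k)
  case 0
  have "vec.dim (UNIV :: (complex^('n + 'n)) set) = 2 * CARD('n)"
    unfolding vec_dim_card by (simp add: card_sum)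
  moreover have "{v. \<forall>u\<in>e ` {..<0}. sform u v = 0} = UNIV" by simp
  ultimately show ?case by (simp only:)
next
  case (Suc k)
  have "{v. \<forall>u\<in>e ` {..<Suc k}. sform u v = 0} = {v \<in> {v. \<forall>u\<in>e ` {..<k}. sform u v = 0}. sform (e k) v = 0}"
    by (auto simp: less_Suc_eq)
  then show ?case using Suc dim_hyperplane [OF subspace_perp, of "e ` {..<k}" "e k"] by simp
qed

lemma span_invariant:
  fixes e :: "nat \<Rightarrow> complex^'m::finite"
  assumes "\<And>i. i < (k::nat) \<Longrightarrow> x *v e i \<in> vec.span (e ` {..i})" "w \<in> vec.span (e ` {..<k})"
  shows "x *v w \<in> vec.span (e ` {..<k})"
  using assms(2)
proof (induction rule: vec.span_induct_alt)
  case base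
  then show ?case by (simp add: vec.span_zero)
next
  case (step c u z)
  then obtain i where i: "i < k" "u = e i" by auto
  have "e ` {..i} \<subseteq> e ` {..<k}" using i by (intro image_mono) auto
  then have "x *v u \<in> vec.span (e ` {..<k})"
    using assms(1) [OF i(1)] vec.span_mono i(2) by blast
  then show ?case using step(2)
    by (simp add: matrix_vector_right_distrib mult_vector_scale vec.span_add vec.span_scale)
qed

text \<open>The next vector is taken from ?M outside ?L, the perpendicular space and the span of the
  flag so far: lying in ?M keeps the flag isotropic, and both spaces are stable under \<bb>.\<close>

lemma isotropic_flag:
  fixes \<bb> :: "(complex^('n::finite + 'n)^('n + 'n)) set"
  assumes b: "lie_subalgebra \<bb>" "\<bb> \<subseteq> sp" "lie_solvable \<bb>" and k: "k \<le> CARD('n)"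
  shows "\<exists>e. (\<forall>i<k. \<forall>j<k. sform (e i) (e j) = 0) \<and> (\<forall>i<k. e i \<notin> vec.span (e ` {..<i}))
    \<and> (\<forall>x\<in>\<bb>. \<forall>i<k. x *v e i \<in> vec.span (e ` {..i}))"
  using k
proof (induction k)
  case 0
  then show ?case by simp
next
  case (Suc k)
  have "k \<le> CARD('n)" using Suc.prems by simp
  from Suc.IH [OF this] obtain e where E: "\<forall>i<k. \<forall>j<k. sform (e i) (e j) = 0"
    "\<forall>i<k. e i \<notin> vec.span (e ` {..<i})" "\<forall>x\<in>\<bb>. \<forall>i<k. x *v e i \<in> vec.span (e ` {..i})"
    by (elim exE conjE)
  then have iso: "\<And>i j. i < k \<Longrightarrow> j < k \<Longrightarrow> sform (e i) (e j) = 0"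
    and indep: "\<And>i. i < k \<Longrightarrow> e i \<notin> vec.span (e ` {..<i})"
    and stable: "\<And>x i. x \<in> \<bb> \<Longrightarrow> i < k \<Longrightarrow> x *v e i \<in> vec.span (e ` {..i})" by blast+
  let ?L = "vec.span (e ` {..<k})" and ?M = "{v. \<forall>u\<in>e ` {..<k}. sform u v = 0}"
  have "?L \<subseteq> ?M" by (rule vec.span_minimal [OF _ subspace_perp]) (use iso in auto)
  \<comment> \<open>The dimension of ?L is at most k, that of ?M at least 2n - k, and k < n.\<close>
  moreover have "?L \<noteq> ?M"
  proof
    assume "?L = ?M"
    then have "vec.dim ?M \<le> vec.dim (e ` {..<k})" by (metis vec.dim_span order_refl)
    also have "\<dots> \<le> card (e ` {..<k})" by (rule vec.dim_le_card') simp
    also have "\<dots> \<le> k" using card_image_le [of "{..<k}" e] by simp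
    finally show False using dim_perp [of e k] Suc.prems by linarith
  qed
  ultimately have LM: "?L \<subset> ?M" by blast
  obtain K where K: "derived_series \<bb> K = {0}" using b(3) by (auto simp: lie_solvable_def)
  have invL: "x *v w \<in> ?L" if "x \<in> \<bb>" "w \<in> ?L" for x w
    using span_invariant [OF stable [OF that(1)] that(2)] .
  \<comment> \<open>Elements of \<open>sp\<close> are skew for the form, so the perpendicular space
    of an invariant space is invariant.\<close>
  have invM: "x *v w \<in> ?M" if "x \<in> \<bb>" "w \<in> ?M" for x w
  proof -
    have w: "sform u w = 0" if "u \<in> ?L" for u
    proof -
      have "?L \<subseteq> {u. sform w u = 0}"
        by (rule vec.span_minimal)
          (use \<open>w \<in> ?M\<close> sform_swap [of w] in \<open>auto intro!: vec.subspaceI simp: sform_add_left sform_scale_left\<close>)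
      then show ?thesis using that sform_swap [of u w] by auto
    qed
    have "sform (e i) (x *v w) = 0" if "i < k" for i
    proof -
      have "x *v e i \<in> ?L" by (rule invL [OF \<open>x \<in> \<bb>\<close>]) (use that in \<open>auto intro: vec.span_base\<close>)
      then show ?thesis using sform_sp [of x "e i" w] w b(2) \<open>x \<in> \<bb>\<close> by auto
    qed
    then show ?thesis by auto
  qed
  obtain v \<kappa> where v: "v \<in> ?M" "v \<notin> ?L" and eig: "\<And>x. x \<in> \<bb> \<Longrightarrow> x *v v - \<kappa> x *s v \<in> ?L"
    using lie_theorem [OF b(1) K vec.subspace_span subspace_perp LM invL invM] by blast
  define e' where "e' = e (k := v)"
  have e'_lt: "e' i = e i" if "i < k" for i using that by (simp add: e'_def)
  have img: "e' ` {..<i} = e ` {..<i}" if "i \<le> k" for i using that by (auto simp: e'_def)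
  have img': "e' ` {..i} = e ` {..i}" if "i < k" for i using that by (auto simp: e'_def)
  have "sform (e' i) (e' j) = 0" if "i < Suc k" "j < Suc k" for i j
  proof -
    have "sform (e i) v = 0" "sform v (e i) = 0" if "i < k" for i
      using v(1) that sform_swap [of v "e i"] by auto
    then show ?thesis using that iso [of i j] by (cases "i = k"; cases "j = k") (auto simp: e'_def less_Suc_eq)
  qed
  moreover have "e' i \<notin> vec.span (e' ` {..<i})" if "i < Suc k" for i
    using that indep [of i] v(2) img [of i] by (cases "i = k") (auto simp: e'_def)
  moreover have "x *v e' i \<in> vec.span (e' ` {..i})" if "x \<in> \<bb>" "i < Suc k" for x i
  proof (cases "i = k")
    case True
    have "e' ` {..k} = insert v (e ` {..<k})" by (auto simp: e'_def image_iff le_less)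
    moreover have "(x *v v - \<kappa> x *s v) + \<kappa> x *s v \<in> vec.span (insert v (e ` {..<k}))"
      using eig [OF that(1)] vec.span_mono [of "e ` {..<k}" "insert v (e ` {..<k})"]
      by (intro vec.span_add vec.span_scale) (auto intro: vec.span_base)
    ultimately show ?thesis using True by (simp add: e'_def)
  next
    case False
    then show ?thesis using stable [OF that(1), of i] that(2) img' [of i] e'_lt [of i] by simp
  qed
  ultimately show ?case by (intro exI [of _ e']) blast
qed

text \<open>A left inverse of the matrix with columns \<open>e\<close> provides vectors g dual to
  \<open>e\<close>, with arbitrary pairings among themselves. Adding combinations of the mutually
  orthogonal \<open>e\<close> repairs these pairings without disturbing the duality.\<close>

lemma symplectic_completion:
  fixes e :: "'n::finite \<Rightarrow> complex^('n + 'n)"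
  assumes iso: "\<And>a b. sform (e a) (e b) = 0" and indep: "\<And>c. (\<Sum>a\<in>UNIV. c a *s e a) = 0 \<Longrightarrow> \<forall>a. c a = 0"
  obtains f where "\<And>a b. sform (e a) (f b) = (if a = b then 1 else 0)" "\<And>a b. sform (f a) (f b) = 0"
proof -
  define E where "E = (\<chi> i a. e a $ i)"
  have E: "E *v c = (\<Sum>a\<in>UNIV. c $ a *s e a)" for c
    by (simp add: vec_eq_iff E_def matrix_vector_nth mult.commute)
  have "inj ((*v) E)"
  proof (rule injI)
    fix c d assume "E *v c = E *v d"
    then have "E *v (c - d) = 0" by (simp add: matrix_vector_mult_diff_distrib)
    then show "c = d" using indep [of "\<lambda>a. (c - d) $ a"] unfolding E by (simp add: vec_eq_iff)
  qed
  then obtain B where B: "B ** E = mat 1" by (metis matrix_left_invertible_injective)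
  have "\<exists>v. \<forall>u. sform u v = (\<Sum>i\<in>UNIV. u $ i * B $ b $ i)" for b by (rule sform_represents)
  then obtain g where g: "\<And>b u. sform u (g b) = (\<Sum>i\<in>UNIV. u $ i * B $ b $ i)" by metis
  have eg: "sform (e a) (g b) = (if a = b then 1 else 0)" for a b
  proof -
    have "sform (e a) (g b) = (B ** E) $ b $ a" by (simp add: g matrix_matrix_mult_def E_def mult.commute)
    then show ?thesis by (simp add: B mat_def)
  qed
  have ge: "sform (g b) (e a) = (if a = b then -1 else 0)" for a b
    using eg [of a b] sform_swap [of "g b" "e a"] by simp
  \<comment> \<open>The factor 1/2 is there because the correction acts twice, through f a and
    through f b, each time removing half of \<open>sform (g a) (g b)\<close>.\<close>
  define f where "f = (\<lambda>a. g a + (\<Sum>b\<in>UNIV. (- sform (g a) (g b) / 2) *s e b))"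
  have "sform (e a) (f b) = (if a = b then 1 else 0)" for a b
    unfolding f_def sform_add_right sform_sum_right sform_scale_right iso eg by simp
  moreover have "sform (f a) (f b) = 0" for a b
  proof -
    have 1: "sform (g a) (\<Sum>d\<in>UNIV. (- sform (g b) (g d) / 2) *s e d) = sform (g b) (g a) / 2"
      unfolding sform_sum_right sform_scale_right ge
      by (simp add: if_distrib [of "\<lambda>x. _ * x"] cong: if_cong)
    have 2: "sform (\<Sum>d\<in>UNIV. (- sform (g a) (g d) / 2) *s e d) (g b) = - sform (g a) (g b) / 2"
      unfolding sform_sum_left sform_scale_left eg
      by (simp add: if_distrib [of "\<lambda>x. _ * x"] cong: if_cong)
    have 3: "sform (\<Sum>d\<in>UNIV. (- sform (g a) (g d) / 2) *s e d) (\<Sum>d\<in>UNIV. (- sform (g b) (g d) / 2) *s e d) = 0"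
      unfolding sform_sum_left sform_sum_right sform_scale_left sform_scale_right iso by simp
    show ?thesis
      unfolding f_def sform_add_left sform_add_right 1 2 3 using sform_swap [of "g b" "g a"] by simp
  qed
  ultimately show ?thesis using that by blast
qed

section \<open>Symplectic matrices\<close>

lemma transpose_symplectic_form: "transpose symplectic_form = - symplectic_form"
  by (auto simp: vec_eq_iff transpose_nth symplectic_form_nth)

lemma symplectic_form_square: "symplectic_form ** symplectic_form = - (mat 1 :: complex^('n::finite + 'n)^('n + 'n))"
proof -
  have "(symplectic_form ** symplectic_form) $ i $ j = (- mat 1) $ i $ j" for i j :: "'n + 'n"
  proof -
    have "(symplectic_form ** symplectic_form) $ i $ j
        = (\<Sum>k\<in>UNIV. if k = flip i then if j = i then -1 else 0 else 0)"
      unfolding matrix_mult_nth by (rule sum.cong) (auto simp: symplectic_form_nth)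
    then show ?thesis by (simp add: mat_def)
  qed
  then show ?thesis by (simp add: matrix_eq_iff)
qed

lemma similar_sp:
  assumes g: "transpose g ** symplectic_form ** g = symplectic_form" and gh: "g ** h = mat 1" and x: "x \<in> sp"
  shows "similar h g x \<in> sp" "transpose h ** symplectic_form ** h = symplectic_form"
proof -
  let ?J = symplectic_form
  have "transpose g ** ?J = transpose g ** ?J ** (g ** h)" by (simp add: gh)
  also have "\<dots> = ?J ** h" using g by (simp add: matrix_mul_assoc)
  finally have Jh: "?J ** h = transpose g ** ?J" by simp
  then have "transpose (?J ** h) = transpose (transpose g ** ?J)" by simp
  then have hJ: "transpose h ** ?J = ?J ** g"
    unfolding matrix_transpose_mul transpose_symplectic_form transpose_transpose
    by (simp add: matrix_mult_minus_left matrix_mult_minus_right)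
  have "transpose h ** ?J ** h = ?J ** (g ** h)" by (simp add: hJ matrix_mul_assoc)
  then show "transpose h ** ?J ** h = ?J" by (simp add: gh)
  have x0: "transpose x ** ?J + ?J ** x = 0" using x by (simp add: sp_def)
  have "transpose (similar h g x) ** ?J = transpose g ** transpose x ** (transpose h ** ?J)"
    by (simp add: similar_def matrix_transpose_mul matrix_mul_assoc)
  also have "\<dots> = transpose g ** (transpose x ** ?J) ** g" by (simp add: hJ matrix_mul_assoc)
  finally have 1: "transpose (similar h g x) ** ?J = transpose g ** (transpose x ** ?J) ** g" .
  have "?J ** similar h g x = (?J ** h) ** x ** g" by (simp add: similar_def matrix_mul_assoc)
  also have "\<dots> = transpose g ** (?J ** x) ** g" by (simp add: Jh matrix_mul_assoc)
  finally have "transpose (similar h g x) ** ?J + ?J ** similar h g x = transpose g ** (transpose x ** ?J + ?J ** x) ** g"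
    by (simp only: 1 matrix_add_ldistrib matrix_add_rdistrib)
  then show "similar h g x \<in> sp" by (simp add: x0 sp_def)
qed

lemma symplectic_basis_matrix:
  fixes c :: "'n::finite + 'n \<Rightarrow> complex^('n + 'n)"
  assumes c: "\<And>i j. sform (c i) (c j) = symplectic_form $ i $ j"
  defines "P \<equiv> \<chi> i j. c j $ i"
  shows "transpose P ** symplectic_form ** P = symplectic_form"
proof -
  have "(transpose P ** symplectic_form ** P) $ i $ j = sform (c i) (c j)" for i j
  proof -
    have "(symplectic_form ** P) $ k $ j = eps k * c j $ flip k" for k
      unfolding matrix_mult_nth
      by (subst sum.cong [OF refl, of _ _ "\<lambda>m. if m = flip k then eps k * c j $ flip k else 0"])
        (auto simp: symplectic_form_nth P_def)
    then show ?thesis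
      unfolding matrix_mul_assoc [symmetric] matrix_mult_nth [of "transpose P"]
      by (simp add: transpose_nth P_def sform_def mult_ac)
  qed
  then show ?thesis by (simp add: matrix_eq_iff c)
qed

text \<open>\<open>symplectic_form\<close> squares to -1, which makes ?Q a left inverse of
  \<open>P\<close>.\<close>

lemma symplectic_inverse:
  fixes P :: "complex^('n::finite + 'n)^('n + 'n)"
  assumes "transpose P ** symplectic_form ** P = symplectic_form"
  obtains Q where "P ** Q = mat 1" "Q ** P = mat 1"
proof -
  let ?Q = "- (symplectic_form ** transpose P ** symplectic_form)"
  have "?Q ** P = - (symplectic_form ** (transpose P ** symplectic_form ** P))"
    by (simp add: matrix_mult_minus_left matrix_mul_assoc)
  also have "\<dots> = mat 1" by (simp add: assms symplectic_form_square)
  finally have 1: "?Q ** P = mat 1" .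
  then have 2: "P ** ?Q = mat 1" by (rule matrix_left_right_inverse [THEN iffD1])
  show ?thesis by (rule that [OF 2 1])
qed

section \<open>Solvability of the standard Borel subalgebra\<close>

context symplectic_order
begin

lemma lie_subalgebra_std_borel: "lie_subalgebra std_borel"
  unfolding lie_subalgebra_def
proof (intro conjI ballI)
  show "gl.subspace std_borel" unfolding std_borel_def by (intro gl.subspace_inter sp_subspace subspace_pattern)
  fix x y assume "x \<in> std_borel" "y \<in> std_borel"
  then show "lie_bracket x y \<in> std_borel"
    using pattern_bracket [of x rk 0 y 0] sp_bracket [of x y] by (simp add: std_borel_def)
qed

text \<open>The diagonal of a product of triangular matrices is the product of the diagonals, so a
  commutator has diagonal 0; as \<open>rk\<close> is injective, it is then strictly raising.\<close>

lemma bracket_std_borel: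
  assumes "x \<in> std_borel" "y \<in> std_borel"
  shows "lie_bracket x y \<in> pattern (\<lambda>i j. rk i + 1 \<le> rk j)"
proof (rule patternI)
  fix i j assume nz: "lie_bracket x y $ i $ j \<noteq> 0"
  have x: "rk a \<le> rk b" if "x $ a $ b \<noteq> 0" for a b using assms(1) that patternD by (auto simp: std_borel_def)
  have y: "rk a \<le> rk b" if "y $ a $ b \<noteq> 0" for a b using assms(2) that patternD by (auto simp: std_borel_def)
  have "lie_bracket x y \<in> std_borel" using lie_subalgebra_std_borel assms by (auto simp: lie_subalgebra_def)
  then have "rk i \<le> rk j" using patternD nz unfolding std_borel_def by blast
  moreover have "i \<noteq> j"
  proof
    assume "i = j"
    have diag: "(u ** v) $ i $ i = u $ i $ i * v $ i $ i"
      if u: "\<And>a b. u $ a $ b \<noteq> 0 \<Longrightarrow> rk a \<le> rk b" and v: "\<And>a b. v $ a $ b \<noteq> 0 \<Longrightarrow> rk a \<le> rk b"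
      for u v :: "complex^('n + 'n)^('n + 'n)"
    proof -
      have "u $ i $ k * v $ k $ i = (if k = i then u $ i $ i * v $ i $ i else 0)" for k
      proof (cases "k = i")
        case False
        then have "rk k \<noteq> rk i" using inj_rk by (auto dest: injD)
        then have "u $ i $ k = 0 \<or> v $ k $ i = 0" using u [of i k] v [of k i] by force
        then show ?thesis using False by auto
      qed simp
      then have "(\<Sum>k\<in>UNIV. u $ i $ k * v $ k $ i) = (\<Sum>k\<in>UNIV. if k = i then u $ i $ i * v $ i $ i else 0)"
        by (intro sum.cong refl)
      then show ?thesis by (simp add: matrix_mult_nth)
    qed
    show False using nz \<open>i = j\<close> diag [OF x y] diag [OF y x] by (simp add: lie_bracket_def)
  qed
  ultimately show "rk i + 1 \<le> rk j" using inj_rk by (metis Suc_eq_plus1 Suc_leI injD le_neq_implies_less)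
qed

lemma lie_solvable_std_borel: "lie_solvable std_borel"
proof -
  have sub: "derived_series std_borel (Suc k) \<subseteq> pattern (\<lambda>i j. rk i + Suc k \<le> rk j)" for k
  proof (induction k)
    case 0
    show ?case using bracket_std_borel unfolding derived_series.simps
      by (intro bracket_span_minimal subspace_pattern) simp
  next
    case (Suc k)
    show ?case unfolding derived_series.simps(2) [of _ "Suc k"]
    proof (rule bracket_span_minimal [OF _ subspace_pattern])
      fix x y assume "x \<in> derived_series std_borel (Suc k)" "y \<in> derived_series std_borel (Suc k)"
      then have "lie_bracket x y \<in> pattern (\<lambda>i j. rk i + (Suc k + Suc k) \<le> rk j)"
        using Suc by (intro pattern_bracket) auto
      then show "lie_bracket x y \<in> pattern (\<lambda>i j. rk i + Suc (Suc k) \<le> rk j)"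
        by (intro patternI) (drule (1) patternD, linarith)
    qed
  qed
  have "pattern (\<lambda>i j. rk i + Suc (Max (range rk)) \<le> rk j) = {0}"
  proof -
    have "\<not> rk i + Suc (Max (range rk)) \<le> rk j" for i j
    proof -
      have "rk j \<le> Max (range rk)" by (rule Max_ge) auto
      then show ?thesis by linarith
    qed
    then show ?thesis by (auto simp: pattern_def matrix_eq_iff)
  qed
  then have "derived_series std_borel (Suc (Max (range rk))) \<subseteq> {0}" using sub by metis
  moreover have "0 \<in> derived_series std_borel (Suc k)" for k
    by (auto intro: gl.subspace_0 subspace_bracket_span)
  ultimately show ?thesis unfolding lie_solvable_def by blast
qed

end

section \<open>Reduction of an arbitrary Borel subalgebra to the standard one\<close>

lemma (in std_parabolic) nilradical_nilpotent_elements: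
  assumes "x \<in> nilradical \<pp>"
  shows "\<exists>K. mpow x K = 0"
proof -
  have "lev i < lev j" if "x $ i $ j \<noteq> 0" for i j
    using assms that patternD unfolding nilradical_eq_strict strict_def by blast
  then have "x \<in> raising lev UNIV 1" by (intro raisingI) (simp add: Suc_le_eq)
  then have "mpow x (Suc (Max (range lev))) = 0"
    by (rule mpow_raising_eq_0) (auto simp: le_imp_less_Suc)
  then show ?thesis by blast
qed

theorem theorem5p3:
  fixes \<bb> \<pp> :: "(complex^('n::finite + 'n)^('n + 'n)) set"
  assumes "borel_subalgebra \<bb> sp"
    and "standard_parabolic \<pp> \<bb> sp"
  shows "has_generic_coadjoint_stabiliser (nilradical \<pp>)"
proof -
  have b: "lie_subalgebra \<bb>" "\<bb> \<subseteq> sp" "lie_solvable \<bb>"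
    and max: "\<And>\<ss>. lie_subalgebra \<ss> \<Longrightarrow> \<ss> \<subseteq> sp \<Longrightarrow> lie_solvable \<ss> \<Longrightarrow> \<bb> \<subseteq> \<ss> \<Longrightarrow> \<ss> = \<bb>"
    using assms(1) by (auto simp: borel_subalgebra_def)
  let ?N = "CARD('n)"
  obtain e where iso: "\<And>i j. i < ?N \<Longrightarrow> j < ?N \<Longrightarrow> sform (e i) (e j) = 0"
    and indep: "\<And>i. i < ?N \<Longrightarrow> e i \<notin> vec.span (e ` {..<i})"
    and stable: "\<And>x i. x \<in> \<bb> \<Longrightarrow> i < ?N \<Longrightarrow> x *v e i \<in> vec.span (e ` {..i})"
    using isotropic_flag [OF b order_refl] by blast
  obtain f :: "'n \<Rightarrow> nat" where "bij_betw f UNIV {0..<?N}"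
    using ex_bij_betw_finite_nat [of "UNIV :: 'n set"] by auto
  then have f: "inj f" "range f = {..<?N}" by (auto simp: bij_betw_def)
  then have fN: "f a < ?N" for a by blast
  \<comment> \<open>In a nontrivial relation, the vector latest in the flag would lie in the span of
    the earlier ones.\<close>
  have lin: "\<forall>a. c a = 0" if sum0: "(\<Sum>a\<in>UNIV. c a *s e (f a)) = 0" for c
  proof (rule ccontr)
    assume "\<not> (\<forall>a. c a = 0)"
    then obtain a0 where "c a0 \<noteq> 0" by blast
    then obtain a where a: "c a \<noteq> 0" and max: "\<And>b. c b \<noteq> 0 \<Longrightarrow> f b \<le> f a"
      using ex_has_greatest_nat [of "\<lambda>a. c a \<noteq> 0" a0 f ?N] fN less_imp_le by metis
    have "c a *s e (f a) + (\<Sum>b\<in>UNIV - {a}. c b *s e (f b)) = 0"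
      using sum0 by (simp add: sum.remove [of UNIV a])
    then have ca: "c a *s e (f a) = - (\<Sum>b\<in>UNIV - {a}. c b *s e (f b))" by (simp add: eq_neg_iff_add_eq_0)
    have "c b *s e (f b) \<in> vec.span (e ` {..<f a})" if "b \<noteq> a" for b
    proof (cases "c b = 0")
      case True
      then show ?thesis by (simp add: vec.span_zero)
    next
      case False
      have "f b \<noteq> f a" using that f(1) by (auto dest: injD)
      then have "f b < f a" using max [OF False] by simp
      then show ?thesis by (intro vec.span_scale vec.span_base) auto
    qed
    then have "- (\<Sum>b\<in>UNIV - {a}. c b *s e (f b)) \<in> vec.span (e ` {..<f a})"
      by (intro vec.span_neg vec.span_sum) auto
    then have "(1 / c a) *s (c a *s e (f a)) \<in> vec.span (e ` {..<f a})"
      unfolding ca by (rule vec.span_scale)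
    then show False using indep [OF fN, of a] a by (simp add: vector_smult_assoc)
  qed
  have iso': "sform (e (f a)) (e (f b)) = 0" for a b using iso fN by blast
  obtain g where eg: "\<And>a b. sform (e (f a)) (g b) = (if a = b then 1 else 0)" and gg: "\<And>a b. sform (g a) (g b) = 0"
    using symplectic_completion [of "\<lambda>a. e (f a)", OF iso' lin] by (smt (verit, best))
  define c where "c = case_sum (\<lambda>a. e (f a)) g"
  have c_Inl: "c (Inl a) = e (f a)" and c_Inr: "c (Inr a) = g a" for a by (simp_all add: c_def)
  have ge: "sform (g b) (e (f a)) = (if a = b then -1 else 0)" for a b
    using eg [of a b] sform_swap [of "g b" "e (f a)"] by simp
  have c: "sform (c i) (c j) = symplectic_form $ i $ j" for i j
    by (cases i; cases j) (simp_all add: c_Inl c_Inr symplectic_form_nth iso' eg ge gg eq_commute)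
  define P where "P = (\<chi> i j. c j $ i)"
  have P: "transpose P ** symplectic_form ** P = symplectic_form"
    unfolding P_def by (rule symplectic_basis_matrix [OF c])
  obtain Q where PQ: "P ** Q = mat 1" "Q ** P = mat 1" using symplectic_inverse [OF P] .
  interpret S: similarity P Q by unfold_locales (rule PQ)
  have Q: "transpose Q ** symplectic_form ** Q = symplectic_form"
    by (rule similar_sp(2) [OF P PQ(1) gl.subspace_0 [OF sp_subspace]])
  have QP_sp: "similar Q P x \<in> sp" if "x \<in> sp" for x using similar_sp(1) [OF P PQ(1) that] .
  have PQ_sp: "similar P Q x \<in> sp" if "x \<in> sp" for x using similar_sp(1) [OF Q PQ(2) that] .
  \<comment> \<open>Flag order on the isotropic half, then the dual vectors in reverse: 2n - f a is
    larger than n and thus than every value of \<open>f\<close>, and the reflection makes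
    \<open>flip\<close> reverse the order.\<close>
  define rk :: "'n + 'n \<Rightarrow> nat" where "rk = case_sum f (\<lambda>a. 2 * ?N - f a)"
  have rk: "rk (Inl a) = f a" "rk (Inr a) = 2 * ?N - f a" for a by (simp_all add: rk_def)
  interpret O: symplectic_order rk
  proof
    show "inj rk"
    proof (rule injI)
      fix i j assume eq: "rk i = rk j"
      show "i = j"
      proof (cases i; cases j)
        fix a b assume "i = Inl a" "j = Inl b"
        then show ?thesis using eq injD [OF f(1), of a b] by (simp add: rk)
      next
        fix a b assume "i = Inl a" "j = Inr b"
        then show ?thesis using eq fN [of a] fN [of b] by (simp add: rk)
      next
        fix a b assume "i = Inr a" "j = Inl b"
        then show ?thesis using eq fN [of a] fN [of b] by (simp add: rk)
      next
        fix a b assume ij: "i = Inr a" "j = Inr b"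
        then have "f a = f b" using eq fN [of a] fN [of b] by (simp add: rk)
        then show ?thesis using ij injD [OF f(1)] by simp
      qed
    qed
    show "rk i < rk j \<longleftrightarrow> rk (flip j) < rk (flip i)" for i j
    proof -
      obtain a where a: "i = Inl a \<or> i = Inr a" by (cases i) auto
      obtain b where b: "j = Inl b \<or> j = Inr b" by (cases j) auto
      have "rk i < rk j \<longleftrightarrow> rk (flip j) < rk (flip i)" if "f a < ?N" "f b < ?N"
        using a b that by (elim disjE) (simp_all add: rk, linarith+)
      then show ?thesis using fN by blast
    qed
    show "rk (Inl a) < rk (Inr b)" for a b using fN [of a] fN [of b] by (simp add: rk)
  qed
  let ?b = "O.std_borel"
  have b_sub: "\<bb> \<subseteq> similar P Q ` ?b"
  proof
    fix x assume x: "x \<in> \<bb>"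
    let ?y = "similar Q P x"
    have "?y \<in> sp" using x b(2) QP_sp by blast
    \<comment> \<open>Entries of the transported matrix are read off by pairing with the symplectic
      basis.\<close>
    have coeff: "sform (c i) (x *v c j) = eps i * ?y $ flip i $ j" for i j
    proof -
      have col: "A *v c j = (\<chi> i. (A ** P) $ i $ j)" for A
        by (simp add: vec_eq_iff matrix_vector_nth matrix_mult_nth P_def)
      have "x ** P = P ** ?y" by (simp add: similar_def matrix_mul_assoc PQ(1))
      then have "x *v c j = (\<Sum>k\<in>UNIV. ?y $ k $ j *s c k)"
        by (simp add: col vec_eq_iff matrix_mult_nth P_def mult.commute)
      then have "sform (c i) (x *v c j) = (\<Sum>k\<in>UNIV. ?y $ k $ j * symplectic_form $ i $ k)"
        by (simp only: sform_sum_right sform_scale_right c)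
      also have "\<dots> = (\<Sum>k\<in>UNIV. if k = flip i then eps i * ?y $ flip i $ j else 0)"
        by (rule sum.cong) (auto simp: symplectic_form_nth)
      finally show ?thesis by simp
    qed
    have x_e: "sform u (x *v e (f a)) = 0" if u: "\<And>i. i \<le> f a \<Longrightarrow> sform u (e i) = 0" for u a
    proof -
      have "vec.span (e ` {..f a}) \<subseteq> {v. sform u v = 0}"
        by (rule vec.span_minimal) (use u in \<open>auto intro!: vec.subspaceI simp: sform_add_right sform_scale_right\<close>)
      then show ?thesis using stable [OF x fN] by blast
    qed
    \<comment> \<open>The vector dual to a later flag vector annihilates the part of the flag into
      which x maps.\<close>
    have Inl: "f b \<le> f a" if nz: "?y $ Inl b $ Inl a \<noteq> 0" for a b
    proof (rule ccontr)
      assume less: "\<not> f b \<le> f a"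
      have "sform (g b) (e i) = 0" if "i \<le> f a" for i
      proof -
        have "i \<in> range f" unfolding f(2) using that fN [of a] by simp
        then obtain d where d: "i = f d" by blast
        then have "d \<noteq> b" using that less by auto
        then show ?thesis by (simp add: d ge)
      qed
      from x_e [OF this] show False using coeff [of "Inr b" "Inl a"] nz by (simp add: c_Inl c_Inr)
    qed
    \<comment> \<open>x maps the flag into itself, and the form vanishes there.\<close>
    have Inr: "?y $ Inr b $ Inl a = 0" for a b
    proof -
      have "sform (e (f b)) (e i) = 0" if "i \<le> f a" for i
        using iso [of "f b" i] fN [of b] fN [of a] that by simp
      from x_e [OF this] show ?thesis using coeff [of "Inl b" "Inl a"] by (simp add: c_Inl)
    qed
    have "rk i \<le> rk j" if nz: "?y $ i $ j \<noteq> 0" for i j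
    proof (cases i; cases j)
      fix a b assume "i = Inl a" "j = Inl b"
      then show ?thesis using Inl nz by (simp add: rk)
    next
      fix a b assume "i = Inl a" "j = Inr b"
      then show ?thesis using O.rk_Inl_Inr [of a b] by simp
    next
      fix a b assume "i = Inr a" "j = Inl b"
      then show ?thesis using Inr nz by simp
    next
      fix a b assume ij: "i = Inr a" "j = Inr b"
      \<comment> \<open>The lower right block is minus the transpose of the upper left one, and
        \<open>rk\<close> runs backwards on it.\<close>
      then have "?y $ Inl b $ Inl a \<noteq> 0" using nz spD [OF \<open>?y \<in> sp\<close>, where i = "Inl b" and j = "Inl a"] by simp
      from Inl [OF this] show ?thesis using ij by (simp add: rk diff_le_mono2)
    qed
    then have "?y \<in> ?b" unfolding O.std_borel_def using \<open>?y \<in> sp\<close> by (blast intro: patternI)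
    then show "x \<in> similar P Q ` ?b" by (simp add: S.mem_image_iff)
  qed
  \<comment> \<open>Maximality of \<bb> among solvable subalgebras turns the inclusion into an
    equality.\<close>
  have "similar P Q ` ?b = \<bb>"
    using b_sub PQ_sp
    by (intro max S.lie_subalgebra_image S.lie_solvable_image O.lie_subalgebra_std_borel O.lie_solvable_std_borel)
      (auto simp: O.std_borel_def)
  then have b_eq: "?b = similar Q P ` \<bb>" using S.image_cancel by metis
  define \<qq> where "\<qq> = similar Q P ` \<pp>"
  have p_eq: "\<pp> = similar P Q ` \<qq>"
    unfolding \<qq>_def by (simp add: similarity.image_cancel [OF S.inverse])
  have "standard_parabolic \<qq> ?b sp"
    using assms(2) QP_sp unfolding standard_parabolic_def b_eq \<qq>_def
    by (auto intro: similarity.lie_subalgebra_image [OF S.inverse])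
  then interpret R: std_parabolic rk \<qq> by unfold_locales
  show ?thesis
    unfolding p_eq S.nilradical_image
    by (intro S.generic_stabiliser_image R.nilradical_nilpotent_elements R.generic_stabiliser_nilradical)
qed

end
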